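(* Let $X$ be a topological space and let $\mathcal H=(\mathcal H_j)_{j\ge 0}$ be a sheaf of AQ central series on $X$ with successive quotients $\mathcal A_j=\mathcal H_j/\mathcal H_{j+1}$. Then for each $j$ there is a complex of pointed sets $$H^0(X,\mathcal A_j)\xrightarrow{\ \partial^1_{j+1}\ }H^1(X,\mathcal A_{j+1})\xrightarrow{\ \partial^2_{j+2}\ }H^2(X,\mathcal A_{j+2}),$$ where $\partial^1_{j+1}$ and $\partial^2_{j+2}$ are the maps of pointed sets described in the context; that is, the composition $\partial^2_{j+2}\circ\partial^1_{j+1}$ is trivial (sends everything to the base-point) for each $j$.
   Context: A sheaf of AQ normal series on $X$ is a finite descending collection of sheaves of groups $\mathcal G=\mathcal H_0\supseteq \mathcal H_1\supseteq\cdots\supseteq\mathcal H_N=\{e\}$ on $X$ (put $\mathcal H_j=\{e\}$ for $j\ge N$) such that each $\mathcal H_j$ is a sheaf of normal subgroups of $\mathcal G$ and each quotient $\mathcal A_j=\mathcal H_j/\mathcal H_{j+1}$ is a sheaf of abelian groups. It is central (an AQ central series) if for each $j>0$ there exists some $k<j$ such that the short exact sequence $\{e\}\to\mathcal A_j\to\mathcal H_k/\mathcal H_{j+1}\to\mathcal H_k/\mathcal H_j\to\{e\}$ is central, i.e. $\mathcal A_j$ lies in the centre of $\mathcal H_k/\mathcal H_{j+1}$. For a sheaf of (possibly non-abelian) groups, $H^0$ is the group of global sections and $\check H^1$ is the non-abelian Čech cohomology pointed set. A short exact sequence of sheaves of groups induces a long exact sequence of pointed sets in degrees $0,1$, which extends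 by a connecting map to degree $2$ when the sequence is central. The map $\partial^1_{j+1}$ is the composite $H^0(X,\mathcal A_j)\to H^0(X,\mathcal H_k/\mathcal H_{j+1})\xrightarrow{\delta^1}H^1(X,\mathcal A_{j+1})$, where the first map is induced by $\mathcal A_j=\mathcal H_j/\mathcal H_{j+1}\subset\mathcal H_k/\mathcal H_{j+1}$ and $\delta^1$ is the connecting map of the central sequence $\{e\}\to\mathcal A_{j+1}\to\mathcal H_k/\mathcal H_{j+2}\to\mathcal H_k/\mathcal H_{j+1}\to\{e\}$, $k<j+1$. The map $\partial^2_{j+2}$ is the composite $H^1(X,\mathcal A_{j+1})\to\check H^1(X,\mathcal H_k/\mathcal H_{j+2})\xrightarrow{\delta^2}H^2(X,\mathcal A_{j+2})$, where the first map is induced by inclusion and $\delta^2$ is the degree-2 connecting map of the central sequence $\{e\}\to\mathcal A_{j+2}\to\mathcal H_k/\mathcal H_{j+3}\to\mathcal H_k/\mathcal H_{j+2}\to\{e\}$, $k<j+2$. *)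

theory Defs
  imports "HOL-Analysis.Abstract_Topology" "HOL-Algebra.Product_Groups"
begin

section \<open>Sheaves of groups\<close>

text \<open>Only the values of the fields on the open sets of the ambient space are ever relevant.\<close>

record ('a, 'g) presheaf =
  sections :: "'a set \<Rightarrow> 'g monoid"
  restr :: "'a set \<Rightarrow> 'a set \<Rightarrow> 'g \<Rightarrow> 'g"  \<comment> \<open>\<open>restr F U V : F(U) \<rightarrow> F(V)\<close> for \<open>V \<subseteq> U\<close>\<close>

locale presheaf_of_groups =
  fixes X :: "'a topology" and F :: "('a, 'g) presheaf"
  assumes group_sections: "openin X U \<Longrightarrow> group (sections F U)"
    and restr_hom: "\<lbrakk>openin X U; openin X V; V \<subseteq> U\<rbrakk>
          \<Longrightarrow> restr F U V \<in> hom (sections F U) (sections F V)"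
    and restr_id: "\<lbrakk>openin X U; s \<in> carrier (sections F U)\<rbrakk> \<Longrightarrow> restr F U U s = s"
    and restr_comp: "\<lbrakk>openin X U; openin X V; openin X W; W \<subseteq> V; V \<subseteq> U;
            s \<in> carrier (sections F U)\<rbrakk>
          \<Longrightarrow> restr F V W (restr F U V s) = restr F U W s"

locale sheaf_of_groups = presheaf_of_groups +
  assumes locality: "\<lbrakk>\<And>U. U \<in> \<U> \<Longrightarrow> openin X U;
            s \<in> carrier (sections F (\<Union>\<U>)); t \<in> carrier (sections F (\<Union>\<U>));
            \<And>U. U \<in> \<U> \<Longrightarrow> restr F (\<Union>\<U>) U s = restr F (\<Union>\<U>) U t\<rbrakk> \<Longrightarrow> s = t"
    and gluing: "\<lbrakk>\<And>U. U \<in> \<U> \<Longrightarrow> openin X U;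
            \<And>U. U \<in> \<U> \<Longrightarrow> f U \<in> carrier (sections F U);
            \<And>U V. \<lbrakk>U \<in> \<U>; V \<in> \<U>\<rbrakk>
              \<Longrightarrow> restr F U (U \<inter> V) (f U) = restr F V (U \<inter> V) (f V)\<rbrakk>
          \<Longrightarrow> \<exists>s \<in> carrier (sections F (\<Union>\<U>)). \<forall>U\<in>\<U>. restr F (\<Union>\<U>) U s = f U"

definition subpresheaf :: "('a, 'g) presheaf \<Rightarrow> ('a set \<Rightarrow> 'g set) \<Rightarrow> ('a, 'g) presheaf" where
  "subpresheaf F N = \<lparr>sections = (\<lambda>U. (sections F U)\<lparr>carrier := N U\<rparr>), restr = restr F\<rparr>"

definition normal_subsheaf ::
    "'a topology \<Rightarrow> ('a, 'g) presheaf \<Rightarrow> ('a set \<Rightarrow> 'g set) \<Rightarrow> bool" where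
  "normal_subsheaf X F N \<longleftrightarrow>
     sheaf_of_groups X (subpresheaf F N) \<and> (\<forall>U. openin X U \<longrightarrow> N U \<lhd> sections F U)"

definition sheaf_of_abelian_groups :: "'a topology \<Rightarrow> ('a, 'g) presheaf \<Rightarrow> bool" where
  "sheaf_of_abelian_groups X F \<longleftrightarrow>
     sheaf_of_groups X F \<and> (\<forall>U. openin X U \<longrightarrow> comm_group (sections F U))"


section \<open>Stalks, sheafification and quotient sheaves\<close>

definition germ ::
    "'a topology \<Rightarrow> ('a, 'g) presheaf \<Rightarrow> 'a set \<Rightarrow> 'g \<Rightarrow> 'a \<Rightarrow> ('a set \<times> 'g) set" where
  "germ X F U s x = {(V, t). openin X V \<and> x \<in> V \<and> t \<in> carrier (sections F V) \<and>
     (\<exists>W. openin X W \<and> x \<in> W \<and> W \<subseteq> U \<inter> V \<and> restr F U W s = restr F V W t)}"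

definition stalk :: "'a topology \<Rightarrow> ('a, 'g) presheaf \<Rightarrow> 'a \<Rightarrow> ('a set \<times> 'g) set monoid" where
  "stalk X F x =
     \<lparr>carrier = {germ X F U s x | U s. openin X U \<and> x \<in> U \<and> s \<in> carrier (sections F U)},
      monoid.mult = (\<lambda>\<xi> \<eta>. \<Union>(U, s)\<in>\<xi>. \<Union>(V, t)\<in>\<eta>.
        germ X F (U \<inter> V) (restr F U (U \<inter> V) s \<otimes>\<^bsub>sections F (U \<inter> V)\<^esub> restr F V (U \<inter> V) t) x),
      one = germ X F (topspace X) \<one>\<^bsub>sections F (topspace X)\<^esub> x\<rparr>"

text \<open>Godement's sheaf of discontinuous sections, \<open>U \<mapsto> \<Prod>x\<in>U. F\<^sub>x\<close>.\<close>

definition godement ::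
    "'a topology \<Rightarrow> ('a, 'g) presheaf \<Rightarrow> ('a, 'a \<Rightarrow> ('a set \<times> 'g) set) presheaf" where
  "godement X F = \<lparr>sections = (\<lambda>U. product_group U (stalk X F)), restr = (\<lambda>U V \<sigma>. restrict \<sigma> V)\<rparr>"

definition germs ::
    "'a topology \<Rightarrow> ('a, 'g) presheaf \<Rightarrow> 'a set \<Rightarrow> 'g \<Rightarrow> 'a \<Rightarrow> ('a set \<times> 'g) set" where
  "germs X F U s = (\<lambda>x\<in>U. germ X F U s x)"

definition sheafify ::
    "'a topology \<Rightarrow> ('a, 'g) presheaf \<Rightarrow> ('a, 'a \<Rightarrow> ('a set \<times> 'g) set) presheaf" where
  "sheafify X F = subpresheaf (godement X F)
     (\<lambda>U. {\<sigma> \<in> carrier (sections (godement X F) U). \<forall>x\<in>U. \<exists>V s.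
             openin X V \<and> x \<in> V \<and> V \<subseteq> U \<and> s \<in> carrier (sections F V) \<and>
             restrict \<sigma> V = germs X F V s})"

text \<open>The map on (possibly discontinuous) sections of stalks induced by a morphism of presheaves
  \<open>\<phi> U : F(U) \<rightarrow> F'(U)\<close>. All members of the class \<open>\<sigma> x\<close> give the same germ,
  so the union is that germ; the same idiom is used below for maps out of other quotients.\<close>

definition stalkwise ::
    "'a topology \<Rightarrow> ('a, 'h) presheaf \<Rightarrow> ('a set \<Rightarrow> 'g \<Rightarrow> 'h) \<Rightarrow> 'a set
       \<Rightarrow> ('a \<Rightarrow> ('a set \<times> 'g) set) \<Rightarrow> 'a \<Rightarrow> ('a set \<times> 'h) set" where
  "stalkwise X F' \<phi> U \<sigma> = (\<lambda>x\<in>U. \<Union>(V, t)\<in>\<sigma> x. germ X F' V (\<phi> V t) x)"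

definition quotient_presheaf ::
    "('a, 'g) presheaf \<Rightarrow> ('a set \<Rightarrow> 'g set) \<Rightarrow> ('a, 'g set) presheaf" where
  "quotient_presheaf F N =
     \<lparr>sections = (\<lambda>U. sections F U Mod N U),
      restr = (\<lambda>U V K. N V <#>\<^bsub>sections F V\<^esub> (restr F U V ` K))\<rparr>"

definition quotient_sheaf ::
    "'a topology \<Rightarrow> ('a, 'g) presheaf \<Rightarrow> ('a set \<Rightarrow> 'g set)
       \<Rightarrow> ('a, 'a \<Rightarrow> ('a set \<times> 'g set) set) presheaf" where
  "quotient_sheaf X F N = sheafify X (quotient_presheaf F N)"


section \<open>Cohomology\<close>

definition H0 :: "'a topology \<Rightarrow> ('a, 'g) presheaf \<Rightarrow> 'g monoid" where
  "H0 X F = sections F (topspace X)"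

subsection \<open>Non-abelian Cech cohomology in degree 1\<close>

text \<open>Covers are sets of open sets, indexed by themselves: every indexed open cover and its
  underlying set of open sets refine each other.\<close>

definition open_cover :: "'a topology \<Rightarrow> 'a set set \<Rightarrow> bool" where
  "open_cover X \<U> \<longleftrightarrow> (\<forall>U\<in>\<U>. openin X U) \<and> \<Union>\<U> = topspace X"

definition cech_cocycles ::
    "'a topology \<Rightarrow> ('a, 'g) presheaf \<Rightarrow> ('a set set \<times> ('a set \<Rightarrow> 'a set \<Rightarrow> 'g)) set" where
  "cech_cocycles X F = {(\<U>, g). open_cover X \<U> \<and>
     (\<forall>U\<in>\<U>. \<forall>V\<in>\<U>. g U V \<in> carrier (sections F (U \<inter> V))) \<and>
     (\<forall>U\<in>\<U>. \<forall>V\<in>\<U>. \<forall>W\<in>\<U>.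
        restr F (U \<inter> V) (U \<inter> V \<inter> W) (g U V)
          \<otimes>\<^bsub>sections F (U \<inter> V \<inter> W)\<^esub> restr F (V \<inter> W) (U \<inter> V \<inter> W) (g V W)
        = restr F (U \<inter> W) (U \<inter> V \<inter> W) (g U W))}"

definition cech_cohomologous ::
    "'a topology \<Rightarrow> ('a, 'g) presheaf \<Rightarrow> ('a set set \<times> ('a set \<Rightarrow> 'a set \<Rightarrow> 'g)) rel" where
  "cech_cohomologous X F = {((\<U>, g), (\<V>, h)).
     (\<U>, g) \<in> cech_cocycles X F \<and> (\<V>, h) \<in> cech_cocycles X F \<and>
     (\<exists>\<W> \<rho> \<tau> a. open_cover X \<W> \<and> \<rho> \<in> \<W> \<rightarrow> \<U> \<and> \<tau> \<in> \<W> \<rightarrow> \<V> \<and>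
        (\<forall>W\<in>\<W>. W \<subseteq> \<rho> W \<and> W \<subseteq> \<tau> W \<and> a W \<in> carrier (sections F W)) \<and>
        (\<forall>W\<in>\<W>. \<forall>W'\<in>\<W>.
           restr F (\<tau> W \<inter> \<tau> W') (W \<inter> W') (h (\<tau> W) (\<tau> W'))
           = inv\<^bsub>sections F (W \<inter> W')\<^esub> (restr F W (W \<inter> W') (a W))
               \<otimes>\<^bsub>sections F (W \<inter> W')\<^esub> restr F (\<rho> W \<inter> \<rho> W') (W \<inter> W') (g (\<rho> W) (\<rho> W'))
               \<otimes>\<^bsub>sections F (W \<inter> W')\<^esub> restr F W' (W \<inter> W') (a W')))}"

definition H1 ::
    "'a topology \<Rightarrow> ('a, 'g) presheaf \<Rightarrow> ('a set set \<times> ('a set \<Rightarrow> 'a set \<Rightarrow> 'g)) set set" where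
  "H1 X F = cech_cocycles X F // cech_cohomologous X F"

definition H1_base ::
    "'a topology \<Rightarrow> ('a, 'g) presheaf \<Rightarrow> ('a set set \<times> ('a set \<Rightarrow> 'a set \<Rightarrow> 'g)) set" where
  "H1_base X F =
     cech_cohomologous X F `` {({topspace X}, \<lambda>_ _. \<one>\<^bsub>sections F (topspace X)\<^esub>)}"

definition H1_map ::
    "'a topology \<Rightarrow> ('a, 'h) presheaf \<Rightarrow> ('a set \<Rightarrow> 'g \<Rightarrow> 'h)
       \<Rightarrow> ('a set set \<times> ('a set \<Rightarrow> 'a set \<Rightarrow> 'g)) set
       \<Rightarrow> ('a set set \<times> ('a set \<Rightarrow> 'a set \<Rightarrow> 'h)) set" where
  "H1_map X F' \<phi> c =
     (\<Union>(\<U>, g)\<in>c. cech_cohomologous X F' `` {(\<U>, \<lambda>U V. \<phi> (U \<inter> V) (g U V))})"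

subsection \<open>Degree 2 cohomology of abelian sheaves\<close>

text \<open>Sheaf cohomology on an arbitrary space is computed by Godement's canonical resolution
  \<open>F \<rightarrow> C\<^sup>0(F) \<rightarrow> C\<^sup>1(F) \<rightarrow> \<dots>\<close>, where \<open>C\<^sup>0 = godement X\<close>, \<open>Z(F) = C\<^sup>0(F)/F\<close> and
  \<open>C\<^sup>n(F) = C\<^sup>0(Z\<^sup>n(F))\<close>. Thus the differential \<open>C\<^sup>n(F) \<rightarrow> C\<^sup>n\<^sup>+\<^sup>1(F)\<close> is the composite
  \<open>C\<^sup>0(F') \<rightarrow> Z(F') \<rightarrow> C\<^sup>0(Z(F'))\<close> for \<open>F' = Z\<^sup>n(F)\<close>.\<close>

definition continuous_sections ::
    "'a topology \<Rightarrow> ('a, 'g) presheaf \<Rightarrow> 'a set \<Rightarrow> ('a \<Rightarrow> ('a set \<times> 'g) set) set" where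
  "continuous_sections X F U = germs X F U ` carrier (sections F U)"

definition godement_quotient where
  "godement_quotient X F = quotient_sheaf X (godement X F) (continuous_sections X F)"

definition godement_diff where
  "godement_diff X F U \<sigma> =
     germs X (godement_quotient X F) U
       (germs X (quotient_presheaf (godement X F) (continuous_sections X F)) U
          (continuous_sections X F U #>\<^bsub>sections (godement X F) U\<^esub> \<sigma>))"

definition H2 where
  "H2 X F =
    (let Z1 = godement_quotient X F;
         Z2 = godement_quotient X Z1;
         Z3 = godement_quotient X Z2;
         C1 = H0 X (godement X Z1);
         C2 = H0 X (godement X Z2);
         C3 = H0 X (godement X Z3)
     in (C2\<lparr>carrier := kernel C2 C3 (godement_diff X Z2 (topspace X))\<rparr>)
          Mod (godement_diff X Z1 (topspace X) ` carrier C1))"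

subsection \<open>Connecting maps of a short exact sequence \<open>A \<rightarrow> B \<rightarrow> C\<close> of sheaves of groups\<close>

text \<open>The sequence is given by \<open>i U : A(U) \<rightarrow> B(U)\<close> and \<open>p U : B(U) \<rightarrow> C(U)\<close>. A global section
  \<open>s\<close> of \<open>C\<close> is lifted to sections \<open>b U\<close> of \<open>B\<close> over the members of a cover.\<close>

definition delta1 ::
    "'a topology \<Rightarrow> ('a, 'f) presheaf \<Rightarrow> ('a, 'g) presheaf \<Rightarrow> ('a, 'h) presheaf
       \<Rightarrow> ('a set \<Rightarrow> 'f \<Rightarrow> 'g) \<Rightarrow> ('a set \<Rightarrow> 'g \<Rightarrow> 'h) \<Rightarrow> 'h
       \<Rightarrow> ('a set set \<times> ('a set \<Rightarrow> 'a set \<Rightarrow> 'f)) set" where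
  "delta1 X A B C i p s = (\<Union>(\<U>, z) \<in> {(\<U>, z). open_cover X \<U> \<and> (\<exists>b.
       (\<forall>U\<in>\<U>. b U \<in> carrier (sections B U) \<and> p U (b U) = restr C (topspace X) U s) \<and>
       (\<forall>U\<in>\<U>. \<forall>V\<in>\<U>. z U V \<in> carrier (sections A (U \<inter> V)) \<and>
          i (U \<inter> V) (z U V) = inv\<^bsub>sections B (U \<inter> V)\<^esub> (restr B U (U \<inter> V) (b U))
                                \<otimes>\<^bsub>sections B (U \<inter> V)\<^esub> restr B V (U \<inter> V) (b V)))}.
     cech_cohomologous X A `` {(\<U>, z)})"

text \<open>Central case, degree 2. A cocycle \<open>g U V\<close> of \<open>C\<close> need not lift to \<open>B\<close> over the whole of
  \<open>U \<inter> V\<close>, even after refining the cover, so its obstruction class is formed in the double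
  complex of Cech cochains with values in the Godement resolution of \<open>A\<close>.
  Discontinuous sections \<open>\<beta> U\<close> of \<open>B\<close> are chosen so that, locally on \<open>U \<inter> V\<close>, a lift
  \<open>b\<close> of \<open>g U V\<close> to \<open>B\<close> has the form \<open>(\<beta> U)\<^sup>-\<^sup>1 (\<beta> V) i(a)\<close> with \<open>a\<close> a section of \<open>C\<^sup>0(A)\<close>.
  The section \<open>a\<close> is unique up to sections of \<open>A\<close>, so \<open>d a\<close> is a well-defined section of
  \<open>C\<^sup>1(A)\<close> over \<open>U \<inter> V\<close>. It is the Cech coboundary of some \<open>\<zeta>\<close>, and the \<open>d (\<zeta> U)\<close> glue to a
  global 2-cocycle \<open>y\<close> of \<open>C\<^sup>2(A)\<close>. (If lifts \<open>b U V\<close> and corresponding \<open>a U V\<close> exist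
  on all of \<open>U \<inter> V\<close>, then the image under \<open>i\<close> of the Cech coboundary of \<open>a\<close> is
  \<open>b U V \<cdot> b V W \<cdot> (b U W)\<^sup>-\<^sup>1\<close>, the usual Cech description.)\<close>

definition delta2_rep where
  "delta2_rep X A B C i p \<U> g y \<longleftrightarrow>
    (let C0A = godement X A;
         C0B = godement X B;
         Z1 = godement_quotient X A;
         C1 = godement X Z1;
         C2 = godement X (godement_quotient X Z1)
     in y \<in> carrier (H0 X C2) \<and>
      (\<exists>\<beta> \<zeta>.
        (\<forall>U\<in>\<U>. \<beta> U \<in> carrier (sections C0B U) \<and> \<zeta> U \<in> carrier (sections C1 U) \<and>
           godement_diff X Z1 U (\<zeta> U) = restr C2 (topspace X) U y) \<and>
        (\<forall>U\<in>\<U>. \<forall>V\<in>\<U>. \<forall>x\<in>U \<inter> V. \<exists>W a b.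
           openin X W \<and> x \<in> W \<and> W \<subseteq> U \<inter> V \<and>
           a \<in> carrier (sections C0A W) \<and> b \<in> carrier (sections B W) \<and>
           p W b = restr C (U \<inter> V) W (g U V) \<and>
           germs X B W b = inv\<^bsub>sections C0B W\<^esub> (restr C0B U W (\<beta> U))
                             \<otimes>\<^bsub>sections C0B W\<^esub> restr C0B V W (\<beta> V)
                             \<otimes>\<^bsub>sections C0B W\<^esub> stalkwise X B i W a \<and>
           godement_diff X A W a = inv\<^bsub>sections C1 W\<^esub> (restr C1 U W (\<zeta> U))
                                     \<otimes>\<^bsub>sections C1 W\<^esub> restr C1 V W (\<zeta> V))))"

definition delta2 where
  "delta2 X A B C i p c =
    (let Z1 = godement_quotient X A;
         C1 = H0 X (godement X Z1);
         C2 = H0 X (godement X (godement_quotient X Z1))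
     in \<Union>{(godement_diff X Z1 (topspace X) ` carrier C1) #>\<^bsub>C2\<^esub> y | y \<U> g.
             (\<U>, g) \<in> c \<and> delta2_rep X A B C i p \<U> g y})"


section \<open>AQ central series\<close>

text \<open>\<open>series_quotient X G H k m\<close> is \<open>H\<^sub>k / H\<^sub>m\<close>, for \<open>k \<le> m\<close>.\<close>

definition series_quotient ::
    "'a topology \<Rightarrow> ('a, 'g) presheaf \<Rightarrow> (nat \<Rightarrow> 'a set \<Rightarrow> 'g set) \<Rightarrow> nat \<Rightarrow> nat
       \<Rightarrow> ('a, 'a \<Rightarrow> ('a set \<times> 'g set) set) presheaf" where
  "series_quotient X G H k m = quotient_sheaf X (subpresheaf G (H k)) (H m)"

abbreviation AQ where
  "AQ X G H j \<equiv> series_quotient X G H j (Suc j)"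

text \<open>The natural map \<open>H\<^sub>l / H\<^sub>n \<rightarrow> H\<^sub>k / H\<^sub>m\<close> for \<open>k \<le> l\<close> and \<open>m \<le> n\<close>: an inclusion if
  \<open>m = n\<close>, a projection if \<open>k = l\<close>. On cosets it is \<open>K \<mapsto> H\<^sub>m K\<close>, whatever \<open>l\<close> and \<open>n\<close> are.\<close>

definition series_map ::
    "'a topology \<Rightarrow> ('a, 'g) presheaf \<Rightarrow> (nat \<Rightarrow> 'a set \<Rightarrow> 'g set) \<Rightarrow> nat \<Rightarrow> nat \<Rightarrow> 'a set
       \<Rightarrow> ('a \<Rightarrow> ('a set \<times> 'g set) set) \<Rightarrow> 'a \<Rightarrow> ('a set \<times> 'g set) set" where
  "series_map X G H k m = stalkwise X (quotient_presheaf (subpresheaf G (H k)) (H m))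
     (\<lambda>U K. H m U <#>\<^bsub>sections G U\<^esub> K)"

definition AQ_normal_series ::
    "'a topology \<Rightarrow> ('a, 'g) presheaf \<Rightarrow> (nat \<Rightarrow> 'a set \<Rightarrow> 'g set) \<Rightarrow> bool" where
  "AQ_normal_series X G H \<longleftrightarrow>
     sheaf_of_groups X G \<and>
     (\<forall>U. openin X U \<longrightarrow> H 0 U = carrier (sections G U)) \<and>
     (\<forall>j U. openin X U \<longrightarrow> H (Suc j) U \<subseteq> H j U) \<and>
     (\<exists>N. \<forall>j\<ge>N. \<forall>U. openin X U \<longrightarrow> H j U = {\<one>\<^bsub>sections G U\<^esub>}) \<and>
     (\<forall>j. normal_subsheaf X G (H j)) \<and>
     (\<forall>j. sheaf_of_abelian_groups X (AQ X G H j))"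

text \<open>\<open>k < j\<close>, and \<open>A\<^sub>j\<close> is central in \<open>H\<^sub>k / H\<^sub>j\<^sub>+\<^sub>1\<close>.\<close>

definition central_at ::
    "'a topology \<Rightarrow> ('a, 'g) presheaf \<Rightarrow> (nat \<Rightarrow> 'a set \<Rightarrow> 'g set) \<Rightarrow> nat \<Rightarrow> nat \<Rightarrow> bool" where
  "central_at X G H k j \<longleftrightarrow> k < j \<and>
     (\<forall>U. openin X U \<longrightarrow>
       (\<forall>a \<in> carrier (sections (AQ X G H j) U).
        \<forall>b \<in> carrier (sections (series_quotient X G H k (Suc j)) U).
          series_map X G H k (Suc j) U a \<otimes>\<^bsub>sections (series_quotient X G H k (Suc j)) U\<^esub> b
          = b \<otimes>\<^bsub>sections (series_quotient X G H k (Suc j)) U\<^esub> series_map X G H k (Suc j) U a))"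

definition AQ_central_series ::
    "'a topology \<Rightarrow> ('a, 'g) presheaf \<Rightarrow> (nat \<Rightarrow> 'a set \<Rightarrow> 'g set) \<Rightarrow> bool" where
  "AQ_central_series X G H \<longleftrightarrow> AQ_normal_series X G H \<and> (\<forall>j>0. \<exists>k. central_at X G H k j)"

text \<open>For \<open>n > 0\<close>, \<open>partial1 X G H k n : H\<^sup>0(A\<^sub>n\<^sub>-\<^sub>1) \<rightarrow> H\<^sup>1(A\<^sub>n)\<close> and
  \<open>partial2 X G H k n : H\<^sup>1(A\<^sub>n\<^sub>-\<^sub>1) \<rightarrow> H\<^sup>2(A\<^sub>n)\<close> are formed with the sequence
  \<open>A\<^sub>n \<rightarrow> H\<^sub>k / H\<^sub>n\<^sub>+\<^sub>1 \<rightarrow> H\<^sub>k / H\<^sub>n\<close>.\<close>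

definition partial1 where
  "partial1 X G H k n s =
     delta1 X (AQ X G H n) (series_quotient X G H k (Suc n)) (series_quotient X G H k n)
       (series_map X G H k (Suc n)) (series_map X G H k n)
       (series_map X G H k n (topspace X) s)"

definition partial2 where
  "partial2 X G H k n c =
     delta2 X (AQ X G H n) (series_quotient X G H k (Suc n)) (series_quotient X G H k n)
       (series_map X G H k (Suc n)) (series_map X G H k n)
       (H1_map X (series_quotient X G H k n) (series_map X G H k n) c)"


section \<open>Complexes of pointed sets\<close>

definition pointed_map :: "'a set \<times> 'a \<Rightarrow> 'b set \<times> 'b \<Rightarrow> ('a \<Rightarrow> 'b) \<Rightarrow> bool" where
  "pointed_map P Q f \<longleftrightarrow> snd P \<in> fst P \<and> snd Q \<in> fst Q \<and> f \<in> fst P \<rightarrow> fst Q \<and> f (snd P) = snd Q"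

definition pointed_complex ::
    "'a set \<times> 'a \<Rightarrow> ('a \<Rightarrow> 'b) \<Rightarrow> 'b set \<times> 'b \<Rightarrow> ('b \<Rightarrow> 'c) \<Rightarrow> 'c set \<times> 'c \<Rightarrow> bool" where
  "pointed_complex P f Q g R \<longleftrightarrow>
     pointed_map P Q f \<and> pointed_map Q R g \<and> (\<forall>x \<in> fst P. g (f x) = snd R)"

end

theory Submission
  imports Defs
begin

text \<open>
  Represent a section \<open>s\<close> of \<open>A\<^sub>j\<close> locally by sections \<open>h U\<close> of \<open>H\<^sub>j\<close>. Modulo \<open>H\<^sub>j\<^sub>+\<^sub>1\<close> they
  are restrictions of the same section, so the differences \<open>c U V = (h U)\<^sup>-\<^sup>1 (h V)\<close> are sections of
  \<open>H\<^sub>j\<^sub>+\<^sub>1\<close>; being differences, they satisfy the cocycle identity in \<open>G\<close> itself. The classes of \<open>c\<close>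
  modulo \<open>H\<^sub>j\<^sub>+\<^sub>2\<close> represent the image of \<open>s\<close> under the first map. To apply the second map, one asks
  whether this cocycle of \<open>H\<^sub>l / H\<^sub>j\<^sub>+\<^sub>2\<close> lifts to a cocycle of \<open>H\<^sub>l / H\<^sub>j\<^sub>+\<^sub>3\<close>, and the classes of \<open>c\<close>
  modulo \<open>H\<^sub>j\<^sub>+\<^sub>3\<close> are such a lift. Here \<open>k\<close> and \<open>l\<close> are independent of
  each other: \<open>c\<close> lies in \<open>H\<^sub>l\<close> because \<open>l \<le> j + 1\<close>. This is lemma \<open>partial2_partial1\<close>.

  The larger part of the work shows that the two maps are well defined, that is, that the unions over
  all choices by which the connecting maps are given are single classes (\<open>delta1_class\<close> and
  \<open>delta2_class\<close>). Two devices keep this manageable. First, sections of a sheaf are determined by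
  their germs (\<open>section_eqI\<close>), so identities between restrictions to varying intersections are
  replaced by identities in the stalks, which are groups. Secondly, the Godement differential enters
  only through a few formal properties: it is a local homomorphism, it kills the sections of the
  sheaf, and its square is trivial (\<open>diff_relation\<close>, \<open>diff_germs\<close>, \<open>diff_diff\<close>).

  In degree two, representatives exist (\<open>delta2_data_exists\<close>) because a section of \<open>C\<^sup>0\<close> or \<open>C\<^sup>1\<close> is an
  arbitrary choice of a stalk element at each point: choosing a member \<open>u x\<close> of the cover for each
  point \<open>x\<close>, a cocycle of such sections becomes the coboundary of its values at \<open>(u x, U)\<close>. Two representatives of
  cohomologous cocycles differ by the differential of a global section of \<open>C\<^sup>1\<close>
  (\<open>delta2_data_cohomologous\<close>). Centrality is what lets the factors from \<open>A\<close> be separated from the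
  others in both computations. That the quotients of the series form central extensions is proved
  in \<open>series_central_extension\<close>, by reducing to local sections of \<open>H\<^sub>k\<close>.
\<close>

section \<open>Group identities\<close>

lemma (in group) cancel_simps:
  assumes "x \<in> carrier G" "y \<in> carrier G"
  shows "inv x \<otimes> (x \<otimes> y) = y" "x \<otimes> (inv x \<otimes> y) = y"
  using assms by (simp_all add: m_assoc [symmetric])

lemma (in comm_group) difference_exchange:
  assumes c: "m \<in> carrier G" "m' \<in> carrier G" "z1 \<in> carrier G" "z2 \<in> carrier G"
      "w1 \<in> carrier G" "w2 \<in> carrier G"
    and eq: "(inv z1 \<otimes> z2) \<otimes> m' = m \<otimes> (inv w1 \<otimes> w2)"
  shows "m \<otimes> z1 \<otimes> inv w1 = m' \<otimes> z2 \<otimes> inv w2"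
proof -
  have "m \<otimes> z1 \<otimes> inv w1 = (m \<otimes> (inv w1 \<otimes> w2)) \<otimes> (inv w2 \<otimes> z1)"
    using c by (simp add: m_assoc cancel_simps m_comm[of z1 "inv w1"])
  also have "\<dots> = ((inv z1 \<otimes> z2) \<otimes> m') \<otimes> (inv w2 \<otimes> z1)"
    by (simp only: eq)
  also have "\<dots> = inv z1 \<otimes> (z1 \<otimes> (z2 \<otimes> m' \<otimes> inv w2))"
    using c by (simp add: m_ac)
  also have "\<dots> = m' \<otimes> z2 \<otimes> inv w2"
    using c by (simp add: cancel_simps m_comm[of z2 m'])
  finally show ?thesis .
qed

section \<open>Stalks\<close>

abbreviation \<Gamma> where "\<Gamma> F U \<equiv> carrier (sections F U)"

text \<open>The discontinuous sections of \<open>F\<close>, that is, the elements of \<open>C\<^sup>0(F)(U)\<close>.\<close>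

abbreviation disc where "disc X F U \<equiv> \<Pi>\<^sub>E x\<in>U. carrier (stalk X F x)"

context presheaf_of_groups
begin

lemma restr_closed [simp]:
  "\<lbrakk>openin X U; openin X V; V \<subseteq> U; s \<in> \<Gamma> F U\<rbrakk>
     \<Longrightarrow> restr F U V s \<in> \<Gamma> F V"
  using restr_hom by (auto simp: hom_def)

lemma restr_mult:
  "\<lbrakk>openin X U; openin X V; V \<subseteq> U; s \<in> \<Gamma> F U; t \<in> \<Gamma> F U\<rbrakk>
     \<Longrightarrow> restr F U V (s \<otimes>\<^bsub>sections F U\<^esub> t) = restr F U V s \<otimes>\<^bsub>sections F V\<^esub> restr F U V t"
  using restr_hom by (auto simp: hom_def)

lemma restr_one:
  "\<lbrakk>openin X U; openin X V; V \<subseteq> U\<rbrakk> \<Longrightarrow> restr F U V \<one>\<^bsub>sections F U\<^esub> = \<one>\<^bsub>sections F V\<^esub>"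
  using hom_one[OF restr_hom group_sections group_sections] by blast

lemma mult_closed [simp]:
  "\<lbrakk>openin X U; s \<in> \<Gamma> F U; t \<in> \<Gamma> F U\<rbrakk>
     \<Longrightarrow> s \<otimes>\<^bsub>sections F U\<^esub> t \<in> \<Gamma> F U"
  using group_sections group.is_monoid monoid.m_closed by metis

lemma one_closed [simp]: "openin X U \<Longrightarrow> \<one>\<^bsub>sections F U\<^esub> \<in> \<Gamma> F U"
  using group_sections group.is_monoid monoid.one_closed by metis

lemma inverse_closed [simp]:
  "\<lbrakk>openin X U; s \<in> \<Gamma> F U\<rbrakk> \<Longrightarrow> inv\<^bsub>sections F U\<^esub> s \<in> \<Gamma> F U"
  using group_sections group.inv_closed by metis

lemma germ_mem_iff:
  "(V, t) \<in> germ X F U s x \<longleftrightarrow> openin X V \<and> x \<in> V \<and> t \<in> \<Gamma> F V \<and>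
     (\<exists>W. openin X W \<and> x \<in> W \<and> W \<subseteq> U \<inter> V \<and> restr F U W s = restr F V W t)"
  by (simp add: germ_def)

lemma germ_refl:
  "\<lbrakk>openin X U; x \<in> U; s \<in> \<Gamma> F U\<rbrakk> \<Longrightarrow> (U, s) \<in> germ X F U s x"
  unfolding germ_mem_iff by blast

lemma germ_subset:
  assumes U: "openin X U" "s \<in> \<Gamma> F U"
    and V: "openin X V" "t \<in> \<Gamma> F V"
    and W: "openin X W" "x \<in> W" "W \<subseteq> U \<inter> V" "restr F U W s = restr F V W t"
  shows "germ X F U s x \<subseteq> germ X F V t x"
proof (clarsimp simp: germ_mem_iff)
  fix T r N
  assume T: "openin X T" "x \<in> T" "r \<in> \<Gamma> F T"
    and N: "openin X N" "x \<in> N" "N \<subseteq> U" "N \<subseteq> T" "restr F U N s = restr F T N r"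
  have o: "openin X (N \<inter> W)" using N W by blast
  have "restr F V (N \<inter> W) t = restr F W (N \<inter> W) (restr F V W t)"
    using o V W by (subst restr_comp) auto
  also have "\<dots> = restr F U (N \<inter> W) s"
    unfolding W(4) [symmetric] using o U W by (subst restr_comp) auto
  also have "\<dots> = restr F N (N \<inter> W) (restr F U N s)"
    using o U N by (subst restr_comp) auto
  also have "\<dots> = restr F T (N \<inter> W) r"
    unfolding N(5) using o T N by (subst restr_comp) auto
  finally show "\<exists>N. openin X N \<and> x \<in> N \<and> N \<subseteq> V \<and> N \<subseteq> T \<and> restr F V N t = restr F T N r"
    using o N W by (intro exI[of _ "N \<inter> W"]) auto
qed

lemma germ_eq_iff:
  assumes "openin X U" "s \<in> \<Gamma> F U"
    and "openin X V" "t \<in> \<Gamma> F V" "x \<in> V"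
  shows "germ X F U s x = germ X F V t x \<longleftrightarrow>
    (\<exists>W. openin X W \<and> x \<in> W \<and> W \<subseteq> U \<inter> V \<and> restr F U W s = restr F V W t)"
proof
  assume "germ X F U s x = germ X F V t x"
  then have "(V, t) \<in> germ X F U s x"
    using germ_refl assms by blast
  then show "\<exists>W. openin X W \<and> x \<in> W \<and> W \<subseteq> U \<inter> V \<and> restr F U W s = restr F V W t"
    unfolding germ_mem_iff by blast
next
  assume "\<exists>W. openin X W \<and> x \<in> W \<and> W \<subseteq> U \<inter> V \<and> restr F U W s = restr F V W t"
  then obtain W where W: "openin X W" "x \<in> W" "W \<subseteq> U \<inter> V" "restr F U W s = restr F V W t" by blast
  then show "germ X F U s x = germ X F V t x"
    using germ_subset[of U s V t W x] germ_subset[of V t U s W x] assms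
    by (metis Int_commute subset_antisym)
qed

lemma germ_restr:
  assumes "openin X U" "openin X V" "V \<subseteq> U" "x \<in> V" "s \<in> \<Gamma> F U"
  shows "germ X F V (restr F U V s) x = germ X F U s x"
  using assms by (subst germ_eq_iff) (auto intro!: exI[of _ V] simp: restr_id)

lemma germ_in_stalk [simp]:
  "\<lbrakk>openin X U; x \<in> U; s \<in> \<Gamma> F U\<rbrakk> \<Longrightarrow> germ X F U s x \<in> carrier (stalk X F x)"
  by (auto simp: stalk_def)

lemma stalk_cases:
  assumes "\<xi> \<in> carrier (stalk X F x)"
  obtains U s where "openin X U" "x \<in> U" "s \<in> \<Gamma> F U" "\<xi> = germ X F U s x"
  using assms by (auto simp: stalk_def)

lemma germ_mult_raw:
  assumes U: "openin X U" "x \<in> U" "s \<in> \<Gamma> F U"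
    and V: "openin X V" "x \<in> V" "t \<in> \<Gamma> F V"
  shows "germ X F U s x \<otimes>\<^bsub>stalk X F x\<^esub> germ X F V t x =
    germ X F (U \<inter> V) (restr F U (U \<inter> V) s \<otimes>\<^bsub>sections F (U \<inter> V)\<^esub> restr F V (U \<inter> V) t) x"
    (is "_ = germ X F (U \<inter> V) (?m U s V t) x")
proof -
  have UV: "openin X (U \<inter> V)" using U V by blast
  have eq: "germ X F (U' \<inter> V') (?m U' s' V' t') x = germ X F (U \<inter> V) (?m U s V t) x"
    if s': "(U', s') \<in> germ X F U s x" and t': "(V', t') \<in> germ X F V t x" for U' s' V' t'
  proof -
    from s' obtain W where U': "openin X U'" "x \<in> U'" "s' \<in> \<Gamma> F U'"
      and W: "openin X W" "x \<in> W" "W \<subseteq> U \<inter> U'" "restr F U W s = restr F U' W s'"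
      unfolding germ_mem_iff by blast
    from t' obtain W' where V': "openin X V'" "x \<in> V'" "t' \<in> \<Gamma> F V'"
      and W': "openin X W'" "x \<in> W'" "W' \<subseteq> V \<inter> V'" "restr F V W' t = restr F V' W' t'"
      unfolding germ_mem_iff by blast
    let ?N = "W \<inter> W'"
    have N: "openin X ?N" "openin X (U' \<inter> V')" using W W' U' V' by auto
    have sub: "?N \<subseteq> U" "?N \<subseteq> V" "?N \<subseteq> U'" "?N \<subseteq> V'" using W W' by auto
    have sN: "restr F U ?N s = restr F U' ?N s'"
      using restr_comp[of U W ?N s] restr_comp[of U' W ?N s'] W U U' N by auto
    have tN: "restr F V ?N t = restr F V' ?N t'"
      using restr_comp[of V W' ?N t] restr_comp[of V' W' ?N t'] W' V V' N by auto
    have "restr F (U' \<inter> V') ?N (?m U' s' V' t') =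
        restr F U' ?N s' \<otimes>\<^bsub>sections F ?N\<^esub> restr F V' ?N t'"
      using N sub U' V' restr_comp[of U' "U' \<inter> V'" ?N s'] restr_comp[of V' "U' \<inter> V'" ?N t']
      by (subst restr_mult) auto
    moreover have "restr F (U \<inter> V) ?N (?m U s V t) =
        restr F U ?N s \<otimes>\<^bsub>sections F ?N\<^esub> restr F V ?N t"
      using N sub U V UV restr_comp[of U "U \<inter> V" ?N s] restr_comp[of V "U \<inter> V" ?N t]
      by (subst restr_mult) auto
    ultimately have "restr F (U' \<inter> V') ?N (?m U' s' V' t') = restr F (U \<inter> V) ?N (?m U s V t)"
      using sN tN by simp
    then show ?thesis
      using N UV U V U' V' W W' by (subst germ_eq_iff) (auto intro!: exI[of _ ?N])
  qed
  have "germ X F U s x \<otimes>\<^bsub>stalk X F x\<^esub> germ X F V t x =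
     (\<Union>(U', s')\<in>germ X F U s x. \<Union>(V', t')\<in>germ X F V t x. germ X F (U' \<inter> V') (?m U' s' V' t') x)"
    by (simp add: stalk_def)
  also have "\<dots> = germ X F (U \<inter> V) (?m U s V t) x"
  proof (intro subset_antisym subsetI)
    fix z assume "z \<in> germ X F (U \<inter> V) (?m U s V t) x"
    then show "z \<in> (\<Union>(U', s')\<in>germ X F U s x. \<Union>(V', t')\<in>germ X F V t x.
        germ X F (U' \<inter> V') (?m U' s' V' t') x)"
      using germ_refl[OF U] germ_refl[OF V] by blast
  qed (use eq in auto)
  finally show ?thesis .
qed

lemma germ_mult:
  assumes "openin X U" "x \<in> U" "s \<in> \<Gamma> F U" "t \<in> \<Gamma> F U"
  shows "germ X F U (s \<otimes>\<^bsub>sections F U\<^esub> t) x = germ X F U s x \<otimes>\<^bsub>stalk X F x\<^esub> germ X F U t x"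
  using assms by (simp add: germ_mult_raw restr_id)

lemma germ_one:
  assumes "openin X U" "x \<in> U"
  shows "germ X F U \<one>\<^bsub>sections F U\<^esub> x = \<one>\<^bsub>stalk X F x\<^esub>"
proof -
  have "U \<subseteq> topspace X" using assms openin_subset by blast
  then have "germ X F U (restr F (topspace X) U \<one>\<^bsub>sections F (topspace X)\<^esub>) x = \<one>\<^bsub>stalk X F x\<^esub>"
    using assms by (subst germ_restr) (auto simp: stalk_def)
  then show ?thesis
    using assms \<open>U \<subseteq> topspace X\<close> by (simp add: restr_one)
qed

lemma stalk_cases2:
  assumes "\<xi> \<in> carrier (stalk X F x)" "\<eta> \<in> carrier (stalk X F x)"
  obtains U s t where "openin X U" "x \<in> U" "s \<in> \<Gamma> F U" "t \<in> \<Gamma> F U"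
    "\<xi> = germ X F U s x" "\<eta> = germ X F U t x"
proof -
  obtain U s where U: "openin X U" "x \<in> U" "s \<in> \<Gamma> F U" "\<xi> = germ X F U s x"
    using assms stalk_cases by metis
  obtain V t where V: "openin X V" "x \<in> V" "t \<in> \<Gamma> F V" "\<eta> = germ X F V t x"
    using assms stalk_cases by metis
  have "openin X (U \<inter> V)" using U V by blast
  then show thesis
    using that[of "U \<inter> V" "restr F U (U \<inter> V) s" "restr F V (U \<inter> V) t"] U V by (simp add: germ_restr)
qed

lemma stalk_in_topspace: "\<xi> \<in> carrier (stalk X F x) \<Longrightarrow> x \<in> topspace X"
  by (metis stalk_cases openin_subset subsetD)

lemma group_stalk:
  assumes x: "x \<in> topspace X"
  shows "group (stalk X F x)"
proof (rule groupI)
  let ?S = "stalk X F x"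
  have one: "\<one>\<^bsub>?S\<^esub> = germ X F (topspace X) \<one>\<^bsub>sections F (topspace X)\<^esub> x"
    by (simp add: stalk_def)
  show "\<one>\<^bsub>?S\<^esub> \<in> carrier ?S"
    using x by (simp add: one)
  show "\<xi> \<otimes>\<^bsub>?S\<^esub> \<eta> \<in> carrier ?S" if "\<xi> \<in> carrier ?S" "\<eta> \<in> carrier ?S" for \<xi> \<eta>
    using stalk_cases2[OF that] by (metis germ_in_stalk germ_mult mult_closed)
  show "\<one>\<^bsub>?S\<^esub> \<otimes>\<^bsub>?S\<^esub> \<xi> = \<xi>" if xi: "\<xi> \<in> carrier ?S" for \<xi>
    using xi
  proof (rule stalk_cases)
    fix U s assume U: "openin X U" "x \<in> U" "s \<in> \<Gamma> F U" "\<xi> = germ X F U s x"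
    then show ?thesis
      unfolding U(4) using U(1-3) by (simp add: germ_one [of U x, symmetric] germ_mult [symmetric]
          group.is_monoid[OF group_sections] monoid.l_one)
  qed
  show "\<exists>\<eta>\<in>carrier ?S. \<eta> \<otimes>\<^bsub>?S\<^esub> \<xi> = \<one>\<^bsub>?S\<^esub>" if xi: "\<xi> \<in> carrier ?S" for \<xi>
    using xi
  proof (rule stalk_cases)
    fix U s assume U: "openin X U" "x \<in> U" "s \<in> \<Gamma> F U" "\<xi> = germ X F U s x"
    then show ?thesis
      unfolding U(4) using U(1-3)
      by (intro bexI[of _ "germ X F U (inv\<^bsub>sections F U\<^esub> s) x"])
         (simp_all add: germ_one [of U x, symmetric] germ_mult [symmetric] group.l_inv[OF group_sections])
  qed
  show "\<xi> \<otimes>\<^bsub>?S\<^esub> \<eta> \<otimes>\<^bsub>?S\<^esub> \<zeta> = \<xi> \<otimes>\<^bsub>?S\<^esub> (\<eta> \<otimes>\<^bsub>?S\<^esub> \<zeta>)"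
    if xi: "\<xi> \<in> carrier ?S" and eta: "\<eta> \<in> carrier ?S" and zeta: "\<zeta> \<in> carrier ?S" for \<xi> \<eta> \<zeta>
    using xi eta
  proof (rule stalk_cases2)
    fix U s t assume U: "openin X U" "x \<in> U" "s \<in> \<Gamma> F U"
      "t \<in> \<Gamma> F U" "\<xi> = germ X F U s x" "\<eta> = germ X F U t x"
    from zeta obtain V r where V: "openin X V" "x \<in> V" "r \<in> \<Gamma> F V"
      "\<zeta> = germ X F V r x" using stalk_cases by metis
    let ?N = "U \<inter> V"
    have N: "openin X ?N" using U V by blast
    have *: "\<xi> = germ X F ?N (restr F U ?N s) x" "\<eta> = germ X F ?N (restr F U ?N t) x"
      "\<zeta> = germ X F ?N (restr F V ?N r) x"
      using U V N by (simp_all add: germ_restr)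
    show ?thesis
      unfolding * using U V N
      by (simp add: germ_mult [symmetric] monoid.m_assoc[OF group.is_monoid[OF group_sections]])
  qed
qed

lemma germ_inv:
  assumes "openin X U" "x \<in> U" "s \<in> \<Gamma> F U"
  shows "germ X F U (inv\<^bsub>sections F U\<^esub> s) x = inv\<^bsub>stalk X F x\<^esub> germ X F U s x"
proof -
  have "x \<in> topspace X" using assms openin_subset by blast
  then have "group (stalk X F x)" by (rule group_stalk)
  moreover have "germ X F U (inv\<^bsub>sections F U\<^esub> s) x \<otimes>\<^bsub>stalk X F x\<^esub> germ X F U s x = \<one>\<^bsub>stalk X F x\<^esub>"
    using assms by (simp add: germ_mult [symmetric] germ_one group.l_inv[OF group_sections])
  ultimately show ?thesis
    using assms by (metis group.inv_equality germ_in_stalk inverse_closed)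
qed

lemma comm_group_stalk:
  assumes "\<And>U. openin X U \<Longrightarrow> comm_group (sections F U)" "x \<in> topspace X"
  shows "comm_group (stalk X F x)"
proof (rule group.group_comm_groupI[OF group_stalk[OF assms(2)]])
  fix \<xi> \<eta> assume "\<xi> \<in> carrier (stalk X F x)" "\<eta> \<in> carrier (stalk X F x)"
  then show "\<xi> \<otimes>\<^bsub>stalk X F x\<^esub> \<eta> = \<eta> \<otimes>\<^bsub>stalk X F x\<^esub> \<xi>"
  proof (rule stalk_cases2)
    fix U s t assume U: "openin X U" "x \<in> U" "s \<in> \<Gamma> F U"
      "t \<in> \<Gamma> F U" "\<xi> = germ X F U s x" "\<eta> = germ X F U t x"
    have "s \<otimes>\<^bsub>sections F U\<^esub> t = t \<otimes>\<^bsub>sections F U\<^esub> s"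
      using comm_group.axioms(1)[OF assms(1)] U(1,3,4) comm_monoid.m_comm by metis
    then show ?thesis
      unfolding U(5,6) using U(1-4) by (metis germ_mult)
  qed
qed

end

context sheaf_of_groups
begin

text \<open>This turns identities between restrictions of sections to varying open sets into pointwise
  identities, for which only a computation in a single group remains.\<close>

lemma section_eqI:
  assumes U: "openin X U" "s \<in> \<Gamma> F U" "t \<in> \<Gamma> F U"
    and eq: "\<And>x. x \<in> U \<Longrightarrow> germ X F U s x = germ X F U t x"
  shows "s = t"
proof -
  have "\<exists>W. openin X W \<and> x \<in> W \<and> W \<subseteq> U \<and> restr F U W s = restr F U W t" if "x \<in> U" for x
    using eq[OF that] that U by (subst (asm) germ_eq_iff) auto
  then obtain W where W: "\<And>x. x \<in> U \<Longrightarrow> openin X (W x)" "\<And>x. x \<in> U \<Longrightarrow> x \<in> W x"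
    "\<And>x. x \<in> U \<Longrightarrow> W x \<subseteq> U" "\<And>x. x \<in> U \<Longrightarrow> restr F U (W x) s = restr F U (W x) t" by metis
  have un: "\<Union> (W ` U) = U" using W by auto
  show ?thesis
    by (rule locality[of "W ` U"]) (use W U in \<open>auto simp: un\<close>)
qed

end

text \<open>Stalk elements are sets, but are treated as points from here on: an equation between them
  must not be split into two inclusions.\<close>

declare subset_antisym [rule del]

section \<open>Morphisms of presheaves and induced maps of stalks\<close>

definition stalk_map where
  "stalk_map X F' \<phi> x \<xi> = (\<Union>(V, t)\<in>\<xi>. germ X F' V (\<phi> V t) x)"

lemma stalkwise_eq: "stalkwise X F' \<phi> U \<sigma> = (\<lambda>x\<in>U. stalk_map X F' \<phi> x (\<sigma> x))"
  by (simp add: stalkwise_def stalk_map_def)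

text \<open>The unions over representatives that define products of germs, induced maps and connecting
  maps are evaluated by showing that all members agree.\<close>

lemma UN_const_pair:
  "\<lbrakk>(U, s) \<in> \<xi>; \<And>V t. (V, t) \<in> \<xi> \<Longrightarrow> f V t = c\<rbrakk> \<Longrightarrow> (\<Union>(V, t)\<in>\<xi>. f V t) = c"
  by (intro subset_antisym) auto

locale presheaf_morphism = dom: presheaf_of_groups X F + cod: presheaf_of_groups X F'
  for X :: "'a topology" and F :: "('a, 'g) presheaf" and F' :: "('a, 'h) presheaf" +
  fixes \<phi> :: "'a set \<Rightarrow> 'g \<Rightarrow> 'h"
  assumes hom: "openin X U \<Longrightarrow> \<phi> U \<in> hom (sections F U) (sections F' U)"
    and natural: "\<lbrakk>openin X U; openin X V; V \<subseteq> U; s \<in> \<Gamma> F U\<rbrakk>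
      \<Longrightarrow> restr F' U V (\<phi> U s) = \<phi> V (restr F U V s)"
begin

lemma map_closed [simp]:
  "\<lbrakk>openin X U; s \<in> \<Gamma> F U\<rbrakk> \<Longrightarrow> \<phi> U s \<in> \<Gamma> F' U"
  using hom by (auto simp: hom_def)

lemma map_mult:
  "\<lbrakk>openin X U; s \<in> \<Gamma> F U; t \<in> \<Gamma> F U\<rbrakk>
     \<Longrightarrow> \<phi> U (s \<otimes>\<^bsub>sections F U\<^esub> t) = \<phi> U s \<otimes>\<^bsub>sections F' U\<^esub> \<phi> U t"
  using hom by (auto simp: hom_def)

lemma map_one: "openin X U \<Longrightarrow> \<phi> U \<one>\<^bsub>sections F U\<^esub> = \<one>\<^bsub>sections F' U\<^esub>"
  using hom_one[OF hom dom.group_sections cod.group_sections] by blast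

lemma map_inv:
  assumes "openin X U" "s \<in> \<Gamma> F U"
  shows "\<phi> U (inv\<^bsub>sections F U\<^esub> s) = inv\<^bsub>sections F' U\<^esub> \<phi> U s"
  using assms hom dom.group_sections cod.group_sections group_hom.hom_inv
  by (metis group_hom.intro group_hom_axioms.intro)

lemma stalk_map_germ:
  assumes U: "openin X U" "x \<in> U" "s \<in> \<Gamma> F U"
  shows "stalk_map X F' \<phi> x (germ X F U s x) = germ X F' U (\<phi> U s) x"
proof -
  have "germ X F' V (\<phi> V t) x = germ X F' U (\<phi> U s) x" if "(V, t) \<in> germ X F U s x" for V t
  proof -
    from that obtain W where V: "openin X V" "x \<in> V" "t \<in> \<Gamma> F V"
      and W: "openin X W" "x \<in> W" "W \<subseteq> U \<inter> V" "restr F U W s = restr F V W t"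
      unfolding dom.germ_mem_iff by blast
    then show ?thesis
      using U natural[of V W t] natural[of U W s]
      by (subst cod.germ_eq_iff) (auto intro!: exI[of _ W])
  qed
  then show ?thesis
    unfolding stalk_map_def by (rule UN_const_pair[OF dom.germ_refl[OF U]])
qed

lemma stalk_map_hom: "stalk_map X F' \<phi> x \<in> hom (stalk X F x) (stalk X F' x)"
proof (rule homI)
  fix \<xi> assume "\<xi> \<in> carrier (stalk X F x)"
  then show "stalk_map X F' \<phi> x \<xi> \<in> carrier (stalk X F' x)"
    by (rule dom.stalk_cases) (simp add: stalk_map_germ)
next
  fix \<xi> \<eta> assume "\<xi> \<in> carrier (stalk X F x)" "\<eta> \<in> carrier (stalk X F x)"
  then show "stalk_map X F' \<phi> x (\<xi> \<otimes>\<^bsub>stalk X F x\<^esub> \<eta>)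
      = stalk_map X F' \<phi> x \<xi> \<otimes>\<^bsub>stalk X F' x\<^esub> stalk_map X F' \<phi> x \<eta>"
    by (rule dom.stalk_cases2)
       (simp add: stalk_map_germ dom.germ_mult [symmetric] cod.germ_mult [symmetric] map_mult)
qed

lemma stalk_map_group_hom:
  "x \<in> topspace X \<Longrightarrow> group_hom (stalk X F x) (stalk X F' x) (stalk_map X F' \<phi> x)"
  using dom.group_stalk cod.group_stalk stalk_map_hom
  by (simp add: group_hom_def group_hom_axioms_def)

lemma stalk_map_closed [simp]:
  "\<xi> \<in> carrier (stalk X F x) \<Longrightarrow> stalk_map X F' \<phi> x \<xi> \<in> carrier (stalk X F' x)"
  using stalk_map_hom by (auto simp: hom_def)

end

lemma presheaf_morphism_comp:
  assumes "presheaf_morphism X F F' \<phi>" "presheaf_morphism X F' F'' \<psi>"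
  shows "presheaf_morphism X F F'' (\<lambda>U s. \<psi> U (\<phi> U s))"
proof -
  interpret f: presheaf_morphism X F F' \<phi> by fact
  interpret g: presheaf_morphism X F' F'' \<psi> by fact
  show ?thesis
    by unfold_locales (auto intro!: homI simp: f.map_mult g.map_mult f.natural g.natural)
qed

section \<open>Subpresheaves, discontinuous sections and sheafification\<close>

lemma subpresheaf_simps [simp]:
  "sections (subpresheaf F N) U = (sections F U)\<lparr>carrier := N U\<rparr>"
  "restr (subpresheaf F N) = restr F"
  by (simp_all add: subpresheaf_def)

lemma godement_simps [simp]:
  "sections (godement X F) U = product_group U (stalk X F)"
  "restr (godement X F) U V \<sigma> = restrict \<sigma> V"
  by (simp_all add: godement_def)

lemma (in presheaf_of_groups) subpresheaf_presheaf:
  assumes sub: "\<And>U. openin X U \<Longrightarrow> subgroup (N U) (sections F U)"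
    and restr_N: "\<And>U V s. \<lbrakk>openin X U; openin X V; V \<subseteq> U; s \<in> N U\<rbrakk> \<Longrightarrow> restr F U V s \<in> N V"
  shows "presheaf_of_groups X (subpresheaf F N)"
proof (rule presheaf_of_groups.intro)
  have mem: "s \<in> \<Gamma> F U" if "openin X U" "s \<in> N U" for U s
    using that sub subgroup.mem_carrier by metis
  show "group (sections (subpresheaf F N) U)" if "openin X U" for U
    using that by (simp add: subgroup.subgroup_is_group sub group_sections)
  show "restr (subpresheaf F N) U V \<in> hom (sections (subpresheaf F N) U) (sections (subpresheaf F N) V)"
    if "openin X U" "openin X V" "V \<subseteq> U" for U V
    using that by (auto intro!: homI simp: restr_N restr_mult mem)
  show "restr (subpresheaf F N) U U s = s"
    if "openin X U" "s \<in> \<Gamma> (subpresheaf F N) U" for U s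
    using that mem by (simp add: restr_id)
  show "restr (subpresheaf F N) V W (restr (subpresheaf F N) U V s) = restr (subpresheaf F N) U W s"
    if "openin X U" "openin X V" "openin X W" "W \<subseteq> V" "V \<subseteq> U"
      "s \<in> \<Gamma> (subpresheaf F N) U" for U V W s
    using that mem by (simp add: restr_comp)
qed

context presheaf_of_groups
begin

lemma group_stalk_on: "openin X U \<Longrightarrow> x \<in> U \<Longrightarrow> group (stalk X F x)"
  using group_stalk openin_subset by blast

lemma group_godement: "openin X U \<Longrightarrow> group (product_group U (stalk X F))"
  by (rule product_group) (rule group_stalk_on)

lemma germs_in_godement [simp]:
  "\<lbrakk>openin X U; s \<in> \<Gamma> F U\<rbrakk> \<Longrightarrow> germs X F U s \<in> disc X F U"
  by (auto simp: germs_def)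

lemma godement_presheaf: "presheaf_of_groups X (godement X F)"
proof (rule presheaf_of_groups.intro)
  show "group (sections (godement X F) U)" if "openin X U" for U
    using that by (simp add: group_godement)
  show "restr (godement X F) U V \<in> hom (sections (godement X F) U) (sections (godement X F) V)"
    if "openin X U" "openin X V" "V \<subseteq> U" for U V
    using that by (intro homI) (force simp: PiE_iff fun_eq_iff restrict_def extensional_def)+
qed (auto simp: PiE_iff fun_eq_iff restrict_def extensional_def)

lemma restrict_eq_germs_iff: "restrict \<sigma> V = germs X F V s \<longleftrightarrow> (\<forall>y\<in>V. \<sigma> y = germ X F V s y)"
  by (auto simp: germs_def fun_eq_iff restrict_def)

lemma sheafify_simps [simp]:
  "\<sigma> \<otimes>\<^bsub>sections (sheafify X F) U\<^esub> \<tau> = (\<lambda>x\<in>U. \<sigma> x \<otimes>\<^bsub>stalk X F x\<^esub> \<tau> x)"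
  "\<one>\<^bsub>sections (sheafify X F) U\<^esub> = (\<lambda>x\<in>U. \<one>\<^bsub>stalk X F x\<^esub>)"
  "restr (sheafify X F) U V \<sigma> = restrict \<sigma> V"
  by (simp_all add: sheafify_def)

lemma sheafify_mem_iff:
  "\<sigma> \<in> \<Gamma> (sheafify X F) U \<longleftrightarrow> \<sigma> \<in> disc X F U \<and>
     (\<forall>x\<in>U. \<exists>V s. openin X V \<and> x \<in> V \<and> V \<subseteq> U \<and> s \<in> \<Gamma> F V \<and>
        (\<forall>y\<in>V. \<sigma> y = germ X F V s y))"
  by (simp add: sheafify_def restrict_eq_germs_iff)

lemma sheafify_cases:
  assumes "\<sigma> \<in> \<Gamma> (sheafify X F) U" "x \<in> U"
  obtains V s where "openin X V" "x \<in> V" "V \<subseteq> U" "s \<in> \<Gamma> F V"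
    "\<And>y. y \<in> V \<Longrightarrow> \<sigma> y = germ X F V s y"
  using assms unfolding sheafify_mem_iff by meson

lemma restrict_sheafify:
  assumes "openin X V" "V \<subseteq> U" "\<sigma> \<in> \<Gamma> (sheafify X F) U"
  shows "restrict \<sigma> V \<in> \<Gamma> (sheafify X F) V"
  unfolding sheafify_mem_iff
proof (intro conjI ballI)
  show "restrict \<sigma> V \<in> disc X F V"
    using assms by (auto simp: sheafify_mem_iff)
  fix x assume x: "x \<in> V"
  then have "x \<in> U" using assms by blast
  then obtain W s where W: "openin X W" "x \<in> W" "W \<subseteq> U" "s \<in> \<Gamma> F W"
    "\<And>y. y \<in> W \<Longrightarrow> \<sigma> y = germ X F W s y" using sheafify_cases[OF assms(3)] by metis
  then show "\<exists>N r. openin X N \<and> x \<in> N \<and> N \<subseteq> V \<and> r \<in> \<Gamma> F N \<and>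
      (\<forall>y\<in>N. restrict \<sigma> V y = germ X F N r y)"
    using x assms germ_restr[of W "W \<inter> V"] restr_closed[of W "W \<inter> V"] openin_Int[of X W V]
    by (intro exI[of _ "W \<inter> V"] exI[of _ "restr F W (W \<inter> V) s"]) auto
qed

lemma sheafify_subgroup:
  assumes U: "openin X U"
  shows "subgroup (\<Gamma> (sheafify X F) U) (sections (godement X F) U)"
proof (rule group.subgroupI)
  show "group (sections (godement X F) U)"
    using U by (simp add: group_godement)
  show "\<Gamma> (sheafify X F) U \<subseteq> \<Gamma> (godement X F) U"
    by (simp add: subset_iff sheafify_mem_iff)
  have "(\<lambda>x\<in>U. \<one>\<^bsub>stalk X F x\<^esub>) \<in> \<Gamma> (sheafify X F) U"
    unfolding sheafify_mem_iff using U group_stalk_on[OF U] germ_one[OF U]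
    by (auto intro!: exI[of _ U] exI[of _ "\<one>\<^bsub>sections F U\<^esub>"] simp: monoid.one_closed[OF group.is_monoid])
  then show "\<Gamma> (sheafify X F) U \<noteq> {}" by blast
next
  fix \<sigma> assume s: "\<sigma> \<in> \<Gamma> (sheafify X F) U"
  then have PiE: "\<sigma> \<in> disc X F U" by (simp add: sheafify_mem_iff)
  have eq: "inv\<^bsub>sections (godement X F) U\<^esub> \<sigma> = (\<lambda>x\<in>U. inv\<^bsub>stalk X F x\<^esub> \<sigma> x)"
    using PiE group_stalk_on[OF U] by simp
  show "inv\<^bsub>sections (godement X F) U\<^esub> \<sigma> \<in> \<Gamma> (sheafify X F) U"
    unfolding eq sheafify_mem_iff
  proof (intro conjI ballI)
    show "(\<lambda>x\<in>U. inv\<^bsub>stalk X F x\<^esub> \<sigma> x) \<in> disc X F U"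
      using PiE group_stalk_on[OF U] by (auto intro!: group.inv_closed)
    fix x assume "x \<in> U"
    then obtain V r where V: "openin X V" "x \<in> V" "V \<subseteq> U" "r \<in> \<Gamma> F V"
      "\<And>y. y \<in> V \<Longrightarrow> \<sigma> y = germ X F V r y" using sheafify_cases[OF s] by metis
    then show "\<exists>V r. openin X V \<and> x \<in> V \<and> V \<subseteq> U \<and> r \<in> \<Gamma> F V \<and>
        (\<forall>y\<in>V. (\<lambda>x\<in>U. inv\<^bsub>stalk X F x\<^esub> \<sigma> x) y = germ X F V r y)"
      by (intro exI[of _ V] exI[of _ "inv\<^bsub>sections F V\<^esub> r"]) (auto simp: germ_inv)
  qed
next
  fix \<sigma> \<tau> assume s: "\<sigma> \<in> \<Gamma> (sheafify X F) U" and t: "\<tau> \<in> \<Gamma> (sheafify X F) U"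
  then have PiE: "\<sigma> \<in> disc X F U" "\<tau> \<in> disc X F U"
    by (simp_all add: sheafify_mem_iff)
  have eq: "\<sigma> \<otimes>\<^bsub>sections (godement X F) U\<^esub> \<tau> = (\<lambda>x\<in>U. \<sigma> x \<otimes>\<^bsub>stalk X F x\<^esub> \<tau> x)"
    by simp
  show "\<sigma> \<otimes>\<^bsub>sections (godement X F) U\<^esub> \<tau> \<in> \<Gamma> (sheafify X F) U"
    unfolding eq sheafify_mem_iff
  proof (intro conjI ballI)
    show "(\<lambda>x\<in>U. \<sigma> x \<otimes>\<^bsub>stalk X F x\<^esub> \<tau> x) \<in> disc X F U"
      using PiE group_stalk_on[OF U] by (auto intro!: monoid.m_closed group.is_monoid)
    fix x assume x: "x \<in> U"
    then obtain V r where V: "openin X V" "x \<in> V" "V \<subseteq> U" "r \<in> \<Gamma> F V"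
      "\<And>y. y \<in> V \<Longrightarrow> \<sigma> y = germ X F V r y" using sheafify_cases[OF s] by metis
    from x obtain V' r' where V': "openin X V'" "x \<in> V'" "V' \<subseteq> U" "r' \<in> \<Gamma> F V'"
      "\<And>y. y \<in> V' \<Longrightarrow> \<tau> y = germ X F V' r' y" using sheafify_cases[OF t] by metis
    let ?N = "V \<inter> V'"
    have N: "openin X ?N" using V V' by blast
    have "\<sigma> y \<otimes>\<^bsub>stalk X F y\<^esub> \<tau> y
        = germ X F ?N (restr F V ?N r \<otimes>\<^bsub>sections F ?N\<^esub> restr F V' ?N r') y" if "y \<in> ?N" for y
      using that V V' N by (simp add: germ_mult germ_restr)
    then show "\<exists>V r. openin X V \<and> x \<in> V \<and> V \<subseteq> U \<and> r \<in> \<Gamma> F V \<and>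
        (\<forall>y\<in>V. (\<lambda>x\<in>U. \<sigma> x \<otimes>\<^bsub>stalk X F x\<^esub> \<tau> x) y = germ X F V r y)"
      using V V' N
      by (intro exI[of _ ?N] exI[of _ "restr F V ?N r \<otimes>\<^bsub>sections F ?N\<^esub> restr F V' ?N r'"]) auto
  qed
qed

text \<open>Gluing is immediate because sections of a sheafification are functions.\<close>

lemma sheafify_sheaf: "sheaf_of_groups X (sheafify X F)"
proof -
  have eq: "sheafify X F = subpresheaf (godement X F) (\<lambda>U. \<Gamma> (sheafify X F) U)"
    by (simp add: sheafify_def subpresheaf_def)
  have "presheaf_of_groups X (sheafify X F)"
    by (subst eq, rule presheaf_of_groups.subpresheaf_presheaf[OF godement_presheaf])
       (use sheafify_subgroup restrict_sheafify in auto)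
  then interpret S: presheaf_of_groups X "sheafify X F" .
  show ?thesis
  proof unfold_locales
    fix \<U> s t
    assume s: "s \<in> \<Gamma> (sheafify X F) (\<Union>\<U>)"
      and t: "t \<in> \<Gamma> (sheafify X F) (\<Union>\<U>)"
      and eq: "\<And>U. U \<in> \<U> \<Longrightarrow> restr (sheafify X F) (\<Union>\<U>) U s = restr (sheafify X F) (\<Union>\<U>) U t"
    have "s x = t x" if "x \<in> \<Union>\<U>" for x
      using that eq by (metis UnionE restrict_apply' sheafify_simps(3))
    then show "s = t"
      using s t PiE_ext[of s "\<Union>\<U>" "\<lambda>x. carrier (stalk X F x)" t] unfolding sheafify_mem_iff by blast
  next
    fix \<U> f
    assume op: "\<And>U. U \<in> \<U> \<Longrightarrow> openin X U"
      and f: "\<And>U. U \<in> \<U> \<Longrightarrow> f U \<in> \<Gamma> (sheafify X F) U"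
      and compat: "\<And>U V. \<lbrakk>U \<in> \<U>; V \<in> \<U>\<rbrakk> \<Longrightarrow> restr (sheafify X F) U (U \<inter> V) (f U)
        = restr (sheafify X F) V (U \<inter> V) (f V)"
    have "\<exists>U. U \<in> \<U> \<and> x \<in> U" if "x \<in> \<Union>\<U>" for x using that by blast
    then obtain u where u: "\<And>x. x \<in> \<Union>\<U> \<Longrightarrow> u x \<in> \<U> \<and> x \<in> u x" by metis
    define s where "s = (\<lambda>x\<in>\<Union>\<U>. f (u x) x)"
    have s: "s x = f U x" if U: "U \<in> \<U>" "x \<in> U" for U x
    proof -
      have x: "u x \<in> \<U>" "x \<in> u x" using u U by blast+
      from compat[OF this(1) U(1)] have "restrict (f (u x)) (u x \<inter> U) x = restrict (f U) (u x \<inter> U) x"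
        by simp
      then show ?thesis using x U by (auto simp: s_def)
    qed
    have "s \<in> \<Gamma> (sheafify X F) (\<Union>\<U>)"
      unfolding sheafify_mem_iff
    proof (intro conjI ballI)
      have "s x \<in> carrier (stalk X F x)" if "x \<in> U" "U \<in> \<U>" for x U
        using s f[of U] that by (auto simp: sheafify_mem_iff)
      moreover have "s \<in> extensional (\<Union>\<U>)" by (simp add: s_def)
      ultimately show "s \<in> disc X F (\<Union>\<U>)"
        by (auto simp: PiE_iff)
      fix x assume "x \<in> \<Union>\<U>"
      then obtain U where U: "U \<in> \<U>" "x \<in> U" by blast
      obtain V r where "openin X V" "x \<in> V" "V \<subseteq> U" "r \<in> \<Gamma> F V"
        "\<And>y. y \<in> V \<Longrightarrow> f U y = germ X F V r y"
        using sheafify_cases[OF f[OF U(1)] U(2)] by metis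
      then show "\<exists>V r. openin X V \<and> x \<in> V \<and> V \<subseteq> \<Union>\<U> \<and> r \<in> \<Gamma> F V \<and>
          (\<forall>y\<in>V. s y = germ X F V r y)"
        using U s by (intro exI[of _ V] exI[of _ r]) auto
    qed
    moreover have "restrict s U = f U" if "U \<in> \<U>" for U
      using that s f[OF that] by (auto simp: sheafify_mem_iff PiE_iff extensional_def restrict_def)
    ultimately show "\<exists>s\<in>\<Gamma> (sheafify X F) (\<Union>\<U>).
        \<forall>U\<in>\<U>. restr (sheafify X F) (\<Union>\<U>) U s = f U" by auto
  qed
qed

lemma sheafify_comm:
  assumes "\<And>U. openin X U \<Longrightarrow> comm_group (sections F U)" "openin X U"
  shows "comm_group (sections (sheafify X F) U)"
proof -
  interpret S: sheaf_of_groups X "sheafify X F" by (rule sheafify_sheaf)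
  have "\<xi> \<otimes>\<^bsub>stalk X F x\<^esub> \<eta> = \<eta> \<otimes>\<^bsub>stalk X F x\<^esub> \<xi>"
    if "x \<in> U" "\<xi> \<in> carrier (stalk X F x)" "\<eta> \<in> carrier (stalk X F x)" for x \<xi> \<eta>
    using comm_group_stalk[of x] that assms openin_subset
    by (metis comm_group.axioms(1) comm_monoid.m_comm stalk_in_topspace)
  then show ?thesis
    using assms by (intro group.group_comm_groupI[OF S.group_sections])
      (auto simp: sheafify_mem_iff PiE_iff fun_eq_iff restrict_def)
qed

lemma germs_morphism: "presheaf_morphism X F (sheafify X F) (germs X F)"
proof -
  interpret S: sheaf_of_groups X "sheafify X F" by (rule sheafify_sheaf)
  show ?thesis
  proof unfold_locales
    show "germs X F U \<in> hom (sections F U) (sections (sheafify X F) U)" if U: "openin X U" for U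
    proof (rule homI)
      fix s assume s: "s \<in> \<Gamma> F U"
      show "germs X F U s \<in> \<Gamma> (sheafify X F) U"
        unfolding sheafify_mem_iff
        using U s germs_in_godement[OF U s] by (auto simp: germs_def intro!: exI[of _ U] exI[of _ s])
    qed (use U in \<open>auto simp: germs_def germ_mult\<close>)
    show "restr (sheafify X F) U V (germs X F U s) = germs X F V (restr F U V s)"
      if "openin X U" "openin X V" "V \<subseteq> U" "s \<in> \<Gamma> F U" for U V s
      using that by (auto simp: germs_def germ_restr fun_eq_iff restrict_def)
  qed
qed

end

context presheaf_morphism
begin

lemma stalkwise_germs:
  "\<lbrakk>openin X U; s \<in> \<Gamma> F U\<rbrakk>
     \<Longrightarrow> stalkwise X F' \<phi> U (germs X F U s) = germs X F' U (\<phi> U s)"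
  by (auto simp: stalkwise_eq germs_def stalk_map_germ fun_eq_iff restrict_def)

lemma stalkwise_morphism: "presheaf_morphism X (sheafify X F) (sheafify X F') (stalkwise X F' \<phi>)"
proof -
  interpret S: sheaf_of_groups X "sheafify X F" by (rule dom.sheafify_sheaf)
  interpret S': sheaf_of_groups X "sheafify X F'" by (rule cod.sheafify_sheaf)
  show ?thesis
  proof unfold_locales
    show "stalkwise X F' \<phi> U \<in> hom (sections (sheafify X F) U) (sections (sheafify X F') U)"
      if U: "openin X U" for U
    proof (rule homI)
      fix \<sigma> assume s: "\<sigma> \<in> \<Gamma> (sheafify X F) U"
      show "stalkwise X F' \<phi> U \<sigma> \<in> \<Gamma> (sheafify X F') U"
        unfolding cod.sheafify_mem_iff
      proof (intro conjI ballI)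
        show "stalkwise X F' \<phi> U \<sigma> \<in> disc X F' U"
          using s by (auto simp: stalkwise_eq dom.sheafify_mem_iff intro!: stalk_map_closed)
        fix x assume "x \<in> U"
        then obtain V r where "openin X V" "x \<in> V" "V \<subseteq> U" "r \<in> \<Gamma> F V"
          "\<And>y. y \<in> V \<Longrightarrow> \<sigma> y = germ X F V r y" using dom.sheafify_cases[OF s] by metis
        then show "\<exists>V r. openin X V \<and> x \<in> V \<and> V \<subseteq> U \<and> r \<in> \<Gamma> F' V \<and>
            (\<forall>y\<in>V. stalkwise X F' \<phi> U \<sigma> y = germ X F' V r y)"
          by (intro exI[of _ V] exI[of _ "\<phi> V r"]) (auto simp: stalkwise_eq stalk_map_germ)
      qed
    next
      fix \<sigma> \<tau>
      assume "\<sigma> \<in> \<Gamma> (sheafify X F) U" "\<tau> \<in> \<Gamma> (sheafify X F) U"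
      then show "stalkwise X F' \<phi> U (\<sigma> \<otimes>\<^bsub>sections (sheafify X F) U\<^esub> \<tau>)
          = stalkwise X F' \<phi> U \<sigma> \<otimes>\<^bsub>sections (sheafify X F') U\<^esub> stalkwise X F' \<phi> U \<tau>"
        using stalk_map_hom
        by (auto simp: stalkwise_eq dom.sheafify_mem_iff hom_def PiE_iff fun_eq_iff restrict_def)
    qed
  qed (auto simp: stalkwise_eq fun_eq_iff restrict_def)
qed

end

section \<open>Quotient presheaves\<close>

locale normal_subpresheaf = presheaf_of_groups X F
  for X :: "'a topology" and F :: "('a, 'g) presheaf" +
  fixes N :: "'a set \<Rightarrow> 'g set"
  assumes normal: "openin X U \<Longrightarrow> N U \<lhd> sections F U"
    and restr_N: "\<lbrakk>openin X U; openin X V; V \<subseteq> U; s \<in> N U\<rbrakk> \<Longrightarrow> restr F U V s \<in> N V"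
begin

lemma quotient_sections [simp]: "sections (quotient_presheaf F N) U = sections F U Mod N U"
  by (simp add: quotient_presheaf_def)

lemma subgroup_N: "openin X U \<Longrightarrow> subgroup (N U) (sections F U)"
  using normal normal_imp_subgroup by blast

lemma quotient_cases:
  assumes "K \<in> carrier (sections F U Mod N U)"
  obtains s where "s \<in> \<Gamma> F U" "K = N U #>\<^bsub>sections F U\<^esub> s"
  using assms by (auto simp: FactGroup_def RCOSETS_def)

text \<open>Multiplying by \<open>N V\<close> completes the image of a coset, which is contained in a coset but is in
  general smaller, to the full coset.\<close>

lemma restr_coset:
  assumes U: "openin X U" "openin X V" "V \<subseteq> U" and s: "s \<in> \<Gamma> F U"
  shows "restr (quotient_presheaf F N) U V (N U #>\<^bsub>sections F U\<^esub> s)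
    = N V #>\<^bsub>sections F V\<^esub> restr F U V s"
proof -
  let ?A = "sections F U" and ?B = "sections F V"
  interpret A: group ?A using U group_sections by blast
  interpret B: group ?B using U group_sections by blast
  interpret NB: normal "N V" ?B using U normal by blast
  have "restr F U V ` (N U #>\<^bsub>?A\<^esub> s) \<subseteq> N V #>\<^bsub>?B\<^esub> restr F U V s"
    using U s subgroup.mem_carrier[OF subgroup_N[OF U(1)]]
    by (auto simp: r_coset_def restr_mult intro!: restr_N)
  then have "N V <#>\<^bsub>?B\<^esub> (restr F U V ` (N U #>\<^bsub>?A\<^esub> s)) \<subseteq> N V <#>\<^bsub>?B\<^esub> (N V #>\<^bsub>?B\<^esub> restr F U V s)"
    unfolding set_mult_def by blast
  also have "\<dots> = N V #>\<^bsub>?B\<^esub> restr F U V s"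
    using U s by (intro NB.rcosets_mult_eq) (auto simp: RCOSETS_def)
  finally have le: "N V <#>\<^bsub>?B\<^esub> (restr F U V ` (N U #>\<^bsub>?A\<^esub> s)) \<subseteq> N V #>\<^bsub>?B\<^esub> restr F U V s" .
  have "s \<in> N U #>\<^bsub>?A\<^esub> s"
    using s U subgroup_N A.rcos_self by blast
  then have "N V #>\<^bsub>?B\<^esub> restr F U V s \<subseteq> N V <#>\<^bsub>?B\<^esub> (restr F U V ` (N U #>\<^bsub>?A\<^esub> s))"
    unfolding set_mult_def r_coset_def[of ?B "N V"] by blast
  with le show ?thesis
    by (simp add: quotient_presheaf_def)
qed

lemma coset_closed:
  "openin X U \<Longrightarrow> s \<in> \<Gamma> F U
     \<Longrightarrow> N U #>\<^bsub>sections F U\<^esub> s \<in> carrier (sections F U Mod N U)"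
  by (auto simp: FactGroup_def RCOSETS_def)

lemma quotient_presheaf_presheaf: "presheaf_of_groups X (quotient_presheaf F N)"
proof (rule presheaf_of_groups.intro)
  show "group (sections (quotient_presheaf F N) U)" if "openin X U" for U
    using that normal[of U] normal.factorgroup_is_group by simp
  show "restr (quotient_presheaf F N) U V
      \<in> hom (sections (quotient_presheaf F N) U) (sections (quotient_presheaf F N) V)"
    if U: "openin X U" "openin X V" "V \<subseteq> U" for U V
  proof (rule homI; simp only: quotient_sections)
    fix K assume "K \<in> carrier (sections F U Mod N U)"
    then show "restr (quotient_presheaf F N) U V K \<in> carrier (sections F V Mod N V)"
      by (rule quotient_cases) (use U in \<open>simp add: restr_coset coset_closed\<close>)
  next
    fix K L assume "K \<in> carrier (sections F U Mod N U)" "L \<in> carrier (sections F U Mod N U)"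
    then obtain s t where st: "s \<in> \<Gamma> F U" "K = N U #>\<^bsub>sections F U\<^esub> s"
      "t \<in> \<Gamma> F U" "L = N U #>\<^bsub>sections F U\<^esub> t" by (metis quotient_cases)
    have KL: "K \<otimes>\<^bsub>sections F U Mod N U\<^esub> L = N U #>\<^bsub>sections F U\<^esub> (s \<otimes>\<^bsub>sections F U\<^esub> t)"
      using st U normal.rcos_sum[OF normal] by simp
    show "restr (quotient_presheaf F N) U V (K \<otimes>\<^bsub>sections F U Mod N U\<^esub> L) =
      restr (quotient_presheaf F N) U V K \<otimes>\<^bsub>sections F V Mod N V\<^esub> restr (quotient_presheaf F N) U V L"
      unfolding KL using st U normal.rcos_sum[OF normal, of V] by (simp add: restr_coset restr_mult)
  qed
  show "restr (quotient_presheaf F N) U U K = K"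
    if "openin X U" "K \<in> \<Gamma> (quotient_presheaf F N) U" for U K
    using that(2) by (simp, elim quotient_cases) (use that(1) in \<open>simp add: restr_coset restr_id\<close>)
  show "restr (quotient_presheaf F N) V W (restr (quotient_presheaf F N) U V K)
      = restr (quotient_presheaf F N) U W K"
    if "openin X U" "openin X V" "openin X W" "W \<subseteq> V" "V \<subseteq> U"
      "K \<in> \<Gamma> (quotient_presheaf F N) U" for U V W K
    using that(6) by (simp, elim quotient_cases) (use that(1-5) in \<open>simp add: restr_coset restr_comp\<close>)
qed

lemma coset_morphism:
  "presheaf_morphism X F (quotient_presheaf F N) (\<lambda>U s. N U #>\<^bsub>sections F U\<^esub> s)"
proof -
  interpret Q: presheaf_of_groups X "quotient_presheaf F N" by (rule quotient_presheaf_presheaf)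
  show ?thesis
    by unfold_locales (simp_all add: normal.r_coset_hom_Mod[OF normal] restr_coset)
qed

lemma coset_eq_one_iff:
  assumes "openin X U" "s \<in> \<Gamma> F U"
  shows "N U #>\<^bsub>sections F U\<^esub> s = \<one>\<^bsub>sections F U Mod N U\<^esub> \<longleftrightarrow> s \<in> N U"
  using assms group.coset_join1[OF group_sections _ _ subgroup_N]
    group.coset_join2[OF group_sections _ subgroup_N] by (auto simp: FactGroup_def)

lemma quotient_presheaf_comm:
  assumes "openin X U" "comm_group (sections F U)"
  shows "comm_group (sections (quotient_presheaf F N) U)"
  using assms comm_group.abelian_FactGroup[OF assms(2) subgroup_N] by simp

end

section \<open>Cech cohomology in degree one\<close>

locale sheaf_morphism = dom: sheaf_of_groups X F + cod: sheaf_of_groups X F'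
    + presheaf_morphism X F F' \<phi>
  for X :: "'a topology" and F :: "('a, 'g) presheaf" and F' :: "('a, 'h) presheaf"
    and \<phi> :: "'a set \<Rightarrow> 'g \<Rightarrow> 'h"

lemma open_cover_openin: "\<lbrakk>open_cover X \<U>; U \<in> \<U>\<rbrakk> \<Longrightarrow> openin X U"
  by (simp add: open_cover_def)

lemma open_cover_choice:
  assumes "open_cover X \<U>"
  obtains u where "\<And>x. x \<in> topspace X \<Longrightarrow> u x \<in> \<U>" "\<And>x. x \<in> topspace X \<Longrightarrow> x \<in> u x"
proof -
  have "\<exists>U. U \<in> \<U> \<and> x \<in> U" if "x \<in> topspace X" for x
    using that assms unfolding open_cover_def by blast
  then show thesis using that by metis
qed

lemma common_refinement:
  assumes "open_cover X \<U>" "open_cover X \<V>"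
  obtains \<W> \<rho> \<tau> where "open_cover X \<W>" "\<rho> \<in> \<W> \<rightarrow> \<U>" "\<tau> \<in> \<W> \<rightarrow> \<V>"
    "\<And>W. W \<in> \<W> \<Longrightarrow> W = \<rho> W \<inter> \<tau> W"
proof -
  define \<W> where "\<W> = {U \<inter> V | U V. U \<in> \<U> \<and> V \<in> \<V>}"
  have "\<exists>U V. U \<in> \<U> \<and> V \<in> \<V> \<and> W = U \<inter> V" if "W \<in> \<W>" for W
    using that by (auto simp: \<W>_def)
  then obtain \<rho> \<tau> where *: "\<And>W. W \<in> \<W> \<Longrightarrow> \<rho> W \<in> \<U> \<and> \<tau> W \<in> \<V> \<and> W = \<rho> W \<inter> \<tau> W"
    by metis
  have "\<Union>\<W> = \<Union>\<U> \<inter> \<Union>\<V>"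
    by (intro subset_antisym) (auto simp: \<W>_def)
  then have "open_cover X \<W>"
    using assms by (auto simp: open_cover_def \<W>_def)
  then show thesis
    using * by (intro that[of \<W> \<rho> \<tau>]) auto
qed

context sheaf_of_groups
begin

lemma section_eq_iff:
  assumes "openin X U" "s \<in> \<Gamma> F U" "t \<in> \<Gamma> F U"
  shows "s = t \<longleftrightarrow> (\<forall>x\<in>U. germ X F U s x = germ X F U t x)"
  using section_eqI[OF assms] by blast

lemma cocycle_iff:
  "(\<U>, g) \<in> cech_cocycles X F \<longleftrightarrow> open_cover X \<U> \<and>
     (\<forall>U\<in>\<U>. \<forall>V\<in>\<U>. g U V \<in> \<Gamma> F (U \<inter> V)) \<and>
     (\<forall>U\<in>\<U>. \<forall>V\<in>\<U>. \<forall>W\<in>\<U>. \<forall>x\<in>U \<inter> V \<inter> W.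
        germ X F (U \<inter> V) (g U V) x \<otimes>\<^bsub>stalk X F x\<^esub> germ X F (V \<inter> W) (g V W) x
        = germ X F (U \<inter> W) (g U W) x)"
proof -
  have "restr F (U \<inter> V) (U \<inter> V \<inter> W) (g U V)
          \<otimes>\<^bsub>sections F (U \<inter> V \<inter> W)\<^esub> restr F (V \<inter> W) (U \<inter> V \<inter> W) (g V W)
        = restr F (U \<inter> W) (U \<inter> V \<inter> W) (g U W) \<longleftrightarrow>
      (\<forall>x\<in>U \<inter> V \<inter> W. germ X F (U \<inter> V) (g U V) x \<otimes>\<^bsub>stalk X F x\<^esub> germ X F (V \<inter> W) (g V W) x
        = germ X F (U \<inter> W) (g U W) x)"
    if "open_cover X \<U>" "\<forall>U\<in>\<U>. \<forall>V\<in>\<U>. g U V \<in> \<Gamma> F (U \<inter> V)"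
      "U \<in> \<U>" "V \<in> \<U>" "W \<in> \<U>" for U V W
  proof -
    have o: "openin X (U \<inter> V \<inter> W)" "openin X (U \<inter> V)" "openin X (V \<inter> W)" "openin X (U \<inter> W)"
      and c: "g U V \<in> \<Gamma> F (U \<inter> V)" "g V W \<in> \<Gamma> F (V \<inter> W)"
        "g U W \<in> \<Gamma> F (U \<inter> W)"
      and sub: "U \<inter> V \<inter> W \<subseteq> U \<inter> V" "U \<inter> V \<inter> W \<subseteq> V \<inter> W" "U \<inter> V \<inter> W \<subseteq> U \<inter> W"
      using that open_cover_openin by blast+
    have r: "restr F (U \<inter> V) (U \<inter> V \<inter> W) (g U V) \<in> \<Gamma> F (U \<inter> V \<inter> W)"
      "restr F (V \<inter> W) (U \<inter> V \<inter> W) (g V W) \<in> \<Gamma> F (U \<inter> V \<inter> W)"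
      "restr F (U \<inter> W) (U \<inter> V \<inter> W) (g U W) \<in> \<Gamma> F (U \<inter> V \<inter> W)"
      using o c sub by (metis restr_closed)+
    show ?thesis
      by (subst section_eq_iff) (use o c sub r in \<open>auto simp: germ_mult germ_restr\<close>)
  qed
  then show ?thesis
    unfolding cech_cocycles_def by auto
qed

lemma cohomologous_iff:
  "((\<U>, g), (\<V>, h)) \<in> cech_cohomologous X F \<longleftrightarrow>
     (\<U>, g) \<in> cech_cocycles X F \<and> (\<V>, h) \<in> cech_cocycles X F \<and>
     (\<exists>\<W> \<rho> \<tau> a. open_cover X \<W> \<and> \<rho> \<in> \<W> \<rightarrow> \<U> \<and> \<tau> \<in> \<W> \<rightarrow> \<V> \<and>
        (\<forall>W\<in>\<W>. W \<subseteq> \<rho> W \<and> W \<subseteq> \<tau> W \<and> a W \<in> \<Gamma> F W) \<and>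
        (\<forall>W\<in>\<W>. \<forall>W'\<in>\<W>. \<forall>x\<in>W \<inter> W'.
           germ X F (\<tau> W \<inter> \<tau> W') (h (\<tau> W) (\<tau> W')) x
           = inv\<^bsub>stalk X F x\<^esub> (germ X F W (a W) x)
               \<otimes>\<^bsub>stalk X F x\<^esub> germ X F (\<rho> W \<inter> \<rho> W') (g (\<rho> W) (\<rho> W')) x
               \<otimes>\<^bsub>stalk X F x\<^esub> germ X F W' (a W') x))"
proof -
  have "restr F (\<tau> W \<inter> \<tau> W') (W \<inter> W') (h (\<tau> W) (\<tau> W'))
           = inv\<^bsub>sections F (W \<inter> W')\<^esub> (restr F W (W \<inter> W') (a W))
               \<otimes>\<^bsub>sections F (W \<inter> W')\<^esub> restr F (\<rho> W \<inter> \<rho> W') (W \<inter> W') (g (\<rho> W) (\<rho> W'))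
               \<otimes>\<^bsub>sections F (W \<inter> W')\<^esub> restr F W' (W \<inter> W') (a W') \<longleftrightarrow>
        (\<forall>x\<in>W \<inter> W'. germ X F (\<tau> W \<inter> \<tau> W') (h (\<tau> W) (\<tau> W')) x
           = inv\<^bsub>stalk X F x\<^esub> (germ X F W (a W) x)
               \<otimes>\<^bsub>stalk X F x\<^esub> germ X F (\<rho> W \<inter> \<rho> W') (g (\<rho> W) (\<rho> W')) x
               \<otimes>\<^bsub>stalk X F x\<^esub> germ X F W' (a W') x)"
    if g: "(\<U>, g) \<in> cech_cocycles X F" and h: "(\<V>, h) \<in> cech_cocycles X F"
      and W: "open_cover X \<W>" "\<rho> \<in> \<W> \<rightarrow> \<U>" "\<tau> \<in> \<W> \<rightarrow> \<V>"
      "\<forall>W\<in>\<W>. W \<subseteq> \<rho> W \<and> W \<subseteq> \<tau> W \<and> a W \<in> \<Gamma> F W" "W \<in> \<W>" "W' \<in> \<W>"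
    for \<W> \<rho> \<tau> a W W'
  proof -
    let ?N = "W \<inter> W'"
    have "\<rho> W \<in> \<U>" "\<rho> W' \<in> \<U>" "\<tau> W \<in> \<V>" "\<tau> W' \<in> \<V>" using W by auto
    then have o: "openin X W" "openin X W'" "openin X ?N" "openin X (\<tau> W \<inter> \<tau> W')" "openin X (\<rho> W \<inter> \<rho> W')"
      and c: "h (\<tau> W) (\<tau> W') \<in> \<Gamma> F (\<tau> W \<inter> \<tau> W')"
        "g (\<rho> W) (\<rho> W') \<in> \<Gamma> F (\<rho> W \<inter> \<rho> W')"
        "a W \<in> \<Gamma> F W" "a W' \<in> \<Gamma> F W'"
      and sub: "?N \<subseteq> W" "?N \<subseteq> W'" "?N \<subseteq> \<tau> W \<inter> \<tau> W'" "?N \<subseteq> \<rho> W \<inter> \<rho> W'"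
      using W g h unfolding cocycle_iff by (auto simp: open_cover_openin)
    have r: "restr F (\<tau> W \<inter> \<tau> W') ?N (h (\<tau> W) (\<tau> W')) \<in> \<Gamma> F ?N"
      "restr F (\<rho> W \<inter> \<rho> W') ?N (g (\<rho> W) (\<rho> W')) \<in> \<Gamma> F ?N"
      "restr F W ?N (a W) \<in> \<Gamma> F ?N" "restr F W' ?N (a W') \<in> \<Gamma> F ?N"
      using o c sub by (metis restr_closed)+
    have gr: "germ X F ?N (restr F (\<tau> W \<inter> \<tau> W') ?N (h (\<tau> W) (\<tau> W'))) x
        = germ X F (\<tau> W \<inter> \<tau> W') (h (\<tau> W) (\<tau> W')) x"
      "germ X F ?N (restr F (\<rho> W \<inter> \<rho> W') ?N (g (\<rho> W) (\<rho> W'))) x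
        = germ X F (\<rho> W \<inter> \<rho> W') (g (\<rho> W) (\<rho> W')) x"
      "germ X F ?N (restr F W ?N (a W)) x = germ X F W (a W) x"
      "germ X F ?N (restr F W' ?N (a W')) x = germ X F W' (a W') x" if "x \<in> ?N" for x
      using o c sub that by (metis germ_restr)+
    show ?thesis
      by (subst section_eq_iff) (use o r gr in \<open>auto simp: germ_mult germ_inv\<close>)
  qed
  note * = this
  show ?thesis
    unfolding cech_cohomologous_def mem_Collect_eq prod.case
    by (intro conj_cong refl ex_cong1 ball_cong) (rule *; assumption)
qed

lemma cocycle_closed:
  "\<lbrakk>(\<U>, g) \<in> cech_cocycles X F; U \<in> \<U>; V \<in> \<U>; x \<in> U; x \<in> V\<rbrakk>
     \<Longrightarrow> germ X F (U \<inter> V) (g U V) x \<in> carrier (stalk X F x)"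
  unfolding cocycle_iff by (auto intro!: germ_in_stalk simp: open_cover_openin)

lemma cocycle_mult:
  "\<lbrakk>(\<U>, g) \<in> cech_cocycles X F; U \<in> \<U>; V \<in> \<U>; W \<in> \<U>; x \<in> U; x \<in> V; x \<in> W\<rbrakk>
     \<Longrightarrow> germ X F (U \<inter> V) (g U V) x \<otimes>\<^bsub>stalk X F x\<^esub> germ X F (V \<inter> W) (g V W) x
        = germ X F (U \<inter> W) (g U W) x"
  unfolding cocycle_iff by auto

lemma cocycle_diff:
  assumes "(\<U>, g) \<in> cech_cocycles X F" "U \<in> \<U>" "V \<in> \<U>" "W \<in> \<U>" "x \<in> U" "x \<in> V" "x \<in> W"
  shows "inv\<^bsub>stalk X F x\<^esub> germ X F (U \<inter> V) (g U V) x \<otimes>\<^bsub>stalk X F x\<^esub> germ X F (U \<inter> W) (g U W) x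
    = germ X F (V \<inter> W) (g V W) x"
proof -
  have "openin X U" using assms open_cover_openin unfolding cocycle_iff by blast
  then interpret S: group "stalk X F x" using assms group_stalk_on by blast
  show ?thesis
    using cocycle_mult[OF assms] cocycle_closed assms S.inv_solve_left' by metis
qed

text \<open>Only transitivity needs an idea: over a common refinement the two relations meet in values of the
  middle cocycle on different pairs of members, and the cocycle identity compensates for this.\<close>

lemma cohomologous_equiv: "equiv (cech_cocycles X F) (cech_cohomologous X F)"
proof (rule equivI)
  show "cech_cohomologous X F \<subseteq> cech_cocycles X F \<times> cech_cocycles X F"
    by (auto simp: cech_cohomologous_def)
  show "refl_on (cech_cocycles X F) (cech_cohomologous X F)"
  proof (rule refl_onI, clarify)
    fix \<U> g assume g: "(\<U>, g) \<in> cech_cocycles X F"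
    then have cov: "open_cover X \<U>" by (simp add: cocycle_iff)
    show "((\<U>, g), (\<U>, g)) \<in> cech_cohomologous X F"
      unfolding cohomologous_iff
    proof (intro conjI g exI ballI)
      show "open_cover X \<U>" by fact
      show "id \<in> \<U> \<rightarrow> \<U>" "id \<in> \<U> \<rightarrow> \<U>" by auto
    next
      fix W assume "W \<in> \<U>"
      then show "W \<subseteq> id W" "W \<subseteq> id W" "\<one>\<^bsub>sections F W\<^esub> \<in> \<Gamma> F W"
        using open_cover_openin[OF cov] by auto
    next
      fix U V x assume UV: "U \<in> \<U>" "V \<in> \<U>" "x \<in> U \<inter> V"
      then have o: "openin X U" "openin X V" using cov open_cover_openin by auto
      then interpret S: group "stalk X F x" using UV group_stalk_on by blast
      show "germ X F (id U \<inter> id V) (g (id U) (id V)) x = inv\<^bsub>stalk X F x\<^esub> germ X F U \<one>\<^bsub>sections F U\<^esub> x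
          \<otimes>\<^bsub>stalk X F x\<^esub> germ X F (id U \<inter> id V) (g (id U) (id V)) x
          \<otimes>\<^bsub>stalk X F x\<^esub> germ X F V \<one>\<^bsub>sections F V\<^esub> x"
        using UV o cocycle_closed[OF g UV(1,2)] by (simp add: germ_one)
    qed
  qed
  show "sym (cech_cohomologous X F)"
  proof (rule symI, clarify)
    fix \<U> g \<V> h
    assume "((\<U>, g), (\<V>, h)) \<in> cech_cohomologous X F"
    then obtain \<W> \<rho> \<tau> a where g: "(\<U>, g) \<in> cech_cocycles X F" and h: "(\<V>, h) \<in> cech_cocycles X F"
      and W: "open_cover X \<W>" "\<rho> \<in> \<W> \<rightarrow> \<U>" "\<tau> \<in> \<W> \<rightarrow> \<V>"
      "\<And>W. W \<in> \<W> \<Longrightarrow> W \<subseteq> \<rho> W \<and> W \<subseteq> \<tau> W \<and> a W \<in> \<Gamma> F W"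
      and eq: "\<And>W W' x. \<lbrakk>W \<in> \<W>; W' \<in> \<W>; x \<in> W \<inter> W'\<rbrakk> \<Longrightarrow>
           germ X F (\<tau> W \<inter> \<tau> W') (h (\<tau> W) (\<tau> W')) x
           = inv\<^bsub>stalk X F x\<^esub> (germ X F W (a W) x)
               \<otimes>\<^bsub>stalk X F x\<^esub> germ X F (\<rho> W \<inter> \<rho> W') (g (\<rho> W) (\<rho> W')) x
               \<otimes>\<^bsub>stalk X F x\<^esub> germ X F W' (a W') x"
      unfolding cohomologous_iff by metis
    show "((\<V>, h), (\<U>, g)) \<in> cech_cohomologous X F"
      unfolding cohomologous_iff
    proof (intro conjI g h exI ballI)
      show "open_cover X \<W>" "\<tau> \<in> \<W> \<rightarrow> \<V>" "\<rho> \<in> \<W> \<rightarrow> \<U>" by fact+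
    next
      fix W assume "W \<in> \<W>"
      then show "W \<subseteq> \<rho> W" "W \<subseteq> \<tau> W" "inv\<^bsub>sections F W\<^esub> (a W) \<in> \<Gamma> F W"
        using W open_cover_openin[OF W(1)] by auto
    next
      fix W W' x assume x: "W \<in> \<W>" "W' \<in> \<W>" "x \<in> W \<inter> W'"
      then have o: "openin X W" "openin X W'" using W(1) open_cover_openin by auto
      then interpret S: group "stalk X F x" using x group_stalk_on by blast
      have "\<rho> W \<in> \<U>" "\<rho> W' \<in> \<U>" "x \<in> \<rho> W" "x \<in> \<rho> W'" using W x by blast+
      then have "germ X F (\<rho> W \<inter> \<rho> W') (g (\<rho> W) (\<rho> W')) x \<in> carrier (stalk X F x)"
        using cocycle_closed[OF g] by blast
      moreover have "germ X F W (a W) x \<in> carrier (stalk X F x)" "germ X F W' (a W') x \<in> carrier (stalk X F x)"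
        using x W o by auto
      ultimately show "germ X F (\<rho> W \<inter> \<rho> W') (g (\<rho> W) (\<rho> W')) x
          = inv\<^bsub>stalk X F x\<^esub> germ X F W (inv\<^bsub>sections F W\<^esub> a W) x
            \<otimes>\<^bsub>stalk X F x\<^esub> germ X F (\<tau> W \<inter> \<tau> W') (h (\<tau> W) (\<tau> W')) x
            \<otimes>\<^bsub>stalk X F x\<^esub> germ X F W' (inv\<^bsub>sections F W'\<^esub> a W') x"
        unfolding eq[OF x] using x W o by (simp add: germ_inv S.m_assoc S.cancel_simps)
    qed
  qed
  show "trans (cech_cohomologous X F)"
  proof (rule transI, clarify)
    fix \<U> g \<V> h \<T> k
    assume "((\<U>, g), (\<V>, h)) \<in> cech_cohomologous X F"
    then obtain \<W> \<rho> \<tau> a where g: "(\<U>, g) \<in> cech_cocycles X F" and h: "(\<V>, h) \<in> cech_cocycles X F"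
      and W: "open_cover X \<W>" "\<rho> \<in> \<W> \<rightarrow> \<U>" "\<tau> \<in> \<W> \<rightarrow> \<V>"
      "\<And>W. W \<in> \<W> \<Longrightarrow> W \<subseteq> \<rho> W \<and> W \<subseteq> \<tau> W \<and> a W \<in> \<Gamma> F W"
      and eq: "\<And>W W' x. \<lbrakk>W \<in> \<W>; W' \<in> \<W>; x \<in> W \<inter> W'\<rbrakk> \<Longrightarrow>
           germ X F (\<tau> W \<inter> \<tau> W') (h (\<tau> W) (\<tau> W')) x
           = inv\<^bsub>stalk X F x\<^esub> (germ X F W (a W) x)
               \<otimes>\<^bsub>stalk X F x\<^esub> germ X F (\<rho> W \<inter> \<rho> W') (g (\<rho> W) (\<rho> W')) x
               \<otimes>\<^bsub>stalk X F x\<^esub> germ X F W' (a W') x"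
      unfolding cohomologous_iff by metis
    assume "((\<V>, h), (\<T>, k)) \<in> cech_cohomologous X F"
    then obtain \<W>' \<rho>' \<tau>' a' where k: "(\<T>, k) \<in> cech_cocycles X F"
      and W': "open_cover X \<W>'" "\<rho>' \<in> \<W>' \<rightarrow> \<V>" "\<tau>' \<in> \<W>' \<rightarrow> \<T>"
      "\<And>W. W \<in> \<W>' \<Longrightarrow> W \<subseteq> \<rho>' W \<and> W \<subseteq> \<tau>' W \<and> a' W \<in> \<Gamma> F W"
      and eq': "\<And>W W' x. \<lbrakk>W \<in> \<W>'; W' \<in> \<W>'; x \<in> W \<inter> W'\<rbrakk> \<Longrightarrow>
           germ X F (\<tau>' W \<inter> \<tau>' W') (k (\<tau>' W) (\<tau>' W')) x
           = inv\<^bsub>stalk X F x\<^esub> (germ X F W (a' W) x)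
               \<otimes>\<^bsub>stalk X F x\<^esub> germ X F (\<rho>' W \<inter> \<rho>' W') (h (\<rho>' W) (\<rho>' W')) x
               \<otimes>\<^bsub>stalk X F x\<^esub> germ X F W' (a' W') x"
      unfolding cohomologous_iff by metis
    obtain \<N> p q where N: "open_cover X \<N>" "p \<in> \<N> \<rightarrow> \<W>" "q \<in> \<N> \<rightarrow> \<W>'"
      and Neq: "\<And>W. W \<in> \<N> \<Longrightarrow> W = p W \<inter> q W" using common_refinement[OF W(1) W'(1)] by metis
    \<comment> \<open>The two pullbacks of \<open>h\<close> use different members of \<open>\<V>\<close>; the value of \<open>h\<close> on
      this pair of members corrects for that.\<close>
    define b where "b W = restr F (p W) W (a (p W)) \<otimes>\<^bsub>sections F W\<^esub>
      restr F (\<tau> (p W) \<inter> \<rho>' (q W)) W (h (\<tau> (p W)) (\<rho>' (q W))) \<otimes>\<^bsub>sections F W\<^esub>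
      restr F (q W) W (a' (q W))" for W
    have mem: "p W \<in> \<W>" "q W \<in> \<W>'" "W \<subseteq> p W" "W \<subseteq> q W" "\<rho> (p W) \<in> \<U>" "\<tau> (p W) \<in> \<V>"
        "\<rho>' (q W) \<in> \<V>" "\<tau>' (q W) \<in> \<T>" "W \<subseteq> \<rho> (p W)" "W \<subseteq> \<tau> (p W)" "W \<subseteq> \<rho>' (q W)" "W \<subseteq> \<tau>' (q W)"
      if "W \<in> \<N>" for W
    proof -
      show 1: "p W \<in> \<W>" "q W \<in> \<W>'" using that N by auto
      show 2: "W \<subseteq> p W" "W \<subseteq> q W" using Neq[OF that] by blast+
      show "\<rho> (p W) \<in> \<U>" "\<tau> (p W) \<in> \<V>"
        "\<rho>' (q W) \<in> \<V>" "\<tau>' (q W) \<in> \<T>" "W \<subseteq> \<rho> (p W)" "W \<subseteq> \<tau> (p W)" "W \<subseteq> \<rho>' (q W)" "W \<subseteq> \<tau>' (q W)"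
        using 1 2 W(2,3) W'(2,3) W(4)[OF 1(1)] W'(4)[OF 1(2)] by auto
    qed
    have hcov: "open_cover X \<V>" using h by (simp add: cocycle_iff)
    have b: "b W \<in> \<Gamma> F W"
      "\<And>x. x \<in> W \<Longrightarrow> germ X F W (b W) x = germ X F (p W) (a (p W)) x \<otimes>\<^bsub>stalk X F x\<^esub>
        germ X F (\<tau> (p W) \<inter> \<rho>' (q W)) (h (\<tau> (p W)) (\<rho>' (q W))) x \<otimes>\<^bsub>stalk X F x\<^esub>
        germ X F (q W) (a' (q W)) x" if w: "W \<in> \<N>" for W
    proof -
      note m = mem[OF w]
      have o: "openin X W" "openin X (p W)" "openin X (q W)" "openin X (\<tau> (p W) \<inter> \<rho>' (q W))"
        using open_cover_openin[OF N(1) w] open_cover_openin[OF W(1) m(1)] open_cover_openin[OF W'(1) m(2)]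
          open_cover_openin[OF hcov m(6)] open_cover_openin[OF hcov m(7)] by auto
      have hc: "h (\<tau> (p W)) (\<rho>' (q W)) \<in> \<Gamma> F (\<tau> (p W) \<inter> \<rho>' (q W))"
        using m h unfolding cocycle_iff by blast
      have ac: "a (p W) \<in> \<Gamma> F (p W)" "a' (q W) \<in> \<Gamma> F (q W)"
        using m W W' by auto
      have sub: "W \<subseteq> \<tau> (p W) \<inter> \<rho>' (q W)" using m by blast
      have r: "restr F (\<tau> (p W) \<inter> \<rho>' (q W)) W (h (\<tau> (p W)) (\<rho>' (q W))) \<in> \<Gamma> F W"
        using restr_closed[OF o(4) o(1) sub hc] .
      have gr: "germ X F W (restr F (\<tau> (p W) \<inter> \<rho>' (q W)) W (h (\<tau> (p W)) (\<rho>' (q W)))) x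
        = germ X F (\<tau> (p W) \<inter> \<rho>' (q W)) (h (\<tau> (p W)) (\<rho>' (q W))) x" if "x \<in> W" for x
        using germ_restr[OF o(4) o(1) sub that hc] .
      show "b W \<in> \<Gamma> F W"
        unfolding b_def using o ac r m by simp
      show "germ X F W (b W) x = germ X F (p W) (a (p W)) x \<otimes>\<^bsub>stalk X F x\<^esub>
        germ X F (\<tau> (p W) \<inter> \<rho>' (q W)) (h (\<tau> (p W)) (\<rho>' (q W))) x \<otimes>\<^bsub>stalk X F x\<^esub>
        germ X F (q W) (a' (q W)) x" if "x \<in> W" for x
        unfolding b_def using o ac r m that by (simp add: germ_mult gr germ_restr)
    qed
    show "((\<U>, g), (\<T>, k)) \<in> cech_cohomologous X F"
      unfolding cohomologous_iff
    proof (intro conjI g k exI ballI)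
      show "open_cover X \<N>" by fact
      show "(\<lambda>W. \<rho> (p W)) \<in> \<N> \<rightarrow> \<U>" "(\<lambda>W. \<tau>' (q W)) \<in> \<N> \<rightarrow> \<T>" using mem by auto
    next
      fix W assume "W \<in> \<N>"
      then show "W \<subseteq> \<rho> (p W)" "W \<subseteq> \<tau>' (q W)" "b W \<in> \<Gamma> F W"
        using mem b by auto
    next
      fix W V x assume x: "W \<in> \<N>" "V \<in> \<N>" "x \<in> W \<inter> V"
      note m = mem[OF x(1)] mem[OF x(2)]
      have xW: "x \<in> W" "x \<in> V" using x by auto
      have "openin X W" using N(1) x open_cover_openin by blast
      then interpret S: group "stalk X F x" using xW group_stalk_on by blast
      have xx: "x \<in> p W \<inter> p V" "x \<in> q W \<inter> q V" using xW m by blast+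
      let ?a = "germ X F (p W) (a (p W)) x" and ?a' = "germ X F (p V) (a (p V)) x"
        and ?c = "germ X F (q W) (a' (q W)) x" and ?c' = "germ X F (q V) (a' (q V)) x"
        and ?g = "germ X F (\<rho> (p W) \<inter> \<rho> (p V)) (g (\<rho> (p W)) (\<rho> (p V))) x"
        and ?k = "germ X F (\<tau>' (q W) \<inter> \<tau>' (q V)) (k (\<tau>' (q W)) (\<tau>' (q V))) x"
      let ?h = "\<lambda>U V. germ X F (U \<inter> V) (h U V) x"
      have ac: "?a \<in> carrier (stalk X F x)" "?a' \<in> carrier (stalk X F x)"
        "?c \<in> carrier (stalk X F x)" "?c' \<in> carrier (stalk X F x)"
        using xx open_cover_openin[OF W(1)] open_cover_openin[OF W'(1)] W(4) W'(4) m(1,2,13,14)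
        by (auto intro!: germ_in_stalk)
      have xh: "x \<in> \<rho> (p W)" "x \<in> \<rho> (p V)" "x \<in> \<tau> (p W)" "x \<in> \<tau> (p V)" "x \<in> \<rho>' (q W)" "x \<in> \<rho>' (q V)"
        using m xW by auto
      have gc: "?g \<in> carrier (stalk X F x)"
        using xh by (intro cocycle_closed[OF g] m)
      have hc: "?h (\<tau> (p W)) (\<rho>' (q W)) \<in> carrier (stalk X F x)"
        "?h (\<tau> (p V)) (\<rho>' (q V)) \<in> carrier (stalk X F x)"
        "?h (\<tau> (p W)) (\<tau> (p V)) \<in> carrier (stalk X F x)"
        using xh m by (simp_all add: cocycle_closed[OF h])
      have "?h (\<rho>' (q W)) (\<rho>' (q V)) = inv\<^bsub>stalk X F x\<^esub> ?h (\<tau> (p W)) (\<rho>' (q W))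
          \<otimes>\<^bsub>stalk X F x\<^esub> ?h (\<tau> (p W)) (\<rho>' (q V))"
        using xh by (intro cocycle_diff [OF h, symmetric] m)
      also have "?h (\<tau> (p W)) (\<rho>' (q V)) = ?h (\<tau> (p W)) (\<tau> (p V)) \<otimes>\<^bsub>stalk X F x\<^esub> ?h (\<tau> (p V)) (\<rho>' (q V))"
        using xh by (intro cocycle_mult [OF h, symmetric] m)
      finally have hh: "?h (\<rho>' (q W)) (\<rho>' (q V)) = inv\<^bsub>stalk X F x\<^esub> ?h (\<tau> (p W)) (\<rho>' (q W))
          \<otimes>\<^bsub>stalk X F x\<^esub> (?h (\<tau> (p W)) (\<tau> (p V)) \<otimes>\<^bsub>stalk X F x\<^esub> ?h (\<tau> (p V)) (\<rho>' (q V)))" .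
      show "?k = inv\<^bsub>stalk X F x\<^esub> germ X F W (b W) x \<otimes>\<^bsub>stalk X F x\<^esub> ?g \<otimes>\<^bsub>stalk X F x\<^esub> germ X F V (b V) x"
        unfolding b(2)[OF x(1) xW(1)] b(2)[OF x(2) xW(2)] eq'[OF m(2) m(14) xx(2)] hh eq[OF m(1) m(13) xx(1)]
        using ac gc hc by (simp add: S.m_assoc S.inv_mult_group)
    qed
  qed
qed

lemma cocycle_class_in_H1:
  "z \<in> cech_cocycles X F \<Longrightarrow> cech_cohomologous X F `` {z} \<in> H1 X F"
  by (simp add: H1_def quotientI)

lemma H1_cases:
  assumes "c \<in> H1 X F"
  obtains \<U> g where "(\<U>, g) \<in> cech_cocycles X F" "c = cech_cohomologous X F `` {(\<U>, g)}"
  using assms unfolding H1_def by (metis quotientE surj_pair)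

end

context sheaf_morphism
begin

lemma cocycle_map:
  assumes g: "(\<U>, g) \<in> cech_cocycles X F"
  shows "(\<U>, \<lambda>U V. \<phi> (U \<inter> V) (g U V)) \<in> cech_cocycles X F'"
  unfolding cod.cocycle_iff
proof (intro conjI ballI)
  show cov: "open_cover X \<U>" using g by (simp add: dom.cocycle_iff)
  show "\<phi> (U \<inter> V) (g U V) \<in> \<Gamma> F' (U \<inter> V)" if "U \<in> \<U>" "V \<in> \<U>" for U V
    using that g open_cover_openin[OF cov] by (intro map_closed openin_Int) (auto simp: dom.cocycle_iff)
  fix U V W x assume x: "U \<in> \<U>" "V \<in> \<U>" "W \<in> \<U>" "x \<in> U \<inter> V \<inter> W"
  have eq: "germ X F' (U \<inter> V) (\<phi> (U \<inter> V) (g U V)) x = stalk_map X F' \<phi> x (germ X F (U \<inter> V) (g U V) x)"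
    if "U \<in> \<U>" "V \<in> \<U>" "x \<in> U" "x \<in> V" for U V
    using that g cov by (subst stalk_map_germ) (auto simp: dom.cocycle_iff open_cover_openin)
  show "germ X F' (U \<inter> V) (\<phi> (U \<inter> V) (g U V)) x \<otimes>\<^bsub>stalk X F' x\<^esub> germ X F' (V \<inter> W) (\<phi> (V \<inter> W) (g V W)) x
      = germ X F' (U \<inter> W) (\<phi> (U \<inter> W) (g U W)) x"
  proof -
    have "x \<in> topspace X" using x cov openin_subset by (auto simp: open_cover_def)
    then interpret h: group_hom "stalk X F x" "stalk X F' x" "stalk_map X F' \<phi> x"
      by (rule stalk_map_group_hom)
    show ?thesis
      using x dom.cocycle_mult[OF g, of U V W x] dom.cocycle_closed[OF g]
      by (simp add: eq h.hom_mult [symmetric])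
  qed
qed

lemma cohomologous_map:
  assumes "((\<U>, g), (\<V>, h)) \<in> cech_cohomologous X F"
  shows "((\<U>, \<lambda>U V. \<phi> (U \<inter> V) (g U V)), (\<V>, \<lambda>U V. \<phi> (U \<inter> V) (h U V))) \<in> cech_cohomologous X F'"
proof -
  obtain \<W> \<rho> \<tau> a where g: "(\<U>, g) \<in> cech_cocycles X F" and h: "(\<V>, h) \<in> cech_cocycles X F"
    and W: "open_cover X \<W>" "\<rho> \<in> \<W> \<rightarrow> \<U>" "\<tau> \<in> \<W> \<rightarrow> \<V>"
    "\<And>W. W \<in> \<W> \<Longrightarrow> W \<subseteq> \<rho> W \<and> W \<subseteq> \<tau> W \<and> a W \<in> \<Gamma> F W"
    and eq: "\<And>W W' x. \<lbrakk>W \<in> \<W>; W' \<in> \<W>; x \<in> W \<inter> W'\<rbrakk> \<Longrightarrow>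
         germ X F (\<tau> W \<inter> \<tau> W') (h (\<tau> W) (\<tau> W')) x
         = inv\<^bsub>stalk X F x\<^esub> (germ X F W (a W) x)
             \<otimes>\<^bsub>stalk X F x\<^esub> germ X F (\<rho> W \<inter> \<rho> W') (g (\<rho> W) (\<rho> W')) x
             \<otimes>\<^bsub>stalk X F x\<^esub> germ X F W' (a W') x"
    using assms unfolding dom.cohomologous_iff by metis
  have germ_map: "germ X F' (U \<inter> V) (\<phi> (U \<inter> V) (g U V)) x = stalk_map X F' \<phi> x (germ X F (U \<inter> V) (g U V) x)"
    if "(\<U>, g) \<in> cech_cocycles X F" "U \<in> \<U>" "V \<in> \<U>" "x \<in> U" "x \<in> V" for \<U> g U V x
    using that by (subst stalk_map_germ) (auto simp: dom.cocycle_iff open_cover_openin)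
  show ?thesis
    unfolding cod.cohomologous_iff
  proof (intro conjI cocycle_map g h exI ballI)
    show "open_cover X \<W>" "\<rho> \<in> \<W> \<rightarrow> \<U>" "\<tau> \<in> \<W> \<rightarrow> \<V>" by fact+
  next
    fix W assume "W \<in> \<W>"
    then show "W \<subseteq> \<rho> W" "W \<subseteq> \<tau> W" "\<phi> W (a W) \<in> \<Gamma> F' W"
      using W open_cover_openin[OF W(1)] by auto
  next
    fix W W' x assume x: "W \<in> \<W>" "W' \<in> \<W>" "x \<in> W \<inter> W'"
    then have o: "openin X W" "openin X W'" using W(1) open_cover_openin by auto
    then have top: "x \<in> topspace X" using x openin_subset by blast
    interpret h: group_hom "stalk X F x" "stalk X F' x" "stalk_map X F' \<phi> x"
      by (rule stalk_map_group_hom[OF top])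
    have mem: "\<rho> W \<in> \<U>" "\<rho> W' \<in> \<U>" "x \<in> \<rho> W" "x \<in> \<rho> W'"
      "\<tau> W \<in> \<V>" "\<tau> W' \<in> \<V>" "x \<in> \<tau> W" "x \<in> \<tau> W'" using W x by blast+
    have c: "germ X F (\<rho> W \<inter> \<rho> W') (g (\<rho> W) (\<rho> W')) x \<in> carrier (stalk X F x)"
      using dom.cocycle_closed[OF g] mem by blast
    have a: "germ X F W (a W) x \<in> carrier (stalk X F x)" "germ X F W' (a W') x \<in> carrier (stalk X F x)"
      "germ X F' W (\<phi> W (a W)) x = stalk_map X F' \<phi> x (germ X F W (a W) x)"
      "germ X F' W' (\<phi> W' (a W')) x = stalk_map X F' \<phi> x (germ X F W' (a W') x)"
      using x W o by (auto simp: stalk_map_germ)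
    show "germ X F' (\<tau> W \<inter> \<tau> W') (\<phi> (\<tau> W \<inter> \<tau> W') (h (\<tau> W) (\<tau> W'))) x
         = inv\<^bsub>stalk X F' x\<^esub> (germ X F' W (\<phi> W (a W)) x)
             \<otimes>\<^bsub>stalk X F' x\<^esub> germ X F' (\<rho> W \<inter> \<rho> W') (\<phi> (\<rho> W \<inter> \<rho> W') (g (\<rho> W) (\<rho> W'))) x
             \<otimes>\<^bsub>stalk X F' x\<^esub> germ X F' W' (\<phi> W' (a W')) x"
      unfolding germ_map[OF g mem(1-4)] germ_map[OF h mem(5-8)] a(3,4) eq[OF x] using c a by simp
  qed
qed

lemma H1_map_class:
  assumes g: "(\<U>, g) \<in> cech_cocycles X F"
  shows "H1_map X F' \<phi> (cech_cohomologous X F `` {(\<U>, g)})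
    = cech_cohomologous X F' `` {(\<U>, \<lambda>U V. \<phi> (U \<inter> V) (g U V))}"
  unfolding H1_map_def
proof (rule UN_const_pair)
  show "(\<U>, g) \<in> cech_cohomologous X F `` {(\<U>, g)}"
    using g equiv_class_self[OF dom.cohomologous_equiv] by blast
  fix \<V> h assume "(\<V>, h) \<in> cech_cohomologous X F `` {(\<U>, g)}"
  then have "((\<U>, \<lambda>U V. \<phi> (U \<inter> V) (g U V)), (\<V>, \<lambda>U V. \<phi> (U \<inter> V) (h U V))) \<in> cech_cohomologous X F'"
    by (intro cohomologous_map) auto
  then show "cech_cohomologous X F' `` {(\<V>, \<lambda>U V. \<phi> (U \<inter> V) (h U V))}
      = cech_cohomologous X F' `` {(\<U>, \<lambda>U V. \<phi> (U \<inter> V) (g U V))}"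
    by (rule equiv_class_eq[OF cod.cohomologous_equiv, symmetric])
qed

end

section \<open>Short exact sequences and the connecting map in degree one\<close>

locale short_exact =
  A: sheaf_of_groups X A + B: sheaf_of_groups X B + C: sheaf_of_groups X C
    + i: sheaf_morphism X A B i + p: sheaf_morphism X B C p
  for X :: "'a topology" and A :: "('a, 'f) presheaf" and B :: "('a, 'g) presheaf"
    and C :: "('a, 'h) presheaf" and i :: "'a set \<Rightarrow> 'f \<Rightarrow> 'g" and p :: "'a set \<Rightarrow> 'g \<Rightarrow> 'h" +
  assumes injective: "\<lbrakk>openin X U; a \<in> \<Gamma> A U; i U a = \<one>\<^bsub>sections B U\<^esub>\<rbrakk>
      \<Longrightarrow> a = \<one>\<^bsub>sections A U\<^esub>"
    and p_i: "\<lbrakk>openin X U; a \<in> \<Gamma> A U\<rbrakk> \<Longrightarrow> p U (i U a) = \<one>\<^bsub>sections C U\<^esub>"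
    and exact: "\<lbrakk>openin X U; b \<in> \<Gamma> B U; p U b = \<one>\<^bsub>sections C U\<^esub>\<rbrakk>
      \<Longrightarrow> \<exists>a\<in>\<Gamma> A U. i U a = b"
    and locally_surjective: "\<lbrakk>openin X U; c \<in> \<Gamma> C U; x \<in> U\<rbrakk>
      \<Longrightarrow> \<exists>V b. openin X V \<and> x \<in> V \<and> V \<subseteq> U \<and> b \<in> \<Gamma> B V \<and> p V b = restr C U V c"
begin

abbreviation SA where "SA \<equiv> stalk X A"
abbreviation SB where "SB \<equiv> stalk X B"
abbreviation SC where "SC \<equiv> stalk X C"
abbreviation \<iota> where "\<iota> x \<equiv> stalk_map X B i x"
abbreviation \<pi> where "\<pi> x \<equiv> stalk_map X C p x"

lemma stalk_p_i:
  assumes "\<alpha> \<in> carrier (SA x)"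
  shows "\<pi> x (\<iota> x \<alpha>) = \<one>\<^bsub>SC x\<^esub>"
  using assms by (rule A.stalk_cases) (simp add: i.stalk_map_germ p.stalk_map_germ p_i C.germ_one)

lemma stalk_i_trivial:
  assumes "\<alpha> \<in> carrier (SA x)" "\<iota> x \<alpha> = \<one>\<^bsub>SB x\<^esub>"
  shows "\<alpha> = \<one>\<^bsub>SA x\<^esub>"
  using assms(1)
proof (rule A.stalk_cases)
  fix U a assume U: "openin X U" "x \<in> U" "a \<in> \<Gamma> A U" "\<alpha> = germ X A U a x"
  then have "germ X B U (i U a) x = germ X B U \<one>\<^bsub>sections B U\<^esub> x"
    using assms(2) by (simp add: i.stalk_map_germ B.germ_one)
  then obtain W where W: "openin X W" "x \<in> W" "W \<subseteq> U" "restr B U W (i U a) = restr B U W \<one>\<^bsub>sections B U\<^esub>"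
    using U by (subst (asm) B.germ_eq_iff) auto
  then have "i W (restr A U W a) = \<one>\<^bsub>sections B W\<^esub>"
    using U by (simp add: i.natural B.restr_one)
  then have "restr A U W a = \<one>\<^bsub>sections A W\<^esub>"
    using U W by (intro injective) auto
  then show ?thesis
    using U W A.germ_restr[of U W x a] by (simp add: A.germ_one)
qed

lemma stalk_i_inj:
  assumes "\<alpha> \<in> carrier (SA x)" "\<alpha>' \<in> carrier (SA x)" "\<iota> x \<alpha> = \<iota> x \<alpha>'"
  shows "\<alpha> = \<alpha>'"
proof -
  have top: "x \<in> topspace X" using A.stalk_in_topspace assms by blast
  interpret h: group_hom "SA x" "SB x" "\<iota> x" by (rule i.stalk_map_group_hom[OF top])
  have "\<iota> x (\<alpha> \<otimes>\<^bsub>SA x\<^esub> inv\<^bsub>SA x\<^esub> \<alpha>') = \<one>\<^bsub>SB x\<^esub>"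
    using assms by simp
  then have "\<alpha> \<otimes>\<^bsub>SA x\<^esub> inv\<^bsub>SA x\<^esub> \<alpha>' = \<one>\<^bsub>SA x\<^esub>"
    using assms by (intro stalk_i_trivial) auto
  then show ?thesis
    using assms h.G.inv_equality[of \<alpha> "inv\<^bsub>SA x\<^esub> \<alpha>'"] by simp
qed

lemma stalk_p_surj:
  assumes "\<gamma> \<in> carrier (SC x)"
  obtains \<beta> where "\<beta> \<in> carrier (SB x)" "\<pi> x \<beta> = \<gamma>"
  using assms
proof (rule C.stalk_cases)
  fix U c assume U: "openin X U" "x \<in> U" "c \<in> \<Gamma> C U" "\<gamma> = germ X C U c x"
  then obtain V b where V: "openin X V" "x \<in> V" "V \<subseteq> U" "b \<in> \<Gamma> B V" "p V b = restr C U V c"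
    using locally_surjective by meson
  then have "\<pi> x (germ X B V b x) = \<gamma>"
    using U by (simp add: p.stalk_map_germ C.germ_restr)
  then show thesis using V that by (metis B.germ_in_stalk)
qed

lemma stalk_exact:
  assumes "\<beta> \<in> carrier (SB x)" "\<pi> x \<beta> = \<one>\<^bsub>SC x\<^esub>"
  obtains \<alpha> where "\<alpha> \<in> carrier (SA x)" "\<iota> x \<alpha> = \<beta>"
  using assms(1)
proof (rule B.stalk_cases)
  fix U b assume U: "openin X U" "x \<in> U" "b \<in> \<Gamma> B U" "\<beta> = germ X B U b x"
  then have "germ X C U (p U b) x = germ X C U \<one>\<^bsub>sections C U\<^esub> x"
    using assms(2) by (simp add: p.stalk_map_germ C.germ_one)
  then obtain W where W: "openin X W" "x \<in> W" "W \<subseteq> U" "restr C U W (p U b) = restr C U W \<one>\<^bsub>sections C U\<^esub>"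
    using U by (subst (asm) C.germ_eq_iff) auto
  then have "p W (restr B U W b) = \<one>\<^bsub>sections C W\<^esub>"
    using U by (simp add: p.natural C.restr_one)
  then obtain a where a: "a \<in> \<Gamma> A W" "i W a = restr B U W b"
    using exact U W by (metis B.restr_closed)
  then have "\<iota> x (germ X A W a x) = \<beta>"
    using U W by (simp add: i.stalk_map_germ B.germ_restr)
  then show thesis using a W that by (metis A.germ_in_stalk)
qed

text \<open>Equality of the images in \<open>C\<close> is tested on stalks, where it can be computed from the factors of
  \<open>b\<close> and \<open>b'\<close>; exactness is used once, for the section \<open>b\<^sup>-\<^sup>1 b'\<close>.\<close>

lemma section_difference:
  assumes W: "openin X W" and b: "b \<in> \<Gamma> B W" "b' \<in> \<Gamma> B W"
    and eq: "\<And>x. x \<in> W \<Longrightarrow> \<pi> x (germ X B W b x) = \<pi> x (germ X B W b' x)"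
  obtains a where "a \<in> \<Gamma> A W"
    "\<And>x. x \<in> W \<Longrightarrow> \<iota> x (germ X A W a x) = inv\<^bsub>SB x\<^esub> germ X B W b x \<otimes>\<^bsub>SB x\<^esub> germ X B W b' x"
proof -
  let ?c = "inv\<^bsub>sections B W\<^esub> b \<otimes>\<^bsub>sections B W\<^esub> b'"
  have c: "?c \<in> \<Gamma> B W" using W b by simp
  have "p W b = p W b'"
    using W b eq by (intro C.section_eqI[of W]) (auto simp: p.stalk_map_germ)
  then have "p W ?c = \<one>\<^bsub>sections C W\<^esub>"
    using W b group.l_inv[OF C.group_sections, of W "p W b'"] by (simp add: p.map_mult p.map_inv)
  then obtain a where a: "a \<in> \<Gamma> A W" "i W a = ?c"
    using exact[OF W c] by blast
  have "\<iota> x (germ X A W a x) = inv\<^bsub>SB x\<^esub> germ X B W b x \<otimes>\<^bsub>SB x\<^esub> germ X B W b' x" if "x \<in> W" for x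
    using a that W b by (simp add: i.stalk_map_germ B.germ_mult B.germ_inv)
  then show thesis using that a by blast
qed

text \<open>The choices in the construction of the connecting map, with the identity between sections on
  \<open>U \<inter> V\<close> expressed in stalks.\<close>

definition delta1_rep where
  "delta1_rep s \<U> z b \<longleftrightarrow> open_cover X \<U> \<and>
     (\<forall>U\<in>\<U>. b U \<in> \<Gamma> B U \<and> p U (b U) = restr C (topspace X) U s) \<and>
     (\<forall>U\<in>\<U>. \<forall>V\<in>\<U>. z U V \<in> \<Gamma> A (U \<inter> V) \<and>
        (\<forall>x\<in>U \<inter> V. \<iota> x (germ X A (U \<inter> V) (z U V) x)
           = inv\<^bsub>SB x\<^esub> germ X B U (b U) x \<otimes>\<^bsub>SB x\<^esub> germ X B V (b V) x))"

lemma delta1_eq: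
  "delta1 X A B C i p s = (\<Union>(\<U>, z)\<in>{(\<U>, z). \<exists>b. delta1_rep s \<U> z b}. cech_cohomologous X A `` {(\<U>, z)})"
proof -
  have *: "i (U \<inter> V) (z U V) = inv\<^bsub>sections B (U \<inter> V)\<^esub> (restr B U (U \<inter> V) (b U))
                                \<otimes>\<^bsub>sections B (U \<inter> V)\<^esub> restr B V (U \<inter> V) (b V) \<longleftrightarrow>
     (\<forall>x\<in>U \<inter> V. \<iota> x (germ X A (U \<inter> V) (z U V) x)
           = inv\<^bsub>SB x\<^esub> germ X B U (b U) x \<otimes>\<^bsub>SB x\<^esub> germ X B V (b V) x)"
    if "open_cover X \<U>" "\<forall>U\<in>\<U>. b U \<in> \<Gamma> B U \<and> p U (b U) = restr C (topspace X) U s"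
      "U \<in> \<U>" "V \<in> \<U>" "z U V \<in> \<Gamma> A (U \<inter> V)" for \<U> z b U V
  proof -
    have o: "openin X U" "openin X V" "openin X (U \<inter> V)" using that open_cover_openin[OF that(1)] openin_Int by blast+
    then show ?thesis
      using that by (subst B.section_eq_iff[of "U \<inter> V"])
        (auto simp: i.stalk_map_germ B.germ_mult B.germ_inv B.germ_restr)
  qed
  have "(open_cover X \<U> \<and> (\<exists>b.
       (\<forall>U\<in>\<U>. b U \<in> \<Gamma> B U \<and> p U (b U) = restr C (topspace X) U s) \<and>
       (\<forall>U\<in>\<U>. \<forall>V\<in>\<U>. z U V \<in> \<Gamma> A (U \<inter> V) \<and>
          i (U \<inter> V) (z U V) = inv\<^bsub>sections B (U \<inter> V)\<^esub> (restr B U (U \<inter> V) (b U))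
                                \<otimes>\<^bsub>sections B (U \<inter> V)\<^esub> restr B V (U \<inter> V) (b V))))
    \<longleftrightarrow> (\<exists>b. delta1_rep s \<U> z b)" for \<U> z
    unfolding delta1_rep_def ex_simps [symmetric]
    by (intro ex_cong1 conj_cong refl ball_cong) (rule *; assumption)
  then show ?thesis
    unfolding delta1_def by presburger
qed

lemma delta1_rep_cocycle:
  assumes "delta1_rep s \<U> z b"
  shows "(\<U>, z) \<in> cech_cocycles X A"
  unfolding A.cocycle_iff
proof (intro conjI ballI)
  show cov: "open_cover X \<U>" using assms by (simp add: delta1_rep_def)
  show "z U V \<in> \<Gamma> A (U \<inter> V)" if "U \<in> \<U>" "V \<in> \<U>" for U V
    using that assms by (simp add: delta1_rep_def)
  fix U V W x assume x: "U \<in> \<U>" "V \<in> \<U>" "W \<in> \<U>" "x \<in> U \<inter> V \<inter> W"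
  then have o: "openin X U" "openin X V" "openin X W" using open_cover_openin[OF cov] by auto
  then have top: "x \<in> topspace X" using x openin_subset by blast
  interpret h: group_hom "SA x" "SB x" "\<iota> x" by (rule i.stalk_map_group_hom[OF top])
  have z: "germ X A (U \<inter> V) (z U V) x \<in> carrier (SA x)"
    "germ X A (V \<inter> W) (z V W) x \<in> carrier (SA x)"
    "germ X A (U \<inter> W) (z U W) x \<in> carrier (SA x)"
    using x o assms by (auto simp: delta1_rep_def intro!: A.germ_in_stalk)
  have b: "germ X B U (b U) x \<in> carrier (SB x)" "germ X B V (b V) x \<in> carrier (SB x)"
    "germ X B W (b W) x \<in> carrier (SB x)"
    using x o assms by (auto simp: delta1_rep_def intro!: B.germ_in_stalk)
  have iz: "\<iota> x (germ X A (U \<inter> V) (z U V) x)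
           = inv\<^bsub>SB x\<^esub> germ X B U (b U) x \<otimes>\<^bsub>SB x\<^esub> germ X B V (b V) x"
    "\<iota> x (germ X A (V \<inter> W) (z V W) x)
           = inv\<^bsub>SB x\<^esub> germ X B V (b V) x \<otimes>\<^bsub>SB x\<^esub> germ X B W (b W) x"
    "\<iota> x (germ X A (U \<inter> W) (z U W) x)
           = inv\<^bsub>SB x\<^esub> germ X B U (b U) x \<otimes>\<^bsub>SB x\<^esub> germ X B W (b W) x"
    using x assms by (simp_all add: delta1_rep_def)
  have "\<iota> x (germ X A (U \<inter> V) (z U V) x \<otimes>\<^bsub>SA x\<^esub> germ X A (V \<inter> W) (z V W) x)
      = \<iota> x (germ X A (U \<inter> W) (z U W) x)"
    unfolding h.hom_mult[OF z(1,2)] iz using b by (simp add: h.H.m_assoc h.H.cancel_simps)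
  then show "germ X A (U \<inter> V) (z U V) x \<otimes>\<^bsub>SA x\<^esub> germ X A (V \<inter> W) (z V W) x = germ X A (U \<inter> W) (z U W) x"
    by (rule stalk_i_inj[rotated 2]) (use z in simp_all)
qed

text \<open>On an intersection \<open>W = \<rho> W \<inter> \<tau> W\<close> the two lifts of \<open>s\<close> differ by a section of \<open>A\<close>, and these
  differences are the cochain that relates \<open>z\<close> to \<open>z'\<close>.\<close>

lemma delta1_rep_cohomologous:
  assumes r: "delta1_rep s \<U> z b" and r': "delta1_rep s \<V> z' b'"
    and s: "s \<in> \<Gamma> C (topspace X)"
  shows "((\<U>, z), (\<V>, z')) \<in> cech_cohomologous X A"
proof -
  have U: "open_cover X \<U>" and V: "open_cover X \<V>" using r r' by (simp_all add: delta1_rep_def)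
  obtain \<W> \<rho> \<tau> where W: "open_cover X \<W>" "\<rho> \<in> \<W> \<rightarrow> \<U>" "\<tau> \<in> \<W> \<rightarrow> \<V>"
    and Weq: "\<And>W. W \<in> \<W> \<Longrightarrow> W = \<rho> W \<inter> \<tau> W" using common_refinement[OF U V] by metis
  have mem: "openin X W" "\<rho> W \<in> \<U>" "\<tau> W \<in> \<V>" "openin X (\<rho> W)" "openin X (\<tau> W)" "W \<subseteq> \<rho> W" "W \<subseteq> \<tau> W"
    "b (\<rho> W) \<in> \<Gamma> B (\<rho> W)" "b' (\<tau> W) \<in> \<Gamma> B (\<tau> W)"
    if "W \<in> \<W>" for W
  proof -
    show 1: "\<rho> W \<in> \<U>" "\<tau> W \<in> \<V>" "W \<subseteq> \<rho> W" "W \<subseteq> \<tau> W" "openin X W"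
      using that W Weq[OF that] open_cover_openin[OF W(1)] by auto
    show "openin X (\<rho> W)" "openin X (\<tau> W)"
      using 1 open_cover_openin[OF U] open_cover_openin[OF V] by auto
    show "b (\<rho> W) \<in> \<Gamma> B (\<rho> W)" "b' (\<tau> W) \<in> \<Gamma> B (\<tau> W)"
      using 1 r r' by (auto simp: delta1_rep_def)
  qed
  have "\<exists>a. a \<in> \<Gamma> A W \<and> (\<forall>x\<in>W. \<iota> x (germ X A W a x)
      = inv\<^bsub>SB x\<^esub> germ X B (\<rho> W) (b (\<rho> W)) x \<otimes>\<^bsub>SB x\<^esub> germ X B (\<tau> W) (b' (\<tau> W)) x)"
    if w: "W \<in> \<W>" for W
  proof -
    note m = mem[OF w]
    have sub: "\<rho> W \<subseteq> topspace X" "\<tau> W \<subseteq> topspace X" "W \<subseteq> topspace X"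
      using m(1,4,5) openin_subset by blast+
    have "p (\<rho> W) (b (\<rho> W)) = restr C (topspace X) (\<rho> W) s" "p (\<tau> W) (b' (\<tau> W)) = restr C (topspace X) (\<tau> W) s"
      using r r' m by (auto simp: delta1_rep_def)
    then have "\<pi> x (germ X B (\<rho> W) (b (\<rho> W)) x) = \<pi> x (germ X B (\<tau> W) (b' (\<tau> W)) x)" if "x \<in> W" for x
      using m that s sub subsetD[OF m(6) that] subsetD[OF m(7) that]
      by (simp add: p.stalk_map_germ C.germ_restr)
    then obtain a where "a \<in> \<Gamma> A W"
      "\<And>x. x \<in> W \<Longrightarrow> \<iota> x (germ X A W a x) = inv\<^bsub>SB x\<^esub> germ X B W (restr B (\<rho> W) W (b (\<rho> W))) x
         \<otimes>\<^bsub>SB x\<^esub> germ X B W (restr B (\<tau> W) W (b' (\<tau> W))) x"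
      using section_difference[of W "restr B (\<rho> W) W (b (\<rho> W))" "restr B (\<tau> W) W (b' (\<tau> W))"] m
      by (auto simp: B.germ_restr)
    then show ?thesis
      using m by (intro exI[of _ a]) (auto simp: B.germ_restr)
  qed
  then obtain a where a: "\<And>W. W \<in> \<W> \<Longrightarrow> a W \<in> \<Gamma> A W"
    and ia: "\<And>W x. W \<in> \<W> \<Longrightarrow> x \<in> W \<Longrightarrow> \<iota> x (germ X A W (a W) x)
      = inv\<^bsub>SB x\<^esub> germ X B (\<rho> W) (b (\<rho> W)) x \<otimes>\<^bsub>SB x\<^esub> germ X B (\<tau> W) (b' (\<tau> W)) x"
    by metis
  show ?thesis
    unfolding A.cohomologous_iff
  proof (intro conjI delta1_rep_cocycle[OF r] delta1_rep_cocycle[OF r'] exI ballI)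
    show "open_cover X \<W>" "\<rho> \<in> \<W> \<rightarrow> \<U>" "\<tau> \<in> \<W> \<rightarrow> \<V>" by fact+
    show "W \<subseteq> \<rho> W" "W \<subseteq> \<tau> W" "a W \<in> \<Gamma> A W" if "W \<in> \<W>" for W
      using that mem a by auto
    fix W W' x assume x: "W \<in> \<W>" "W' \<in> \<W>" "x \<in> W \<inter> W'"
    note m = mem[OF x(1)] mem[OF x(2)]
    have xx: "x \<in> W" "x \<in> W'" "x \<in> \<rho> W" "x \<in> \<tau> W" "x \<in> \<rho> W'" "x \<in> \<tau> W'" using x m by auto
    then have top: "x \<in> topspace X" using m(1) openin_subset by blast
    interpret h: group_hom "SA x" "SB x" "\<iota> x" by (rule i.stalk_map_group_hom[OF top])
    have z: "germ X A (\<rho> W \<inter> \<rho> W') (z (\<rho> W) (\<rho> W')) x \<in> carrier (SA x)"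
      "germ X A (\<tau> W \<inter> \<tau> W') (z' (\<tau> W) (\<tau> W')) x \<in> carrier (SA x)"
      using A.cocycle_closed[OF delta1_rep_cocycle[OF r]] A.cocycle_closed[OF delta1_rep_cocycle[OF r']] m xx
      by auto
    have ac: "germ X A W (a W) x \<in> carrier (SA x)" "germ X A W' (a W') x \<in> carrier (SA x)"
      using a x m xx by auto
    have bc: "germ X B (\<rho> W) (b (\<rho> W)) x \<in> carrier (SB x)"
      "germ X B (\<rho> W') (b (\<rho> W')) x \<in> carrier (SB x)"
      "germ X B (\<tau> W) (b' (\<tau> W)) x \<in> carrier (SB x)"
      "germ X B (\<tau> W') (b' (\<tau> W')) x \<in> carrier (SB x)"
      using m xx by auto
    have iz: "\<iota> x (germ X A (\<rho> W \<inter> \<rho> W') (z (\<rho> W) (\<rho> W')) x)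
           = inv\<^bsub>SB x\<^esub> germ X B (\<rho> W) (b (\<rho> W)) x \<otimes>\<^bsub>SB x\<^esub> germ X B (\<rho> W') (b (\<rho> W')) x"
      "\<iota> x (germ X A (\<tau> W \<inter> \<tau> W') (z' (\<tau> W) (\<tau> W')) x)
           = inv\<^bsub>SB x\<^esub> germ X B (\<tau> W) (b' (\<tau> W)) x \<otimes>\<^bsub>SB x\<^esub> germ X B (\<tau> W') (b' (\<tau> W')) x"
      using m xx r r' by (simp_all add: delta1_rep_def)
    show "germ X A (\<tau> W \<inter> \<tau> W') (z' (\<tau> W) (\<tau> W')) x
         = inv\<^bsub>SA x\<^esub> (germ X A W (a W) x)
             \<otimes>\<^bsub>SA x\<^esub> germ X A (\<rho> W \<inter> \<rho> W') (z (\<rho> W) (\<rho> W')) x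
             \<otimes>\<^bsub>SA x\<^esub> germ X A W' (a W') x"
    proof (rule stalk_i_inj)
      show "\<iota> x (germ X A (\<tau> W \<inter> \<tau> W') (z' (\<tau> W) (\<tau> W')) x)
         = \<iota> x (inv\<^bsub>SA x\<^esub> (germ X A W (a W) x)
             \<otimes>\<^bsub>SA x\<^esub> germ X A (\<rho> W \<inter> \<rho> W') (z (\<rho> W) (\<rho> W')) x
             \<otimes>\<^bsub>SA x\<^esub> germ X A W' (a W') x)"
        using z ac bc by (simp add: iz ia[OF x(1) xx(1)] ia[OF x(2) xx(2)]
            h.H.m_assoc h.H.inv_mult_group h.H.cancel_simps)
    qed (use z ac in simp_all)
  qed
qed

lemma delta1_class:
  assumes r: "delta1_rep s \<U> z b" and s: "s \<in> \<Gamma> C (topspace X)"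
  shows "delta1 X A B C i p s = cech_cohomologous X A `` {(\<U>, z)}"
  unfolding delta1_eq
proof (rule UN_const_pair)
  show "(\<U>, z) \<in> {(\<U>, z). \<exists>b. delta1_rep s \<U> z b}" using r by blast
  fix \<V> z' assume "(\<V>, z') \<in> {(\<U>, z). \<exists>b. delta1_rep s \<U> z b}"
  then obtain b' where "delta1_rep s \<V> z' b'" by blast
  then show "cech_cohomologous X A `` {(\<V>, z')} = cech_cohomologous X A `` {(\<U>, z)}"
    by (intro equiv_class_eq[OF A.cohomologous_equiv] delta1_rep_cohomologous[OF _ r s])
qed

lemma delta1_rep_exists:
  assumes s: "s \<in> \<Gamma> C (topspace X)"
  obtains \<U> z b where "delta1_rep s \<U> z b"
proof -
  define \<U> where "\<U> = {U. openin X U \<and> (\<exists>b \<in> \<Gamma> B U. p U b = restr C (topspace X) U s)}"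
  have "x \<in> \<Union>\<U>" if "x \<in> topspace X" for x
    using locally_surjective[OF openin_topspace s that] unfolding \<U>_def by blast
  moreover have "\<Union>\<U> \<subseteq> topspace X" unfolding \<U>_def using openin_subset by blast
  ultimately have "\<Union>\<U> = topspace X" by (intro subset_antisym subsetI) blast+
  then have cov: "open_cover X \<U>"
    unfolding open_cover_def by (auto simp: \<U>_def)
  have "\<forall>U\<in>\<U>. \<exists>b. b \<in> \<Gamma> B U \<and> p U b = restr C (topspace X) U s"
    unfolding \<U>_def by blast
  then obtain b where b: "\<And>U. U \<in> \<U> \<Longrightarrow> b U \<in> \<Gamma> B U"
    "\<And>U. U \<in> \<U> \<Longrightarrow> p U (b U) = restr C (topspace X) U s" by metis
  have "\<exists>a. a \<in> \<Gamma> A (U \<inter> V) \<and> (\<forall>x\<in>U \<inter> V. \<iota> x (germ X A (U \<inter> V) a x)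
           = inv\<^bsub>SB x\<^esub> germ X B U (b U) x \<otimes>\<^bsub>SB x\<^esub> germ X B V (b V) x)"
    if UV: "U \<in> \<U>" "V \<in> \<U>" for U V
  proof -
    have o: "openin X U" "openin X V" "openin X (U \<inter> V)" using UV open_cover_openin[OF cov] by auto
    then have sub: "U \<subseteq> topspace X" "V \<subseteq> topspace X" using openin_subset by auto
    have "\<pi> x (germ X B U (b U) x) = \<pi> x (germ X B V (b V) x)" if "x \<in> U \<inter> V" for x
      using that o sub b UV s by (simp add: p.stalk_map_germ C.germ_restr)
    then obtain a where "a \<in> \<Gamma> A (U \<inter> V)"
      "\<And>x. x \<in> U \<inter> V \<Longrightarrow> \<iota> x (germ X A (U \<inter> V) a x) = inv\<^bsub>SB x\<^esub> germ X B (U \<inter> V) (restr B U (U \<inter> V) (b U)) x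
         \<otimes>\<^bsub>SB x\<^esub> germ X B (U \<inter> V) (restr B V (U \<inter> V) (b V)) x"
      using section_difference[OF o(3), of "restr B U (U \<inter> V) (b U)" "restr B V (U \<inter> V) (b V)"] o b UV
      by (auto simp: B.germ_restr)
    then show ?thesis
      using o b UV by (intro exI[of _ a]) (auto simp: B.germ_restr)
  qed
  then obtain z where "\<And>U V. U \<in> \<U> \<Longrightarrow> V \<in> \<U> \<Longrightarrow> z U V \<in> \<Gamma> A (U \<inter> V) \<and>
     (\<forall>x\<in>U \<inter> V. \<iota> x (germ X A (U \<inter> V) (z U V) x)
           = inv\<^bsub>SB x\<^esub> germ X B U (b U) x \<otimes>\<^bsub>SB x\<^esub> germ X B V (b V) x)"
    by metis
  then have "delta1_rep s \<U> z b"
    unfolding delta1_rep_def using cov b by blast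
  then show thesis by (rule that)
qed

lemma delta1_in_H1:
  "s \<in> \<Gamma> C (topspace X) \<Longrightarrow> delta1 X A B C i p s \<in> H1 X A"
  by (metis delta1_rep_exists delta1_class delta1_rep_cocycle A.cocycle_class_in_H1)

lemma delta1_one: "delta1 X A B C i p \<one>\<^bsub>sections C (topspace X)\<^esub> = H1_base X A"
proof -
  have "delta1_rep \<one>\<^bsub>sections C (topspace X)\<^esub> {topspace X} (\<lambda>_ _. \<one>\<^bsub>sections A (topspace X)\<^esub>)
      (\<lambda>_. \<one>\<^bsub>sections B (topspace X)\<^esub>)"
    unfolding delta1_rep_def
  proof (intro conjI ballI; (elim singletonE)?; (hypsubst)?)
    show "open_cover X {topspace X}" by (simp add: open_cover_def)
    show "p (topspace X) \<one>\<^bsub>sections B (topspace X)\<^esub> = restr C (topspace X) (topspace X) \<one>\<^bsub>sections C (topspace X)\<^esub>"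
      by (simp add: p.map_one C.restr_one)
    show "\<one>\<^bsub>sections A (topspace X)\<^esub> \<in> \<Gamma> A (topspace X \<inter> topspace X)" by simp
    fix x assume "x \<in> topspace X \<inter> topspace X"
    then interpret h: group_hom "SA x" "SB x" "\<iota> x" by (intro i.stalk_map_group_hom) auto
    show "\<iota> x (germ X A (topspace X \<inter> topspace X) \<one>\<^bsub>sections A (topspace X)\<^esub> x)
        = inv\<^bsub>SB x\<^esub> germ X B (topspace X) \<one>\<^bsub>sections B (topspace X)\<^esub> x
          \<otimes>\<^bsub>SB x\<^esub> germ X B (topspace X) \<one>\<^bsub>sections B (topspace X)\<^esub> x"
      using \<open>x \<in> topspace X \<inter> topspace X\<close> by (simp add: A.germ_one B.germ_one)
  qed simp_all
  then show ?thesis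
    using delta1_class by (simp add: H1_base_def)
qed

end

section \<open>The Godement differential\<close>

locale abelian_presheaf = presheaf_of_groups X F for X :: "'a topology" and F :: "('a, 'g) presheaf" +
  assumes comm: "openin X U \<Longrightarrow> comm_group (sections F U)"
begin

abbreviation ZF where "ZF \<equiv> godement_quotient X F"

abbreviation QF where "QF \<equiv> quotient_presheaf (godement X F) (continuous_sections X F)"

lemma comm_stalk: "x \<in> topspace X \<Longrightarrow> comm_group (stalk X F x)"
  using comm_group_stalk comm by blast

lemma germs_godement_morphism: "presheaf_morphism X F (godement X F) (germs X F)"
proof -
  interpret G: presheaf_of_groups X "godement X F" by (rule godement_presheaf)
  show ?thesis
  proof unfold_locales
    show "germs X F U \<in> hom (sections F U) (sections (godement X F) U)" if "openin X U" for U
      using that germs_in_godement[OF that] by (intro homI) (auto simp: germs_def germ_mult)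
    show "restr (godement X F) U V (germs X F U s) = germs X F V (restr F U V s)"
      if "openin X U" "openin X V" "V \<subseteq> U" "s \<in> \<Gamma> F U" for U V s
      using that by (auto simp: germs_def germ_restr fun_eq_iff restrict_def)
  qed
qed

lemma godement_comm:
  assumes U: "openin X U"
  shows "comm_group (sections (godement X F) U)"
proof -
  interpret G: presheaf_of_groups X "godement X F" by (rule godement_presheaf)
  have "\<xi> \<otimes>\<^bsub>stalk X F x\<^esub> \<eta> = \<eta> \<otimes>\<^bsub>stalk X F x\<^esub> \<xi>"
    if "x \<in> U" "\<xi> \<in> carrier (stalk X F x)" "\<eta> \<in> carrier (stalk X F x)" for x \<xi> \<eta>
    using comm_stalk[of x] that by (metis comm_group.axioms(1) comm_monoid.m_comm stalk_in_topspace)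
  then show ?thesis
    using U by (intro group.group_comm_groupI[OF G.group_sections])
      (auto simp: PiE_iff fun_eq_iff restrict_def)
qed

lemma continuous_normal: "normal_subpresheaf X (godement X F) (continuous_sections X F)"
proof -
  interpret G: presheaf_of_groups X "godement X F" by (rule godement_presheaf)
  interpret g: presheaf_morphism X F "godement X F" "germs X F" by (rule germs_godement_morphism)
  show ?thesis
  proof (intro normal_subpresheaf.intro godement_presheaf normal_subpresheaf_axioms.intro)
    show "continuous_sections X F U \<lhd> sections (godement X F) U" if U: "openin X U" for U
    proof (rule comm_group.subgroup_imp_normal[OF godement_comm[OF U]])
      interpret gh: group_hom "sections F U" "sections (godement X F) U" "germs X F U"
        using U group_sections G.group_sections g.hom by (simp add: group_hom_def group_hom_axioms_def)
      show "subgroup (continuous_sections X F U) (sections (godement X F) U)"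
        unfolding continuous_sections_def by (rule gh.img_is_subgroup)
    qed
    show "restr (godement X F) U V s \<in> continuous_sections X F V"
      if "openin X U" "openin X V" "V \<subseteq> U" "s \<in> continuous_sections X F U" for U V s
      using that g.natural unfolding continuous_sections_def by force
  qed
qed

lemma quotient_morphism:
  "presheaf_morphism X (godement X F) ZF
     (\<lambda>U \<sigma>. germs X QF U
       (continuous_sections X F U #>\<^bsub>sections (godement X F) U\<^esub> \<sigma>))"
proof -
  interpret N: normal_subpresheaf X "godement X F" "continuous_sections X F" by (rule continuous_normal)
  show ?thesis
    unfolding godement_quotient_def quotient_sheaf_def
    by (rule presheaf_morphism_comp[OF N.coset_morphism
          presheaf_of_groups.germs_morphism[OF N.quotient_presheaf_presheaf]])
qed

lemma godement_quotient_abelian: "abelian_presheaf X ZF"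
proof -
  interpret N: normal_subpresheaf X "godement X F" "continuous_sections X F" by (rule continuous_normal)
  interpret Q: presheaf_of_groups X QF
    by (rule N.quotient_presheaf_presheaf)
  show ?thesis
    unfolding godement_quotient_def quotient_sheaf_def
    using Q.sheafify_sheaf Q.sheafify_comm N.quotient_presheaf_comm[OF _ godement_comm]
    by (simp add: abelian_presheaf_def abelian_presheaf_axioms_def sheaf_of_groups_def)
qed

lemma diff_morphism:
  "presheaf_morphism X (godement X F) (godement X ZF) (godement_diff X F)"
proof -
  have "godement_diff X F = (\<lambda>U \<sigma>. germs X ZF U
       (germs X QF U
          (continuous_sections X F U #>\<^bsub>sections (godement X F) U\<^esub> \<sigma>)))"
    by (intro ext) (simp add: godement_diff_def)
  then show ?thesis
    using presheaf_morphism_comp[OF quotient_morphism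
        abelian_presheaf.germs_godement_morphism[OF godement_quotient_abelian]] by simp
qed

text \<open>A section of \<open>F\<close> represents the trivial coset of \<open>C\<^sup>0(F)/F\<close>. The differential takes values in the
  sections of \<open>Z(F)\<close>, so the same fact for \<open>Z(F)\<close> makes two successive differentials compose to zero
  in \<open>diff_diff\<close>.\<close>

lemma diff_germs:
  assumes U: "openin X U" "s \<in> \<Gamma> F U"
  shows "godement_diff X F U (germs X F U s) = \<one>\<^bsub>sections (godement X ZF) U\<^esub>"
proof -
  interpret N: normal_subpresheaf X "godement X F" "continuous_sections X F" by (rule continuous_normal)
  interpret q: presheaf_morphism X QF
    ZF "germs X QF"
    unfolding godement_quotient_def quotient_sheaf_def
    by (rule presheaf_of_groups.germs_morphism[OF N.quotient_presheaf_presheaf])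
  interpret g: presheaf_morphism X ZF "godement X ZF"
    "germs X ZF"
    by (rule abelian_presheaf.germs_godement_morphism[OF godement_quotient_abelian])
  have "germs X F U s \<in> continuous_sections X F U"
    using U by (simp add: continuous_sections_def)
  moreover have "germs X F U s \<in> \<Gamma> (godement X F) U"
    using germs_in_godement[OF U] by simp
  ultimately have "continuous_sections X F U #>\<^bsub>sections (godement X F) U\<^esub> germs X F U s
      = \<one>\<^bsub>sections QF U\<^esub>"
    using N.coset_eq_one_iff[OF U(1)] by simp
  then show ?thesis
    unfolding godement_diff_def using q.map_one[OF U(1)] g.map_one[OF U(1)] by simp
qed

lemma diff_closed:
  "\<lbrakk>openin X U; \<sigma> \<in> disc X F U\<rbrakk>
     \<Longrightarrow> godement_diff X F U \<sigma> \<in> disc X ZF U"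
  using presheaf_morphism.map_closed[OF diff_morphism, of U \<sigma>] by simp

lemma diff_restrict:
  assumes "openin X U" "openin X V" "V \<subseteq> U" "\<sigma> \<in> disc X F U" "x \<in> V"
  shows "godement_diff X F V (restrict \<sigma> V) x = godement_diff X F U \<sigma> x"
proof -
  have "\<sigma> \<in> \<Gamma> (godement X F) U" using assms(4) by simp
  from fun_cong[OF presheaf_morphism.natural[OF diff_morphism assms(1-3) this], of x]
  show ?thesis using assms(5) by simp
qed

lemma diff_one:
  "openin X U \<Longrightarrow> godement_diff X F U (\<lambda>x\<in>U. \<one>\<^bsub>stalk X F x\<^esub>)
     = (\<lambda>x\<in>U. \<one>\<^bsub>stalk X ZF x\<^esub>)"
  using presheaf_morphism.map_one[OF diff_morphism, of U] by simp

lemma diff_diff: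
  assumes U: "openin X U" "\<sigma> \<in> disc X F U"
  shows "godement_diff X ZF U (godement_diff X F U \<sigma>)
    = \<one>\<^bsub>sections (godement X (godement_quotient X ZF)) U\<^esub>"
  using abelian_presheaf.diff_germs[OF godement_quotient_abelian U(1)
      presheaf_morphism.map_closed[OF quotient_morphism U(1)]] U(2)
  by (simp add: godement_diff_def[of X F])

lemma restrict_PiE: "\<lbrakk>\<sigma> \<in> (\<Pi>\<^sub>E x\<in>U. S x); V \<subseteq> U\<rbrakk> \<Longrightarrow> restrict \<sigma> V \<in> (\<Pi>\<^sub>E x\<in>V. S x)"
  by auto

text \<open>All differentials may be computed after restriction to \<open>N\<close>, where \<open>d\<close> is a homomorphism that kills
  the germs of \<open>s\<close>. The form with four factors combines locality, multiplicativity and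
  independence of sections of \<open>F\<close>, which the comparison of two representatives needs together.\<close>

lemma diff_relation:
  assumes U: "openin X U1" "openin X U2" "openin X U3" "openin X U4"
    and mem: "\<sigma> \<in> disc X F U1" "\<tau> \<in> disc X F U2"
      "\<sigma>' \<in> disc X F U3" "\<tau>' \<in> disc X F U4"
    and N: "openin X N" "N \<subseteq> U1" "N \<subseteq> U2" "N \<subseteq> U3" "N \<subseteq> U4" and s: "s \<in> \<Gamma> F N"
    and eq: "\<And>y. y \<in> N \<Longrightarrow> \<sigma> y \<otimes>\<^bsub>stalk X F y\<^esub> \<tau> y
      = \<sigma>' y \<otimes>\<^bsub>stalk X F y\<^esub> \<tau>' y \<otimes>\<^bsub>stalk X F y\<^esub> germ X F N s y"
    and x: "x \<in> N"
  shows "godement_diff X F U1 \<sigma> x \<otimes>\<^bsub>stalk X ZF x\<^esub> godement_diff X F U2 \<tau> x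
    = godement_diff X F U3 \<sigma>' x \<otimes>\<^bsub>stalk X ZF x\<^esub> godement_diff X F U4 \<tau>' x"
proof -
  let ?Z = "stalk X ZF" and ?d = "godement_diff X F N"
  interpret d: presheaf_morphism X "godement X F" "godement X ZF" "godement_diff X F"
    by (rule diff_morphism)
  let ?G = "sections (godement X F) N"
  let ?r = "\<lambda>\<sigma>. restrict \<sigma> N"
  have r: "?r \<sigma> \<in> carrier ?G" "?r \<tau> \<in> carrier ?G" "?r \<sigma>' \<in> carrier ?G" "?r \<tau>' \<in> carrier ?G"
    using restrict_PiE[OF mem(1) N(2)] restrict_PiE[OF mem(2) N(3)]
      restrict_PiE[OF mem(3) N(4)] restrict_PiE[OF mem(4) N(5)] by simp_all
  have g: "germs X F N s \<in> carrier ?G" using germs_in_godement[OF N(1) s] by simp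
  have "?r \<sigma> \<otimes>\<^bsub>?G\<^esub> ?r \<tau> = (?r \<sigma>' \<otimes>\<^bsub>?G\<^esub> ?r \<tau>') \<otimes>\<^bsub>?G\<^esub> germs X F N s"
    using eq by (auto simp: fun_eq_iff restrict_def germs_def)
  then have "?d (?r \<sigma> \<otimes>\<^bsub>?G\<^esub> ?r \<tau>) = ?d ((?r \<sigma>' \<otimes>\<^bsub>?G\<^esub> ?r \<tau>') \<otimes>\<^bsub>?G\<^esub> germs X F N s)"
    by (rule arg_cong)
  then have "?d (?r \<sigma>) \<otimes>\<^bsub>sections (godement X ZF) N\<^esub> ?d (?r \<tau>)
     = (?d (?r \<sigma>') \<otimes>\<^bsub>sections (godement X ZF) N\<^esub> ?d (?r \<tau>'))
       \<otimes>\<^bsub>sections (godement X ZF) N\<^esub> \<one>\<^bsub>sections (godement X ZF) N\<^esub>"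
    by (simp only: d.map_mult[OF N(1)] r g d.dom.mult_closed[OF N(1)] diff_germs[OF N(1) s])
  also have "\<dots> = ?d (?r \<sigma>') \<otimes>\<^bsub>sections (godement X ZF) N\<^esub> ?d (?r \<tau>')"
    by (intro monoid.r_one group.is_monoid d.cod.group_sections d.cod.mult_closed d.map_closed N r)
  finally have *: "?d (?r \<sigma>) \<otimes>\<^bsub>sections (godement X ZF) N\<^esub> ?d (?r \<tau>)
     = ?d (?r \<sigma>') \<otimes>\<^bsub>sections (godement X ZF) N\<^esub> ?d (?r \<tau>')" .
  have "?d (?r \<sigma>) x \<otimes>\<^bsub>?Z x\<^esub> ?d (?r \<tau>) x = ?d (?r \<sigma>') x \<otimes>\<^bsub>?Z x\<^esub> ?d (?r \<tau>') x"
    using fun_cong[OF *, of x] x by simp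
  then show ?thesis
    using diff_restrict[OF U(1) N(1,2) mem(1) x] diff_restrict[OF U(2) N(1,3) mem(2) x]
      diff_restrict[OF U(3) N(1,4) mem(3) x] diff_restrict[OF U(4) N(1,5) mem(4) x] by simp
qed

lemma diff_product:
  assumes U: "openin X U1" "openin X U2" "openin X U3"
    and mem: "\<sigma> \<in> disc X F U1" "\<tau> \<in> disc X F U2"
      "\<rho> \<in> disc X F U3"
    and N: "openin X N" "N \<subseteq> U1" "N \<subseteq> U2" "N \<subseteq> U3" and s: "s \<in> \<Gamma> F N"
    and eq: "\<And>y. y \<in> N \<Longrightarrow> \<sigma> y \<otimes>\<^bsub>stalk X F y\<^esub> \<tau> y = \<rho> y \<otimes>\<^bsub>stalk X F y\<^esub> germ X F N s y"
    and x: "x \<in> N"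
  shows "godement_diff X F U1 \<sigma> x \<otimes>\<^bsub>stalk X ZF x\<^esub> godement_diff X F U2 \<tau> x
    = godement_diff X F U3 \<rho> x"
proof -
  interpret Z: abelian_presheaf X ZF by (rule godement_quotient_abelian)
  have grp: "group (stalk X F y)" if "y \<in> U3" for y using group_stalk_on U(3) that by blast
  have one: "(\<lambda>y\<in>U3. \<one>\<^bsub>stalk X F y\<^esub>) \<in> disc X F U3"
    using grp by (auto intro!: monoid.one_closed group.is_monoid)
  have "\<rho> y \<otimes>\<^bsub>stalk X F y\<^esub> \<one>\<^bsub>stalk X F y\<^esub> = \<rho> y" if "y \<in> U3" for y
    using grp[OF that] mem(3) that by (intro monoid.r_one group.is_monoid) auto
  then have "\<rho> y \<otimes>\<^bsub>stalk X F y\<^esub> (\<lambda>y\<in>U3. \<one>\<^bsub>stalk X F y\<^esub>) y = \<rho> y" if "y \<in> N" for y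
    using N(4) that by auto
  then have "godement_diff X F U1 \<sigma> x \<otimes>\<^bsub>stalk X ZF x\<^esub> godement_diff X F U2 \<tau> x
     = godement_diff X F U3 \<rho> x \<otimes>\<^bsub>stalk X ZF x\<^esub>
       godement_diff X F U3 (\<lambda>y\<in>U3. \<one>\<^bsub>stalk X F y\<^esub>) x"
    using eq by (intro diff_relation[OF U(1,2,3,3) mem one N(1,2,3,4,4) s _ x]) simp
  also have "\<dots> = godement_diff X F U3 \<rho> x"
    using diff_closed[OF U(3) mem(3)] x N Z.group_stalk_on[OF U(3), of x]
    by (subst diff_one[OF U(3)]) (auto intro!: monoid.r_one group.is_monoid)
  finally show ?thesis .
qed

definition coboundaries2 where
  "coboundaries2 = godement_diff X ZF (topspace X) `
     carrier (H0 X (godement X ZF))"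

lemma H2_one: "\<one>\<^bsub>H2 X F\<^esub> = coboundaries2"
  by (simp add: H2_def coboundaries2_def Let_def FactGroup_def)

lemma H2_coset_closed:
  assumes "y \<in> carrier (H0 X (godement X (godement_quotient X ZF)))"
    and "godement_diff X (godement_quotient X ZF) (topspace X) y
      = \<one>\<^bsub>H0 X (godement X (godement_quotient X (godement_quotient X ZF)))\<^esub>"
  shows "coboundaries2 #>\<^bsub>H0 X (godement X (godement_quotient X ZF))\<^esub> y \<in> carrier (H2 X F)"
  using assms by (force simp: H2_def coboundaries2_def Let_def FactGroup_def RCOSETS_def kernel_def r_coset_def)

lemma coboundaries2_subgroup:
  "subgroup coboundaries2 (H0 X (godement X (godement_quotient X ZF)))"
proof -
  interpret d: presheaf_morphism X "godement X ZF"
    "godement X (godement_quotient X ZF)" "godement_diff X ZF"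
    by (rule abelian_presheaf.diff_morphism[OF godement_quotient_abelian])
  interpret h: group_hom "sections (godement X ZF) (topspace X)"
    "sections (godement X (godement_quotient X ZF)) (topspace X)"
    "godement_diff X ZF (topspace X)"
    using d.dom.group_sections[OF openin_topspace] d.cod.group_sections[OF openin_topspace]
      d.hom[OF openin_topspace] by (simp only: group_hom_def group_hom_axioms_def)
  show ?thesis
    unfolding coboundaries2_def H0_def by (rule h.img_is_subgroup)
qed

end

section \<open>The connecting map in degree two of a central extension\<close>

lemma restrict_cong_iff: "(\<lambda>x\<in>W. f x) = (\<lambda>x\<in>W. h x) \<longleftrightarrow> (\<forall>x\<in>W. f x = h x)"
  by (auto simp: fun_eq_iff restrict_def)

lemma PiE_eq_restrict_iff: "f \<in> (\<Pi>\<^sub>E x\<in>U. S x) \<Longrightarrow> f = restrict h U \<longleftrightarrow> (\<forall>x\<in>U. f x = h x)"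
  by (auto simp: PiE_iff fun_eq_iff restrict_def extensional_def)

lemma (in presheaf_of_groups) godement_inv:
  assumes "openin X W" "\<sigma> \<in> disc X F W"
  shows "inv\<^bsub>sections (godement X F) W\<^esub> \<sigma> = (\<lambda>x\<in>W. inv\<^bsub>stalk X F x\<^esub> \<sigma> x)"
  using assms group_stalk_on[OF assms(1)] by simp

locale central_extension = short_exact X A B C i p + A: abelian_presheaf X A
  for X :: "'a topology" and A :: "('a, 'f) presheaf" and B :: "('a, 'g) presheaf"
    and C :: "('a, 'h) presheaf" and i :: "'a set \<Rightarrow> 'f \<Rightarrow> 'g" and p :: "'a set \<Rightarrow> 'g \<Rightarrow> 'h" +
  assumes central: "\<lbrakk>openin X U; a \<in> \<Gamma> A U; b \<in> \<Gamma> B U\<rbrakk>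
    \<Longrightarrow> i U a \<otimes>\<^bsub>sections B U\<^esub> b = b \<otimes>\<^bsub>sections B U\<^esub> i U a"
begin

abbreviation ZA where "ZA \<equiv> godement_quotient X A"
abbreviation ZZA where "ZZA \<equiv> godement_quotient X ZA"

sublocale Z: abelian_presheaf X ZA
  by (rule A.godement_quotient_abelian)

sublocale ZZ: abelian_presheaf X ZZA
  by (rule Z.godement_quotient_abelian)

abbreviation SZ where "SZ x \<equiv> stalk X ZA x"
abbreviation SZZ where "SZZ x \<equiv> stalk X ZZA x"
abbreviation d\<^sub>0 where "d\<^sub>0 \<equiv> godement_diff X A"
abbreviation d\<^sub>1 where "d\<^sub>1 \<equiv> godement_diff X ZA"

lemma stalk_central:
  assumes "\<alpha> \<in> carrier (SA x)" "\<beta> \<in> carrier (SB x)"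
  shows "\<iota> x \<alpha> \<otimes>\<^bsub>SB x\<^esub> \<beta> = \<beta> \<otimes>\<^bsub>SB x\<^esub> \<iota> x \<alpha>"
proof -
  obtain U a where U: "openin X U" "x \<in> U" "a \<in> \<Gamma> A U" "\<alpha> = germ X A U a x"
    using assms A.stalk_cases by metis
  obtain V b where V: "openin X V" "x \<in> V" "b \<in> \<Gamma> B V" "\<beta> = germ X B V b x"
    using assms B.stalk_cases by metis
  let ?N = "U \<inter> V"
  have N: "openin X ?N" using U V by blast
  have "\<alpha> = germ X A ?N (restr A U ?N a) x" "\<beta> = germ X B ?N (restr B V ?N b) x"
    using U V N by (simp_all add: A.germ_restr B.germ_restr)
  then show ?thesis
    using central[OF N, of "restr A U ?N a" "restr B V ?N b"] U V N
    by (simp add: i.stalk_map_germ B.germ_mult [symmetric])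
qed

text \<open>By this rule and the next one, a product of elements \<open>\<beta> \<iota>(\<alpha>)\<close> splits into its \<open>\<beta>\<close>-part, computed
  in the stalk of \<open>B\<close>, and its \<open>\<alpha>\<close>-part, computed in the stalk of \<open>A\<close>.\<close>

lemma central_mult:
  assumes "\<alpha> \<in> carrier (SA x)" "\<alpha>' \<in> carrier (SA x)"
    "\<beta> \<in> carrier (SB x)" "\<beta>' \<in> carrier (SB x)"
  shows "(\<beta> \<otimes>\<^bsub>SB x\<^esub> \<iota> x \<alpha>) \<otimes>\<^bsub>SB x\<^esub> (\<beta>' \<otimes>\<^bsub>SB x\<^esub> \<iota> x \<alpha>')
    = (\<beta> \<otimes>\<^bsub>SB x\<^esub> \<beta>') \<otimes>\<^bsub>SB x\<^esub> \<iota> x (\<alpha> \<otimes>\<^bsub>SA x\<^esub> \<alpha>')"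
proof -
  interpret h: group_hom "SA x" "SB x" "\<iota> x"
    by (rule i.stalk_map_group_hom[OF A.stalk_in_topspace[OF assms(1)]])
  have "\<iota> x \<alpha> \<otimes>\<^bsub>SB x\<^esub> (\<beta>' \<otimes>\<^bsub>SB x\<^esub> \<iota> x \<alpha>')
      = \<beta>' \<otimes>\<^bsub>SB x\<^esub> (\<iota> x \<alpha> \<otimes>\<^bsub>SB x\<^esub> \<iota> x \<alpha>')"
    using assms by (simp add: h.H.m_assoc [symmetric] stalk_central[OF assms(1,4)])
  then show ?thesis
    using assms by (simp add: h.H.m_assoc)
qed

lemma central_inv:
  assumes "\<alpha> \<in> carrier (SA x)" "\<beta> \<in> carrier (SB x)"
  shows "inv\<^bsub>SB x\<^esub> (\<beta> \<otimes>\<^bsub>SB x\<^esub> \<iota> x \<alpha>)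
    = inv\<^bsub>SB x\<^esub> \<beta> \<otimes>\<^bsub>SB x\<^esub> \<iota> x (inv\<^bsub>SA x\<^esub> \<alpha>)"
proof -
  interpret h: group_hom "SA x" "SB x" "\<iota> x"
    by (rule i.stalk_map_group_hom[OF A.stalk_in_topspace[OF assms(1)]])
  show ?thesis
    using assms stalk_central[of "inv\<^bsub>SA x\<^esub> \<alpha>" x "inv\<^bsub>SB x\<^esub> \<beta>"]
    by (simp add: h.H.inv_mult_group)
qed

text \<open>The local part of the choices for the degree two map: a lift \<open>b\<close> of \<open>g U V\<close> over \<open>W\<close> together
  with the discontinuous section \<open>a\<close> of \<open>A\<close> by which it differs from \<open>(\<beta> U)\<^sup>-\<^sup>1 (\<beta> V)\<close>.\<close>

definition local_lift where
  "local_lift g \<beta> U V W a b \<longleftrightarrow> openin X W \<and> W \<subseteq> U \<inter> V \<and>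
     a \<in> disc X A W \<and> b \<in> \<Gamma> B W \<and>
     (\<forall>y\<in>W. \<pi> y (germ X B W b y) = germ X C (U \<inter> V) (g U V) y) \<and>
     (\<forall>y\<in>W. germ X B W b y = inv\<^bsub>SB y\<^esub> \<beta> U y \<otimes>\<^bsub>SB y\<^esub> \<beta> V y \<otimes>\<^bsub>SB y\<^esub> \<iota> y (a y))"

text \<open>All choices for the degree two map, with every identity between sections read pointwise;
  \<open>delta2_rep_iff\<close> matches this with the original description.\<close>

definition delta2_data where
  "delta2_data \<U> g y \<beta> \<zeta> \<longleftrightarrow> y \<in> (\<Pi>\<^sub>E x\<in>topspace X. carrier (SZZ x)) \<and>
     (\<forall>U\<in>\<U>. \<beta> U \<in> disc X B U \<and> \<zeta> U \<in> disc X ZA U \<and>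
        (\<forall>x\<in>U. d\<^sub>1 U (\<zeta> U) x = y x)) \<and>
     (\<forall>U\<in>\<U>. \<forall>V\<in>\<U>. \<forall>x\<in>U \<inter> V. \<exists>W a b. x \<in> W \<and> local_lift g \<beta> U V W a b \<and>
        (\<forall>y\<in>W. d\<^sub>0 W a y = inv\<^bsub>SZ y\<^esub> \<zeta> U y \<otimes>\<^bsub>SZ y\<^esub> \<zeta> V y))"

lemma delta2_rep_iff:
  assumes g: "(\<U>, g) \<in> cech_cocycles X C"
  shows "delta2_rep X A B C i p \<U> g y \<longleftrightarrow> (\<exists>\<beta> \<zeta>. delta2_data \<U> g y \<beta> \<zeta>)"
proof -
  have cov: "open_cover X \<U>" using g by (simp add: C.cocycle_iff)
  have zeta: "d\<^sub>1 U z = restr (godement X ZZA) (topspace X) U y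
      \<longleftrightarrow> (\<forall>x\<in>U. d\<^sub>1 U z x = y x)"
    if "U \<in> \<U>" "z \<in> \<Gamma> (godement X ZA) U" for U z
  proof -
    have "d\<^sub>1 U z \<in> disc X ZZA U"
      using that open_cover_openin[OF cov] by (intro Z.diff_closed) auto
    then show ?thesis by (simp add: PiE_eq_restrict_iff)
  qed
  have lift: "(openin X W \<and> x \<in> W \<and> W \<subseteq> U \<inter> V \<and>
           a \<in> \<Gamma> (godement X A) W \<and> b \<in> \<Gamma> B W \<and>
           p W b = restr C (U \<inter> V) W (g U V) \<and>
           germs X B W b = inv\<^bsub>sections (godement X B) W\<^esub> (restr (godement X B) U W (\<beta> U))
                             \<otimes>\<^bsub>sections (godement X B) W\<^esub> restr (godement X B) V W (\<beta> V)
                             \<otimes>\<^bsub>sections (godement X B) W\<^esub> stalkwise X B i W a \<and>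
           d\<^sub>0 W a = inv\<^bsub>sections (godement X ZA) W\<^esub>
                (restr (godement X ZA) U W (\<zeta> U))
             \<otimes>\<^bsub>sections (godement X ZA) W\<^esub>
                restr (godement X ZA) V W (\<zeta> V))
     \<longleftrightarrow> x \<in> W \<and> local_lift g \<beta> U V W a b \<and>
        (\<forall>y\<in>W. d\<^sub>0 W a y = inv\<^bsub>SZ y\<^esub> \<zeta> U y \<otimes>\<^bsub>SZ y\<^esub> \<zeta> V y)"
    (is "?L \<longleftrightarrow> ?R")
    if UV: "U \<in> \<U>" "V \<in> \<U>"
      and \<beta>: "\<forall>U\<in>\<U>. \<beta> U \<in> \<Gamma> (godement X B) U \<and>
          \<zeta> U \<in> \<Gamma> (godement X ZA) U \<and>
          d\<^sub>1 U (\<zeta> U) = restr (godement X ZZA) (topspace X) U y"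
    for U V W a b x \<beta> \<zeta>
  proof (cases "openin X W \<and> W \<subseteq> U \<inter> V \<and> a \<in> \<Gamma> (godement X A) W \<and> b \<in> \<Gamma> B W")
    case False
    then show ?thesis by (auto simp: local_lift_def)
  next
    case True
    then have W: "openin X W" "W \<subseteq> U" "W \<subseteq> V" "W \<subseteq> U \<inter> V"
      and a: "a \<in> disc X A W" and b: "b \<in> \<Gamma> B W" by auto
    have o: "openin X (U \<inter> V)" using UV open_cover_openin[OF cov] openin_Int by blast
    have gUV: "g U V \<in> \<Gamma> C (U \<inter> V)" using g UV by (simp add: C.cocycle_iff)
    have bU: "restrict (\<beta> U) W \<in> disc X B W"
      and zU: "restrict (\<zeta> U) W \<in> disc X ZA W"
    proof -
      have *: "\<beta> U \<in> disc X B U" "\<zeta> U \<in> disc X ZA U"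
        using \<beta> UV by auto
      show "restrict (\<beta> U) W \<in> disc X B W"
        "restrict (\<zeta> U) W \<in> disc X ZA W"
        by (rule A.restrict_PiE[OF *(1) W(2)], rule A.restrict_PiE[OF *(2) W(2)])
    qed
    have 1: "p W b = restr C (U \<inter> V) W (g U V)
       \<longleftrightarrow> (\<forall>y\<in>W. \<pi> y (germ X B W b y) = germ X C (U \<inter> V) (g U V) y)"
      using W b o gUV C.restr_closed[OF o W(1,4) gUV] C.germ_restr[OF o W(1,4) _ gUV]
      by (subst C.section_eq_iff[of W]) (simp_all add: p.stalk_map_germ)
    have "inv\<^bsub>sections (godement X B) W\<^esub> (restr (godement X B) U W (\<beta> U)) = (\<lambda>x\<in>W. inv\<^bsub>SB x\<^esub> \<beta> U x)"
      using B.godement_inv[OF W(1) bU] by (simp cong: restrict_cong)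
    then have 2: "germs X B W b = inv\<^bsub>sections (godement X B) W\<^esub> (restr (godement X B) U W (\<beta> U))
                             \<otimes>\<^bsub>sections (godement X B) W\<^esub> restr (godement X B) V W (\<beta> V)
                             \<otimes>\<^bsub>sections (godement X B) W\<^esub> stalkwise X B i W a
       \<longleftrightarrow> (\<forall>y\<in>W. germ X B W b y = inv\<^bsub>SB y\<^esub> \<beta> U y \<otimes>\<^bsub>SB y\<^esub> \<beta> V y \<otimes>\<^bsub>SB y\<^esub> \<iota> y (a y))"
      by (simp add: germs_def stalkwise_eq restrict_cong_iff)
    have inv_zeta: "inv\<^bsub>sections (godement X ZA) W\<^esub>
        (restr (godement X ZA) U W (\<zeta> U)) = (\<lambda>x\<in>W. inv\<^bsub>SZ x\<^esub> \<zeta> U x)"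
      using Z.godement_inv[OF W(1) zU] by (simp cong: restrict_cong)
    have 3: "d\<^sub>0 W a = inv\<^bsub>sections (godement X ZA) W\<^esub>
                (restr (godement X ZA) U W (\<zeta> U))
             \<otimes>\<^bsub>sections (godement X ZA) W\<^esub>
                restr (godement X ZA) V W (\<zeta> V)
       \<longleftrightarrow> (\<forall>y\<in>W. d\<^sub>0 W a y = inv\<^bsub>SZ y\<^esub> \<zeta> U y \<otimes>\<^bsub>SZ y\<^esub> \<zeta> V y)"
      unfolding inv_zeta using A.diff_closed[OF W(1) a] by (simp add: PiE_eq_restrict_iff)
    show ?thesis
      unfolding local_lift_def 1 2 3 using True a by auto
  qed
  have "((\<forall>U\<in>\<U>. \<beta> U \<in> \<Gamma> (godement X B) U \<and>
          \<zeta> U \<in> \<Gamma> (godement X ZA) U \<and>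
          d\<^sub>1 U (\<zeta> U) = restr (godement X ZZA) (topspace X) U y) \<and>
      (\<forall>U\<in>\<U>. \<forall>V\<in>\<U>. \<forall>x\<in>U \<inter> V. \<exists>W a b. openin X W \<and> x \<in> W \<and> W \<subseteq> U \<inter> V \<and>
           a \<in> \<Gamma> (godement X A) W \<and> b \<in> \<Gamma> B W \<and>
           p W b = restr C (U \<inter> V) W (g U V) \<and>
           germs X B W b = inv\<^bsub>sections (godement X B) W\<^esub> (restr (godement X B) U W (\<beta> U))
                             \<otimes>\<^bsub>sections (godement X B) W\<^esub> restr (godement X B) V W (\<beta> V)
                             \<otimes>\<^bsub>sections (godement X B) W\<^esub> stalkwise X B i W a \<and>
           d\<^sub>0 W a = inv\<^bsub>sections (godement X ZA) W\<^esub>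
                (restr (godement X ZA) U W (\<zeta> U))
             \<otimes>\<^bsub>sections (godement X ZA) W\<^esub>
                restr (godement X ZA) V W (\<zeta> V)))
    \<longleftrightarrow> (\<forall>U\<in>\<U>. \<beta> U \<in> disc X B U \<and> \<zeta> U \<in> disc X ZA U \<and>
        (\<forall>x\<in>U. d\<^sub>1 U (\<zeta> U) x = y x)) \<and>
     (\<forall>U\<in>\<U>. \<forall>V\<in>\<U>. \<forall>x\<in>U \<inter> V. \<exists>W a b. x \<in> W \<and> local_lift g \<beta> U V W a b \<and>
        (\<forall>y\<in>W. d\<^sub>0 W a y = inv\<^bsub>SZ y\<^esub> \<zeta> U y \<otimes>\<^bsub>SZ y\<^esub> \<zeta> V y))"
    (is "?P1 \<and> ?Q1 \<longleftrightarrow> ?P2 \<and> ?Q2") for \<beta> \<zeta>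
  proof -
    have P: "?P1 \<longleftrightarrow> ?P2"
      by (intro ball_cong refl) (use zeta in \<open>auto simp: godement_simps(1)\<close>)
    have Q: "?Q1 \<longleftrightarrow> ?Q2" if P1: ?P1
      by (intro ball_cong ex_cong1 refl) (rule lift[OF _ _ P1]; assumption)
    show ?thesis
      using P Q by argo
  qed
  note * = this
  show ?thesis
    unfolding delta2_rep_def delta2_data_def Let_def H0_def * by simp
qed

lemma local_lift_exists:
  assumes UV: "openin X U" "openin X V" "x \<in> U" "x \<in> V" and g: "g U V \<in> \<Gamma> C (U \<inter> V)"
    and \<beta>: "\<beta> U \<in> disc X B U" "\<beta> V \<in> disc X B V"
    and eq: "\<And>y. y \<in> U \<inter> V \<Longrightarrow> inv\<^bsub>SC y\<^esub> \<pi> y (\<beta> U y) \<otimes>\<^bsub>SC y\<^esub> \<pi> y (\<beta> V y) = germ X C (U \<inter> V) (g U V) y"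
  shows "\<exists>W a b. x \<in> W \<and> local_lift g \<beta> U V W a b"
proof -
  have o: "openin X (U \<inter> V)" using UV by blast
  obtain W b where W: "openin X W" "x \<in> W" "W \<subseteq> U \<inter> V" "b \<in> \<Gamma> B W"
    "p W b = restr C (U \<inter> V) W (g U V)"
    using locally_surjective[OF o g, of x] UV by auto
  have pb: "\<pi> y (germ X B W b y) = germ X C (U \<inter> V) (g U V) y" if "y \<in> W" for y
    using W that C.germ_restr[OF o W(1,3) that g] by (simp add: p.stalk_map_germ)
  have "\<exists>\<alpha>. \<alpha> \<in> carrier (SA y) \<and> germ X B W b y
      = inv\<^bsub>SB y\<^esub> \<beta> U y \<otimes>\<^bsub>SB y\<^esub> \<beta> V y \<otimes>\<^bsub>SB y\<^esub> \<iota> y \<alpha>" if y: "y \<in> W" for y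
  proof -
    have yUV: "y \<in> U" "y \<in> V" using y W by auto
    have top: "y \<in> topspace X" using yUV UV openin_subset by blast
    interpret h: group_hom "SB y" "SC y" "\<pi> y" by (rule p.stalk_map_group_hom[OF top])
    have c: "\<beta> U y \<in> carrier (SB y)" "\<beta> V y \<in> carrier (SB y)"
      "germ X B W b y \<in> carrier (SB y)" using \<beta> yUV W y by auto
    let ?q = "inv\<^bsub>SB y\<^esub> \<beta> U y \<otimes>\<^bsub>SB y\<^esub> \<beta> V y"
    have "germ X C (U \<inter> V) (g U V) y \<in> carrier (SC y)"
      using yUV by (intro C.germ_in_stalk o g) auto
    then have "\<pi> y (inv\<^bsub>SB y\<^esub> ?q \<otimes>\<^bsub>SB y\<^esub> germ X B W b y) = \<one>\<^bsub>SC y\<^esub>"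
      using c eq[of y] yUV pb[OF y] by simp
    then obtain \<alpha> where "\<alpha> \<in> carrier (SA y)" "\<iota> y \<alpha> = inv\<^bsub>SB y\<^esub> ?q \<otimes>\<^bsub>SB y\<^esub> germ X B W b y"
      using stalk_exact[of "inv\<^bsub>SB y\<^esub> ?q \<otimes>\<^bsub>SB y\<^esub> germ X B W b y" y] c by auto
    then show ?thesis
      using c by (intro exI[of _ \<alpha>]) (simp add: h.G.cancel_simps)
  qed
  then obtain a where a: "\<And>y. y \<in> W \<Longrightarrow> a y \<in> carrier (SA y)"
    "\<And>y. y \<in> W \<Longrightarrow> germ X B W b y
      = inv\<^bsub>SB y\<^esub> \<beta> U y \<otimes>\<^bsub>SB y\<^esub> \<beta> V y \<otimes>\<^bsub>SB y\<^esub> \<iota> y (a y)" by metis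
  then have "local_lift g \<beta> U V W (restrict a W) b"
    unfolding local_lift_def using W pb by auto
  then show ?thesis using W by blast
qed

text \<open>The section \<open>(b3)\<^sup>-\<^sup>1 b1 b2\<close> has trivial image in \<open>C\<close>, hence comes from \<open>A\<close>. By centrality its stalks
  are \<open>(a3)\<^sup>-\<^sup>1 a1 a2\<close>, since the factors from \<open>\<beta>\<close> cancel; and \<open>d\<close> kills it.\<close>

lemma local_lift_cocycle:
  assumes g: "(\<U>, g) \<in> cech_cocycles X C" and U: "U \<in> \<U>" "V \<in> \<U>" "V' \<in> \<U>"
    and \<beta>: "\<And>U. U \<in> \<U> \<Longrightarrow> \<beta> U \<in> disc X B U"
    and l: "local_lift g \<beta> U V W1 a1 b1" "local_lift g \<beta> V V' W2 a2 b2" "local_lift g \<beta> U V' W3 a3 b3"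
    and x: "x \<in> W1" "x \<in> W2" "x \<in> W3"
  shows "d\<^sub>0 W1 a1 x \<otimes>\<^bsub>SZ x\<^esub> d\<^sub>0 W2 a2 x = d\<^sub>0 W3 a3 x"
proof -
  let ?N = "W1 \<inter> W2 \<inter> W3"
  have W: "openin X W1" "openin X W2" "openin X W3"
    "W1 \<subseteq> U" "W1 \<subseteq> V" "W2 \<subseteq> V" "W2 \<subseteq> V'" "W3 \<subseteq> U" "W3 \<subseteq> V'"
    and a: "a1 \<in> disc X A W1" "a2 \<in> disc X A W2"
      "a3 \<in> disc X A W3"
    and b: "b1 \<in> \<Gamma> B W1" "b2 \<in> \<Gamma> B W2" "b3 \<in> \<Gamma> B W3"
    using l by (auto simp: local_lift_def)
  have N: "openin X ?N" "?N \<subseteq> W1" "?N \<subseteq> W2" "?N \<subseteq> W3" using W by auto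
  let ?b = "restr B W1 ?N b1 \<otimes>\<^bsub>sections B ?N\<^esub> restr B W2 ?N b2" and ?b' = "restr B W3 ?N b3"
  have r: "restr B W1 ?N b1 \<in> \<Gamma> B ?N" "restr B W2 ?N b2 \<in> \<Gamma> B ?N"
    "?b' \<in> \<Gamma> B ?N"
    using B.restr_closed[OF W(1) N(1,2) b(1)] B.restr_closed[OF W(2) N(1,3) b(2)]
      B.restr_closed[OF W(3) N(1,4) b(3)] by auto
  have bc: "?b \<in> \<Gamma> B ?N" using r N(1) by (intro B.mult_closed)
  have gb: "germ X B ?N ?b y = germ X B W1 b1 y \<otimes>\<^bsub>SB y\<^esub> germ X B W2 b2 y"
    "germ X B ?N ?b' y = germ X B W3 b3 y" if "y \<in> ?N" for y
    using B.germ_mult[OF N(1) that r(1,2)] B.germ_restr[OF W(1) N(1,2) that b(1)]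
      B.germ_restr[OF W(2) N(1,3) that b(2)] B.germ_restr[OF W(3) N(1,4) that b(3)] by auto
  have eq: "\<pi> y (germ X B ?N ?b' y) = \<pi> y (germ X B ?N ?b y)" if y: "y \<in> ?N" for y
  proof -
    have top: "y \<in> topspace X" using y N(1) openin_subset by blast
    interpret h: group_hom "SB y" "SC y" "\<pi> y" by (rule p.stalk_map_group_hom[OF top])
    have "germ X B W1 b1 y \<in> carrier (SB y)" "germ X B W2 b2 y \<in> carrier (SB y)"
      using y W b by auto
    moreover have "y \<in> U" "y \<in> V" "y \<in> V'" using y W by auto
    then have "germ X C (U \<inter> V) (g U V) y \<otimes>\<^bsub>SC y\<^esub> germ X C (V \<inter> V') (g V V') y = germ X C (U \<inter> V') (g U V') y"
      by (intro C.cocycle_mult[OF g U])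
    moreover have "\<pi> y (germ X B W1 b1 y) = germ X C (U \<inter> V) (g U V) y"
      "\<pi> y (germ X B W2 b2 y) = germ X C (V \<inter> V') (g V V') y"
      "\<pi> y (germ X B W3 b3 y) = germ X C (U \<inter> V') (g U V') y"
      using l y unfolding local_lift_def by blast+
    ultimately show ?thesis
      by (simp add: gb[OF y])
  qed
  obtain s where s: "s \<in> \<Gamma> A ?N"
    and iota_s: "\<And>y. y \<in> ?N \<Longrightarrow> \<iota> y (germ X A ?N s y) = inv\<^bsub>SB y\<^esub> germ X B ?N ?b' y \<otimes>\<^bsub>SB y\<^esub> germ X B ?N ?b y"
    using section_difference[OF N(1) r(3) bc eq] by blast
  have rel: "a1 y \<otimes>\<^bsub>SA y\<^esub> a2 y = a3 y \<otimes>\<^bsub>SA y\<^esub> germ X A ?N s y" if y: "y \<in> ?N" for y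
  proof -
    have top: "y \<in> topspace X" using y N(1) openin_subset by blast
    interpret h: group_hom "SA y" "SB y" "\<iota> y" by (rule i.stalk_map_group_hom[OF top])
    have c: "a1 y \<in> carrier (SA y)" "a2 y \<in> carrier (SA y)" "a3 y \<in> carrier (SA y)"
      "germ X A ?N s y \<in> carrier (SA y)"
      using a y A.germ_in_stalk[OF N(1) y s] by auto
    have yU: "y \<in> U" "y \<in> V" "y \<in> V'" using y W by auto
    have bc: "\<beta> U y \<in> carrier (SB y)" "\<beta> V y \<in> carrier (SB y)" "\<beta> V' y \<in> carrier (SB y)"
      using \<beta>[OF U(1)] \<beta>[OF U(2)] \<beta>[OF U(3)] yU by auto
    let ?q = "\<lambda>U V. inv\<^bsub>SB y\<^esub> \<beta> U y \<otimes>\<^bsub>SB y\<^esub> \<beta> V y"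
    have "germ X B W1 b1 y = ?q U V \<otimes>\<^bsub>SB y\<^esub> \<iota> y (a1 y)" "germ X B W2 b2 y = ?q V V' \<otimes>\<^bsub>SB y\<^esub> \<iota> y (a2 y)"
      "germ X B W3 b3 y = ?q U V' \<otimes>\<^bsub>SB y\<^esub> \<iota> y (a3 y)"
      using l y by (auto simp: local_lift_def)
    then have "\<iota> y (germ X A ?N s y) = inv\<^bsub>SB y\<^esub> (?q U V' \<otimes>\<^bsub>SB y\<^esub> \<iota> y (a3 y)) \<otimes>\<^bsub>SB y\<^esub>
       ((?q U V \<otimes>\<^bsub>SB y\<^esub> \<iota> y (a1 y)) \<otimes>\<^bsub>SB y\<^esub> (?q V V' \<otimes>\<^bsub>SB y\<^esub> \<iota> y (a2 y)))"
      using iota_s[OF y] gb[OF y] by simp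
    also have "\<dots> = (inv\<^bsub>SB y\<^esub> ?q U V' \<otimes>\<^bsub>SB y\<^esub> (?q U V \<otimes>\<^bsub>SB y\<^esub> ?q V V')) \<otimes>\<^bsub>SB y\<^esub>
        \<iota> y (inv\<^bsub>SA y\<^esub> a3 y \<otimes>\<^bsub>SA y\<^esub> (a1 y \<otimes>\<^bsub>SA y\<^esub> a2 y))"
      using c bc by (simp only: central_mult central_inv h.G.inv_closed h.G.m_closed h.H.inv_closed h.H.m_closed)
    also have "inv\<^bsub>SB y\<^esub> ?q U V' \<otimes>\<^bsub>SB y\<^esub> (?q U V \<otimes>\<^bsub>SB y\<^esub> ?q V V') = \<one>\<^bsub>SB y\<^esub>"
      using bc by (simp add: h.H.m_assoc h.H.inv_mult_group h.H.cancel_simps)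
    finally have "germ X A ?N s y = inv\<^bsub>SA y\<^esub> a3 y \<otimes>\<^bsub>SA y\<^esub> (a1 y \<otimes>\<^bsub>SA y\<^esub> a2 y)"
      using c by (intro stalk_i_inj[of _ y]) (simp_all del: h.hom_mult)
    then show ?thesis
      using c by (simp add: h.G.cancel_simps)
  qed
  show ?thesis
    using x by (intro A.diff_product[OF W(1-3) a N s rel]) auto
qed

text \<open>The same trick is applied twice: a cocycle of discontinuous sections is the coboundary of its
  values at \<open>(u x, U)\<close>. For \<open>g\<close>, viewed in the stalks of \<open>C\<close>, this gives \<open>\<beta>\<close>; for the cocycle \<open>\<alpha>\<close> formed by
  the differentials \<open>d a\<close>, it gives \<open>\<zeta>\<close>. The \<open>d \<zeta>\<close> agree on intersections because \<open>d d a\<close> vanishes.\<close>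

lemma delta2_data_exists:
  assumes g: "(\<U>, g) \<in> cech_cocycles X C"
  obtains y \<beta> \<zeta> where "delta2_data \<U> g y \<beta> \<zeta>"
proof -
  have cov: "open_cover X \<U>" using g by (simp add: C.cocycle_iff)
  note op = open_cover_openin[OF cov]
  have top: "x \<in> topspace X" if "U \<in> \<U>" "x \<in> U" for U x
    using op[OF that(1)] that openin_subset by blast
  obtain u where u: "\<And>x. x \<in> topspace X \<Longrightarrow> u x \<in> \<U>" "\<And>x. x \<in> topspace X \<Longrightarrow> x \<in> u x"
    using open_cover_choice[OF cov] by metis
  have "\<exists>\<beta>. \<beta> \<in> carrier (SB x) \<and> \<pi> x \<beta> = germ X C (u x \<inter> U) (g (u x) U) x"
    if "U \<in> \<U>" "x \<in> U" for U x
    using stalk_p_surj[OF C.cocycle_closed[OF g u(1) that(1) u(2) that(2)]] top[OF that] by metis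
  then obtain \<beta>0 where \<beta>0: "\<And>U x. U \<in> \<U> \<Longrightarrow> x \<in> U \<Longrightarrow> \<beta>0 U x \<in> carrier (SB x)"
    "\<And>U x. U \<in> \<U> \<Longrightarrow> x \<in> U \<Longrightarrow> \<pi> x (\<beta>0 U x) = germ X C (u x \<inter> U) (g (u x) U) x" by metis
  define \<beta> where "\<beta> U = restrict (\<beta>0 U) U" for U
  have \<beta>: "\<beta> U \<in> disc X B U" if "U \<in> \<U>" for U
    using that \<beta>0 by (auto simp: \<beta>_def)
  have ex: "\<exists>W a b. x \<in> W \<and> local_lift g \<beta> U V W a b" if UV: "U \<in> \<U>" "V \<in> \<U>" "x \<in> U" "x \<in> V" for U V x
  proof (intro local_lift_exists op \<beta> UV)
    show "g U V \<in> \<Gamma> C (U \<inter> V)" using g UV by (simp add: C.cocycle_iff)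
    fix y assume y: "y \<in> U \<inter> V"
    then show "inv\<^bsub>SC y\<^esub> \<pi> y (\<beta> U y) \<otimes>\<^bsub>SC y\<^esub> \<pi> y (\<beta> V y) = germ X C (U \<inter> V) (g U V) y"
      using UV \<beta>0 C.cocycle_diff[OF g u(1) UV(1,2) u(2)] top[OF UV(1)] by (simp add: \<beta>_def)
  qed
  \<comment> \<open>The value does not depend on the local lift, by \<open>local_lift_cocycle\<close>.\<close>
  define \<alpha> where "\<alpha> U V x = (SOME z. \<exists>W a b. x \<in> W \<and> local_lift g \<beta> U V W a b \<and> z = d\<^sub>0 W a x)" for U V x
  have \<alpha>_ex: "\<exists>W a b. x \<in> W \<and> local_lift g \<beta> U V W a b \<and> \<alpha> U V x = d\<^sub>0 W a x"
    if "U \<in> \<U>" "V \<in> \<U>" "x \<in> U" "x \<in> V" for U V x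
    unfolding \<alpha>_def by (rule someI_ex) (use ex[OF that] in blast)
  have closed: "d\<^sub>0 W a x \<in> carrier (SZ x)" if "local_lift g \<beta> U V W a b" "x \<in> W" for U V W a b x
    using A.diff_closed[of W a] that by (auto simp: local_lift_def)
  have \<alpha>_closed: "\<alpha> U V x \<in> carrier (SZ x)" if "U \<in> \<U>" "V \<in> \<U>" "x \<in> U" "x \<in> V" for U V x
    using \<alpha>_ex[OF that] closed by metis
  have \<alpha>_mult: "\<alpha> U V x \<otimes>\<^bsub>SZ x\<^esub> d\<^sub>0 W a x = \<alpha> U V' x"
    if "U \<in> \<U>" "V \<in> \<U>" "V' \<in> \<U>" "x \<in> U" "local_lift g \<beta> V V' W a b" "x \<in> W" for U V V' W a b x
  proof -
    note t = that
    have x: "x \<in> V" "x \<in> V'" using that by (auto simp: local_lift_def)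
    obtain W1 a1 b1 where 1: "x \<in> W1" "local_lift g \<beta> U V W1 a1 b1" "\<alpha> U V x = d\<^sub>0 W1 a1 x"
      using \<alpha>_ex[OF t(1,2,4) x(1)] by blast
    obtain W3 a3 b3 where 3: "x \<in> W3" "local_lift g \<beta> U V' W3 a3 b3" "\<alpha> U V' x = d\<^sub>0 W3 a3 x"
      using \<alpha>_ex[OF t(1,3,4) x(2)] by blast
    show ?thesis
      unfolding 1 3 by (rule local_lift_cocycle[OF g t(1-3) \<beta> 1(2) t(5) 3(2) 1(1) t(6) 3(1)])
  qed
  define \<zeta> where "\<zeta> U = (\<lambda>x\<in>U. \<alpha> (u x) U x)" for U
  have \<zeta>: "\<zeta> U \<in> disc X ZA U" if "U \<in> \<U>" for U
    using that \<alpha>_closed u top[OF that] by (auto simp: \<zeta>_def)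
  have \<zeta>_mult: "\<zeta> U z \<otimes>\<^bsub>SZ z\<^esub> d\<^sub>0 W a z = \<zeta> V z"
    if "U \<in> \<U>" "V \<in> \<U>" "local_lift g \<beta> U V W a b" "z \<in> W" for U V W a b z
  proof -
    have "z \<in> U" "z \<in> V" using that by (auto simp: local_lift_def)
    then show ?thesis
      using that \<alpha>_mult[of "u z" U V z W a b] u top[OF that(1)] by (simp add: \<zeta>_def)
  qed
  have d\<zeta>: "d\<^sub>1 U (\<zeta> U) x = d\<^sub>1 V (\<zeta> V) x" if UV: "U \<in> \<U>" "V \<in> \<U>" "x \<in> U" "x \<in> V" for U V x
  proof -
    obtain W a b where x: "x \<in> W" and l: "local_lift g \<beta> U V W a b" using ex[OF UV] by blast
    then have W: "openin X W" "W \<subseteq> U" "W \<subseteq> V" and a: "a \<in> disc X A W"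
      by (auto simp: local_lift_def)
    have da: "d\<^sub>0 W a \<in> disc X ZA W" by (rule A.diff_closed[OF W(1) a])
    have one: "\<one>\<^bsub>sections ZA W\<^esub> \<in> \<Gamma> ZA W"
      using W by (intro Z.one_closed)
    have "d\<^sub>1 U (\<zeta> U) x \<otimes>\<^bsub>SZZ x\<^esub> d\<^sub>1 W (d\<^sub>0 W a) x = d\<^sub>1 V (\<zeta> V) x"
    proof (rule Z.diff_product[OF op[OF UV(1)] W(1) op[OF UV(2)] \<zeta>[OF UV(1)] da \<zeta>[OF UV(2)] W(1,2) subset_refl W(3) one _ x])
      fix y assume y: "y \<in> W"
      interpret S: group "SZ y" using Z.group_stalk_on[OF W(1) y] .
      have "\<zeta> V y \<in> carrier (SZ y)" using \<zeta>[OF UV(2)] W y by auto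
      then show "\<zeta> U y \<otimes>\<^bsub>SZ y\<^esub> d\<^sub>0 W a y = \<zeta> V y \<otimes>\<^bsub>SZ y\<^esub> germ X ZA W \<one>\<^bsub>sections ZA W\<^esub> y"
        using \<zeta>_mult[OF UV(1,2) l y] Z.germ_one[OF W(1) y] by simp
    qed
    moreover have "d\<^sub>1 W (d\<^sub>0 W a) x = \<one>\<^bsub>SZZ x\<^esub>"
      using A.diff_diff[OF W(1) a] x by simp
    moreover have "d\<^sub>1 U (\<zeta> U) x \<in> carrier (SZZ x)"
      using Z.diff_closed[OF op[OF UV(1)] \<zeta>[OF UV(1)]] UV by auto
    ultimately show ?thesis
      using ZZ.group_stalk[OF top[OF UV(1,3)]] by (metis group.is_monoid monoid.r_one)
  qed
  define y where "y = (\<lambda>x\<in>topspace X. d\<^sub>1 (u x) (\<zeta> (u x)) x)"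
  have "delta2_data \<U> g y \<beta> \<zeta>"
    unfolding delta2_data_def
  proof (intro conjI ballI \<beta> \<zeta>)
    have "d\<^sub>1 (u x) (\<zeta> (u x)) x \<in> carrier (SZZ x)" if "x \<in> topspace X" for x
      using Z.diff_closed[OF op[OF u(1)[OF that]] \<zeta>[OF u(1)[OF that]]] u(2)[OF that] by auto
    then show "y \<in> (\<Pi>\<^sub>E x\<in>topspace X. carrier (SZZ x))"
      by (auto simp: y_def)
    show "d\<^sub>1 U (\<zeta> U) x = y x" if "U \<in> \<U>" "x \<in> U" for U x
      using d\<zeta>[OF that(1) u(1) that(2) u(2)] top[OF that] by (simp add: y_def)
    fix U V x assume UV: "U \<in> \<U>" "V \<in> \<U>" "x \<in> U \<inter> V"
    have xUV: "x \<in> U" "x \<in> V" using UV by auto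
    obtain W a b where x: "x \<in> W" and l: "local_lift g \<beta> U V W a b" using ex[OF UV(1,2) xUV] by blast
    have "d\<^sub>0 W a z = inv\<^bsub>SZ z\<^esub> \<zeta> U z \<otimes>\<^bsub>SZ z\<^esub> \<zeta> V z" if z: "z \<in> W" for z
    proof -
      have zU: "z \<in> U" "z \<in> V" using l z by (auto simp: local_lift_def)
      interpret S: group "SZ z" using Z.group_stalk[OF top[OF UV(1) zU(1)]] .
      have "\<zeta> U z \<in> carrier (SZ z)" using \<zeta>[OF UV(1)] zU by auto
      then show ?thesis
        using \<zeta>_mult[OF UV(1,2) l z] closed[OF l z] by (metis S.cancel_simps(1))
    qed
    then show "\<exists>W a b. x \<in> W \<and> local_lift g \<beta> U V W a b \<and>
        (\<forall>y\<in>W. d\<^sub>0 W a y = inv\<^bsub>SZ y\<^esub> \<zeta> U y \<otimes>\<^bsub>SZ y\<^esub> \<zeta> V y)"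
      using x l by blast
  qed
  then show thesis by (rule that)
qed

text \<open>Near each point \<open>y\<close> is a differential \<open>d \<zeta>\<close>, so \<open>d y\<close> vanishes there.\<close>

lemma delta2_data_cocycle:
  assumes cov: "open_cover X \<U>" and D: "delta2_data \<U> g y \<beta> \<zeta>"
  shows "godement_diff X ZZA (topspace X) y
    = \<one>\<^bsub>H0 X (godement X (godement_quotient X ZZA))\<^esub>"
proof -
  let ?d = "godement_diff X ZZA"
  have y: "y \<in> (\<Pi>\<^sub>E x\<in>topspace X. carrier (SZZ x))" using D by (simp add: delta2_data_def)
  have "?d (topspace X) y x = \<one>\<^bsub>stalk X (godement_quotient X ZZA) x\<^esub>"
    if x: "x \<in> topspace X" for x
  proof -
    obtain U where U: "U \<in> \<U>" "x \<in> U" using cov x by (auto simp: open_cover_def)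
    have o: "openin X U" "U \<subseteq> topspace X" using open_cover_openin[OF cov U(1)] openin_subset by auto
    have z: "\<zeta> U \<in> disc X ZA U" and eq: "\<And>x. x \<in> U \<Longrightarrow> d\<^sub>1 U (\<zeta> U) x = y x"
      using D U by (auto simp: delta2_data_def)
    have "restrict y U = d\<^sub>1 U (\<zeta> U)"
      using Z.diff_closed[OF o(1) z] eq by (auto simp: PiE_iff fun_eq_iff restrict_def extensional_def)
    then have "?d (topspace X) y x = ?d U (d\<^sub>1 U (\<zeta> U)) x"
      using ZZ.diff_restrict[OF openin_topspace o y U(2)] by simp
    then show ?thesis
      using Z.diff_diff[OF o(1) z] U by simp
  qed
  then show ?thesis
    using ZZ.diff_closed[OF openin_topspace y]
    by (auto simp: H0_def PiE_iff fun_eq_iff restrict_def extensional_def)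
qed

end

section \<open>Independence of the choices in degree two\<close>

context central_extension
begin

lemma local_lift_image:
  assumes l: "local_lift g \<beta> U V W a b" and y: "y \<in> W"
    and \<beta>: "\<beta> U y \<in> carrier (SB y)" "\<beta> V y \<in> carrier (SB y)"
  shows "inv\<^bsub>SC y\<^esub> \<pi> y (\<beta> U y) \<otimes>\<^bsub>SC y\<^esub> \<pi> y (\<beta> V y) = germ X C (U \<inter> V) (g U V) y"
proof -
  have top: "y \<in> topspace X" using B.stalk_in_topspace[OF \<beta>(1)] .
  interpret h: group_hom "SB y" "SC y" "\<pi> y" by (rule p.stalk_map_group_hom[OF top])
  have a: "a y \<in> carrier (SA y)" using l y by (auto simp: local_lift_def)
  have "germ X C (U \<inter> V) (g U V) y = \<pi> y (inv\<^bsub>SB y\<^esub> \<beta> U y \<otimes>\<^bsub>SB y\<^esub> \<beta> V y \<otimes>\<^bsub>SB y\<^esub> \<iota> y (a y))"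
    using l y by (auto simp: local_lift_def)
  then show ?thesis
    using \<beta> a stalk_p_i[OF a] by simp
qed

text \<open>Let \<open>e\<close> witness that \<open>g\<close> and \<open>h\<close> are cohomologous. The products \<open>\<beta> e \<beta>'\<^sup>-\<^sup>1\<close> in the stalks of \<open>C\<close>
  do not depend on the member of the cover, so they have a common pointwise lift \<open>\<Lambda>\<close>. Local lifts
  \<open>f\<close> of \<open>e\<close> then satisfy \<open>\<beta> f \<beta>'\<^sup>-\<^sup>1 = \<Lambda> i(\<mu>)\<close>, and \<open>d \<mu>\<close> together with \<open>\<zeta>\<close> and \<open>\<zeta>'\<close> yields the cochain
  whose differential is the difference of the two representatives.\<close>

lemma delta2_data_cohomologous:
  assumes D: "delta2_data \<U> g y \<beta> \<zeta>" and D': "delta2_data \<V> h y' \<beta>' \<zeta>'"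
    and coh: "((\<U>, g), (\<V>, h)) \<in> cech_cohomologous X C"
  obtains \<eta> where "\<eta> \<in> (\<Pi>\<^sub>E x\<in>topspace X. carrier (SZ x))"
    "\<And>x. x \<in> topspace X \<Longrightarrow> d\<^sub>1 (topspace X) \<eta> x \<otimes>\<^bsub>SZZ x\<^esub> y' x = y x"
proof -
  obtain \<W> \<rho> \<tau> e where g: "(\<U>, g) \<in> cech_cocycles X C" and h: "(\<V>, h) \<in> cech_cocycles X C"
    and W: "open_cover X \<W>" "\<rho> \<in> \<W> \<rightarrow> \<U>" "\<tau> \<in> \<W> \<rightarrow> \<V>"
    and We: "\<And>W. W \<in> \<W> \<Longrightarrow> W \<subseteq> \<rho> W \<and> W \<subseteq> \<tau> W \<and> e W \<in> \<Gamma> C W"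
    and eq: "\<And>W W' x. \<lbrakk>W \<in> \<W>; W' \<in> \<W>; x \<in> W \<inter> W'\<rbrakk> \<Longrightarrow>
         germ X C (\<tau> W \<inter> \<tau> W') (h (\<tau> W) (\<tau> W')) x
         = inv\<^bsub>SC x\<^esub> (germ X C W (e W) x)
             \<otimes>\<^bsub>SC x\<^esub> germ X C (\<rho> W \<inter> \<rho> W') (g (\<rho> W) (\<rho> W')) x
             \<otimes>\<^bsub>SC x\<^esub> germ X C W' (e W') x"
    using coh unfolding C.cohomologous_iff by metis
  have covU: "open_cover X \<U>" and covV: "open_cover X \<V>" using g h by (simp_all add: C.cocycle_iff)
  have mem: "\<rho> W \<in> \<U>" "\<tau> W \<in> \<V>" "W \<subseteq> \<rho> W" "W \<subseteq> \<tau> W" "openin X W" "openin X (\<rho> W)" "openin X (\<tau> W)"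
    "e W \<in> \<Gamma> C W"
    if "W \<in> \<W>" for W
    using that W(2,3) We[OF that] open_cover_openin[OF W(1) that] open_cover_openin[OF covU, of "\<rho> W"]
      open_cover_openin[OF covV, of "\<tau> W"] by auto
  have top: "x \<in> topspace X" if "W \<in> \<W>" "x \<in> W" for W x
    using mem(5)[OF that(1)] that openin_subset by blast
  have \<beta>PiE: "\<beta> U \<in> disc X B U" "\<zeta> U \<in> disc X ZA U"
    "\<And>x. x \<in> U \<Longrightarrow> d\<^sub>1 U (\<zeta> U) x = y x" if "U \<in> \<U>" for U
    using D that by (auto simp: delta2_data_def)
  have \<beta>'PiE: "\<beta>' U \<in> disc X B U" "\<zeta>' U \<in> disc X ZA U"
    "\<And>x. x \<in> U \<Longrightarrow> d\<^sub>1 U (\<zeta>' U) x = y' x" if "U \<in> \<V>" for U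
    using D' that by (auto simp: delta2_data_def)
  have \<beta>: "\<beta> (\<rho> W) x \<in> carrier (SB x)" "\<beta>' (\<tau> W) x \<in> carrier (SB x)"
    "\<zeta> (\<rho> W) x \<in> carrier (SZ x)" "\<zeta>' (\<tau> W) x \<in> carrier (SZ x)" if "W \<in> \<W>" "x \<in> W" for W x
    using \<beta>PiE(1,2)[OF mem(1)[OF that(1)]] \<beta>'PiE(1,2)[OF mem(2)[OF that(1)]]
      mem(3,4)[OF that(1)] that(2) by auto
  have lift: "\<exists>N a b. x \<in> N \<and> local_lift g \<beta> (\<rho> W) (\<rho> W') N a b \<and>
        (\<forall>y\<in>N. d\<^sub>0 N a y = inv\<^bsub>SZ y\<^esub> \<zeta> (\<rho> W) y \<otimes>\<^bsub>SZ y\<^esub> \<zeta> (\<rho> W') y)"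
    "\<exists>N a b. x \<in> N \<and> local_lift h \<beta>' (\<tau> W) (\<tau> W') N a b \<and>
        (\<forall>y\<in>N. d\<^sub>0 N a y = inv\<^bsub>SZ y\<^esub> \<zeta>' (\<tau> W) y \<otimes>\<^bsub>SZ y\<^esub> \<zeta>' (\<tau> W') y)"
    if "W \<in> \<W>" "W' \<in> \<W>" "x \<in> W" "x \<in> W'" for W W' x
  proof -
    have x: "x \<in> \<rho> W \<inter> \<rho> W'" "x \<in> \<tau> W \<inter> \<tau> W'"
      using mem(3,4)[OF that(1)] mem(3,4)[OF that(2)] that by auto
    show "\<exists>N a b. x \<in> N \<and> local_lift g \<beta> (\<rho> W) (\<rho> W') N a b \<and>
        (\<forall>y\<in>N. d\<^sub>0 N a y = inv\<^bsub>SZ y\<^esub> \<zeta> (\<rho> W) y \<otimes>\<^bsub>SZ y\<^esub> \<zeta> (\<rho> W') y)"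
      using D mem(1)[OF that(1)] mem(1)[OF that(2)] x(1) unfolding delta2_data_def by simp
    show "\<exists>N a b. x \<in> N \<and> local_lift h \<beta>' (\<tau> W) (\<tau> W') N a b \<and>
        (\<forall>y\<in>N. d\<^sub>0 N a y = inv\<^bsub>SZ y\<^esub> \<zeta>' (\<tau> W) y \<otimes>\<^bsub>SZ y\<^esub> \<zeta>' (\<tau> W') y)"
      using D' mem(2)[OF that(1)] mem(2)[OF that(2)] x(2) unfolding delta2_data_def by simp
  qed
  define \<theta> where "\<theta> W x = \<pi> x (\<beta> (\<rho> W) x) \<otimes>\<^bsub>SC x\<^esub> germ X C W (e W) x
    \<otimes>\<^bsub>SC x\<^esub> inv\<^bsub>SC x\<^esub> \<pi> x (\<beta>' (\<tau> W) x)" for W x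
  have e: "germ X C W (e W) x \<in> carrier (SC x)" if "W \<in> \<W>" "x \<in> W" for W x
    using mem(5,8)[OF that(1)] that(2) by simp
  have \<theta>_closed: "\<theta> W x \<in> carrier (SC x)" if "W \<in> \<W>" "x \<in> W" for W x
  proof -
    interpret h: group_hom "SB x" "SC x" "\<pi> x" by (rule p.stalk_map_group_hom[OF top[OF that]])
    show ?thesis unfolding \<theta>_def using \<beta>(1,2)[OF that] e[OF that] by simp
  qed
  \<comment> \<open>Passing from \<open>W\<close> to \<open>W'\<close> multiplies the three factors of \<open>\<theta>\<close> by \<open>g\<close>, by \<open>g\<^sup>-\<^sup>1\<close> and \<open>h\<close>, and by
    \<open>h\<^sup>-\<^sup>1\<close>, which cancel.\<close>
  have \<theta>_eq: "\<theta> W' x = \<theta> W x" if t: "W \<in> \<W>" "W' \<in> \<W>" "x \<in> W" "x \<in> W'" for W W' x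
  proof -
    interpret h: group_hom "SB x" "SC x" "\<pi> x" by (rule p.stalk_map_group_hom[OF top[OF t(1,3)]])
    let ?u = "\<pi> x (\<beta> (\<rho> W) x)" and ?v = "\<pi> x (\<beta> (\<rho> W') x)"
      and ?u' = "\<pi> x (\<beta>' (\<tau> W) x)" and ?v' = "\<pi> x (\<beta>' (\<tau> W') x)"
      and ?e = "germ X C W (e W) x" and ?e' = "germ X C W' (e W') x"
    have c: "?u \<in> carrier (SC x)" "?v \<in> carrier (SC x)"
      "?u' \<in> carrier (SC x)" "?v' \<in> carrier (SC x)"
      "?e \<in> carrier (SC x)" "?e' \<in> carrier (SC x)"
      using \<beta>(1,2)[OF t(1,3)] \<beta>(1,2)[OF t(2,4)] e[OF t(1,3)] e[OF t(2,4)] by simp_all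
    have G: "germ X C (\<rho> W \<inter> \<rho> W') (g (\<rho> W) (\<rho> W')) x = inv\<^bsub>SC x\<^esub> ?u \<otimes>\<^bsub>SC x\<^esub> ?v"
    proof -
      obtain N a b where "x \<in> N" "local_lift g \<beta> (\<rho> W) (\<rho> W') N a b" using lift(1)[OF t] by blast
      then show ?thesis using local_lift_image \<beta>(1)[OF t(1,3)] \<beta>(1)[OF t(2,4)] by metis
    qed
    have H: "germ X C (\<tau> W \<inter> \<tau> W') (h (\<tau> W) (\<tau> W')) x = inv\<^bsub>SC x\<^esub> ?u' \<otimes>\<^bsub>SC x\<^esub> ?v'"
    proof -
      obtain N a b where "x \<in> N" "local_lift h \<beta>' (\<tau> W) (\<tau> W') N a b" using lift(2)[OF t] by blast
      then show ?thesis using local_lift_image \<beta>(2)[OF t(1,3)] \<beta>(2)[OF t(2,4)] by metis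
    qed
    have "x \<in> W \<inter> W'" using t by blast
    from eq[OF t(1,2) this] have "inv\<^bsub>SC x\<^esub> ?u' \<otimes>\<^bsub>SC x\<^esub> ?v'
       = inv\<^bsub>SC x\<^esub> ?e \<otimes>\<^bsub>SC x\<^esub> (inv\<^bsub>SC x\<^esub> ?u \<otimes>\<^bsub>SC x\<^esub> ?v) \<otimes>\<^bsub>SC x\<^esub> ?e'"
      unfolding G H .
    then have "?u \<otimes>\<^bsub>SC x\<^esub> (?e \<otimes>\<^bsub>SC x\<^esub> ((inv\<^bsub>SC x\<^esub> ?u' \<otimes>\<^bsub>SC x\<^esub> ?v') \<otimes>\<^bsub>SC x\<^esub> inv\<^bsub>SC x\<^esub> ?v'))
      = ?u \<otimes>\<^bsub>SC x\<^esub> (?e \<otimes>\<^bsub>SC x\<^esub> ((inv\<^bsub>SC x\<^esub> ?e \<otimes>\<^bsub>SC x\<^esub>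
          (inv\<^bsub>SC x\<^esub> ?u \<otimes>\<^bsub>SC x\<^esub> ?v) \<otimes>\<^bsub>SC x\<^esub> ?e') \<otimes>\<^bsub>SC x\<^esub> inv\<^bsub>SC x\<^esub> ?v'))"
      by simp
    then show ?thesis
      unfolding \<theta>_def using c by (simp add: h.H.m_assoc h.H.cancel_simps)
  qed
  obtain w where w: "\<And>x. x \<in> topspace X \<Longrightarrow> w x \<in> \<W>" "\<And>x. x \<in> topspace X \<Longrightarrow> x \<in> w x"
    using open_cover_choice[OF W(1)] by metis
  have "\<exists>l. l \<in> carrier (SB x) \<and> \<pi> x l = \<theta> (w x) x" if "x \<in> topspace X" for x
    using stalk_p_surj[OF \<theta>_closed[OF w(1)[OF that] w(2)[OF that]]] by metis
  then obtain \<Lambda> where \<Lambda>0: "\<And>x. x \<in> topspace X \<Longrightarrow> \<Lambda> x \<in> carrier (SB x)"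
    "\<And>x. x \<in> topspace X \<Longrightarrow> \<pi> x (\<Lambda> x) = \<theta> (w x) x" by metis
  have \<Lambda>: "\<Lambda> x \<in> carrier (SB x)" "\<pi> x (\<Lambda> x) = \<theta> W x" if "W \<in> \<W>" "x \<in> W" for W x
    using \<Lambda>0[OF top[OF that]] \<theta>_eq[OF that(1) w(1) that(2) w(2)] top[OF that] by auto
  define comparison where "comparison W N \<mu> f \<longleftrightarrow> openin X N \<and> N \<subseteq> W \<and>
      \<mu> \<in> disc X A N \<and> f \<in> \<Gamma> B N \<and>
      (\<forall>z\<in>N. \<pi> z (germ X B N f z) = germ X C W (e W) z) \<and>
      (\<forall>z\<in>N. germ X B N f z = (inv\<^bsub>SB z\<^esub> \<beta> (\<rho> W) z \<otimes>\<^bsub>SB z\<^esub> \<Lambda> z \<otimes>\<^bsub>SB z\<^esub> \<beta>' (\<tau> W) z)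
         \<otimes>\<^bsub>SB z\<^esub> \<iota> z (\<mu> z))" for W N \<mu> f
  have comparison_ex: "\<exists>N \<mu> f. x \<in> N \<and> comparison W N \<mu> f" if t: "W \<in> \<W>" "x \<in> W" for W x
  proof -
    obtain N f where N: "openin X N" "x \<in> N" "N \<subseteq> W" "f \<in> \<Gamma> B N"
      "p N f = restr C W N (e W)"
      using locally_surjective[OF mem(5,8)[OF t(1)] t(2)] by blast
    have pf: "\<pi> z (germ X B N f z) = germ X C W (e W) z" if "z \<in> N" for z
      using N that C.germ_restr[OF mem(5)[OF t(1)] N(1,3) that mem(8)[OF t(1)]] by (simp add: p.stalk_map_germ)
    have "\<exists>\<alpha>. \<alpha> \<in> carrier (SA z) \<and> germ X B N f z
      = (inv\<^bsub>SB z\<^esub> \<beta> (\<rho> W) z \<otimes>\<^bsub>SB z\<^esub> \<Lambda> z \<otimes>\<^bsub>SB z\<^esub> \<beta>' (\<tau> W) z) \<otimes>\<^bsub>SB z\<^esub> \<iota> z \<alpha>"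
      if z: "z \<in> N" for z
    proof -
      have zW: "z \<in> W" using z N by blast
      interpret h: group_hom "SB z" "SC z" "\<pi> z" by (rule p.stalk_map_group_hom[OF top[OF t(1) zW]])
      have c: "\<beta> (\<rho> W) z \<in> carrier (SB z)" "\<beta>' (\<tau> W) z \<in> carrier (SB z)"
        "\<Lambda> z \<in> carrier (SB z)" "germ X B N f z \<in> carrier (SB z)"
        using \<beta>[OF t(1) zW] \<Lambda>[OF t(1) zW] N z by auto
      let ?q = "inv\<^bsub>SB z\<^esub> \<beta> (\<rho> W) z \<otimes>\<^bsub>SB z\<^esub> \<Lambda> z \<otimes>\<^bsub>SB z\<^esub> \<beta>' (\<tau> W) z"
      have "\<pi> z (inv\<^bsub>SB z\<^esub> ?q \<otimes>\<^bsub>SB z\<^esub> germ X B N f z) = \<one>\<^bsub>SC z\<^esub>"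
        using c e[OF t(1) zW] by (simp add: pf[OF z] \<Lambda>(2)[OF t(1) zW] \<theta>_def h.H.m_assoc h.H.inv_mult_group h.H.cancel_simps)
      then obtain \<alpha> where "\<alpha> \<in> carrier (SA z)" "\<iota> z \<alpha> = inv\<^bsub>SB z\<^esub> ?q \<otimes>\<^bsub>SB z\<^esub> germ X B N f z"
        using stalk_exact[of "inv\<^bsub>SB z\<^esub> ?q \<otimes>\<^bsub>SB z\<^esub> germ X B N f z" z] c by auto
      then show ?thesis
        using c by (intro exI[of _ \<alpha>]) (simp add: h.G.cancel_simps)
    qed
    then obtain \<mu> where "\<And>z. z \<in> N \<Longrightarrow> \<mu> z \<in> carrier (SA z)"
      "\<And>z. z \<in> N \<Longrightarrow> germ X B N f z
        = (inv\<^bsub>SB z\<^esub> \<beta> (\<rho> W) z \<otimes>\<^bsub>SB z\<^esub> \<Lambda> z \<otimes>\<^bsub>SB z\<^esub> \<beta>' (\<tau> W) z) \<otimes>\<^bsub>SB z\<^esub> \<iota> z (\<mu> z)"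
      by metis
    then have "comparison W N (restrict \<mu> N) f"
      unfolding comparison_def using N pf by auto
    then show ?thesis using N by blast
  qed
  have comparison_closed: "d\<^sub>0 N \<mu> x \<in> carrier (SZ x)" if "comparison W N \<mu> f" "x \<in> N" for W N \<mu> f x
    using A.diff_closed[of N \<mu>] that by (auto simp: comparison_def)
  \<comment> \<open>Comparing the lift \<open>b'\<close> of \<open>h\<close> with the lift \<open>f\<^sup>-\<^sup>1 b f'\<close> gives \<open>a \<mu>' = \<mu> a'\<close> up to a section of
    \<open>A\<close>. Applying \<open>d\<close> turns \<open>a\<close> and \<open>a'\<close> into differences of \<open>\<zeta>\<close> and \<open>\<zeta>'\<close>.\<close>
  have independent: "d\<^sub>0 N \<mu> x \<otimes>\<^bsub>SZ x\<^esub> \<zeta> (\<rho> W) x \<otimes>\<^bsub>SZ x\<^esub> inv\<^bsub>SZ x\<^esub> \<zeta>' (\<tau> W) x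
      = d\<^sub>0 N' \<mu>' x \<otimes>\<^bsub>SZ x\<^esub> \<zeta> (\<rho> W') x \<otimes>\<^bsub>SZ x\<^esub> inv\<^bsub>SZ x\<^esub> \<zeta>' (\<tau> W') x"
    if t: "W \<in> \<W>" "W' \<in> \<W>" and k: "comparison W N \<mu> f" "comparison W' N' \<mu>' f'" and x: "x \<in> N" "x \<in> N'"
    for W W' N N' \<mu> \<mu>' f f' x
  proof -
    have N: "openin X N" "openin X N'" "N \<subseteq> W" "N' \<subseteq> W'"
      and \<mu>: "\<mu> \<in> disc X A N" "\<mu>' \<in> disc X A N'"
      and f: "f \<in> \<Gamma> B N" "f' \<in> \<Gamma> B N'"
      using k by (auto simp: comparison_def)
    have xW: "x \<in> W" "x \<in> W'" using x N by auto
    obtain M a b where xM: "x \<in> M" and l: "local_lift g \<beta> (\<rho> W) (\<rho> W') M a b"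
      and da: "d\<^sub>0 M a x = inv\<^bsub>SZ x\<^esub> \<zeta> (\<rho> W) x \<otimes>\<^bsub>SZ x\<^esub> \<zeta> (\<rho> W') x"
      using lift(1)[OF t xW] by blast
    obtain M' a' b' where xM': "x \<in> M'" and l': "local_lift h \<beta>' (\<tau> W) (\<tau> W') M' a' b'"
      and da': "d\<^sub>0 M' a' x = inv\<^bsub>SZ x\<^esub> \<zeta>' (\<tau> W) x \<otimes>\<^bsub>SZ x\<^esub> \<zeta>' (\<tau> W') x"
      using lift(2)[OF t xW] by blast
    have M: "openin X M" "openin X M'" and a: "a \<in> disc X A M"
      "a' \<in> disc X A M'"
      and b: "b \<in> \<Gamma> B M" "b' \<in> \<Gamma> B M'"
      using l l' by (auto simp: local_lift_def)
    let ?N = "N \<inter> N' \<inter> M \<inter> M'"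
    have O: "openin X ?N" "?N \<subseteq> N" "?N \<subseteq> N'" "?N \<subseteq> M" "?N \<subseteq> M'" using N M by auto
    have xN: "x \<in> ?N" using x xM xM' by blast
    have r: "restr B N ?N f \<in> \<Gamma> B ?N" "restr B N' ?N f' \<in> \<Gamma> B ?N"
      "restr B M ?N b \<in> \<Gamma> B ?N" "restr B M' ?N b' \<in> \<Gamma> B ?N"
      using B.restr_closed[OF N(1) O(1,2) f(1)] B.restr_closed[OF N(2) O(1,3) f(2)]
        B.restr_closed[OF M(1) O(1,4) b(1)] B.restr_closed[OF M(2) O(1,5) b(2)] .
    let ?c = "inv\<^bsub>sections B ?N\<^esub> restr B N ?N f \<otimes>\<^bsub>sections B ?N\<^esub> restr B M ?N b \<otimes>\<^bsub>sections B ?N\<^esub> restr B N' ?N f'"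
    have c: "?c \<in> \<Gamma> B ?N"
      by (intro B.mult_closed B.inverse_closed O r)
    have gr: "germ X B ?N (restr B N ?N f) z = germ X B N f z"
      "germ X B ?N (restr B N' ?N f') z = germ X B N' f' z"
      "germ X B ?N (restr B M ?N b) z = germ X B M b z"
      "germ X B ?N (restr B M' ?N b') z = germ X B M' b' z" if "z \<in> ?N" for z
      using B.germ_restr[OF N(1) O(1,2) that f(1)] B.germ_restr[OF N(2) O(1,3) that f(2)]
        B.germ_restr[OF M(1) O(1,4) that b(1)] B.germ_restr[OF M(2) O(1,5) that b(2)] .
    have gc: "germ X B ?N ?c z = inv\<^bsub>SB z\<^esub> germ X B N f z \<otimes>\<^bsub>SB z\<^esub> germ X B M b z \<otimes>\<^bsub>SB z\<^esub> germ X B N' f' z"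
      if z: "z \<in> ?N" for z
      by (simp only: B.germ_mult[OF O(1) z] B.germ_inv[OF O(1) z] r B.inverse_closed[OF O(1)]
          B.mult_closed[OF O(1)] gr[OF z])
    have "\<pi> z (germ X B ?N (restr B M' ?N b') z) = \<pi> z (germ X B ?N ?c z)" if z: "z \<in> ?N" for z
    proof -
      have zW: "z \<in> W" "z \<in> W'" using z N by auto
      interpret h: group_hom "SB z" "SC z" "\<pi> z" by (rule p.stalk_map_group_hom[OF top[OF t(1) zW(1)]])
      have "germ X B N f z \<in> carrier (SB z)" "germ X B N' f' z \<in> carrier (SB z)"
        "germ X B M b z \<in> carrier (SB z)"
        using z N M f b by auto
      moreover have "\<pi> z (germ X B N f z) = germ X C W (e W) z" "\<pi> z (germ X B N' f' z) = germ X C W' (e W') z"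
        using k z unfolding comparison_def by blast+
      moreover have "\<pi> z (germ X B M b z) = germ X C (\<rho> W \<inter> \<rho> W') (g (\<rho> W) (\<rho> W')) z"
        "\<pi> z (germ X B M' b' z) = germ X C (\<tau> W \<inter> \<tau> W') (h (\<tau> W) (\<tau> W')) z"
        using l l' z unfolding local_lift_def by blast+
      ultimately show ?thesis
        using eq[OF t, of z] zW by (simp add: gc[OF z] gr[OF z])
    qed
    then obtain s where s: "s \<in> \<Gamma> A ?N"
      and iota_s: "\<And>z. z \<in> ?N \<Longrightarrow> \<iota> z (germ X A ?N s z)
          = inv\<^bsub>SB z\<^esub> germ X B ?N (restr B M' ?N b') z \<otimes>\<^bsub>SB z\<^esub> germ X B ?N ?c z"
      using section_difference[OF O(1) r(4) c] by blast
    have rel: "a z \<otimes>\<^bsub>SA z\<^esub> \<mu>' z = \<mu> z \<otimes>\<^bsub>SA z\<^esub> a' z \<otimes>\<^bsub>SA z\<^esub> germ X A ?N s z" if z: "z \<in> ?N" for z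
    proof -
      have zW: "z \<in> W" "z \<in> W'" using z N by auto
      interpret h: group_hom "SA z" "SB z" "\<iota> z" by (rule i.stalk_map_group_hom[OF top[OF t(1) zW(1)]])
      have ac: "a z \<in> carrier (SA z)" "a' z \<in> carrier (SA z)" "\<mu> z \<in> carrier (SA z)"
        "\<mu>' z \<in> carrier (SA z)" "germ X A ?N s z \<in> carrier (SA z)"
        using a \<mu> z A.germ_in_stalk[OF O(1) z s] by auto
      have bc: "\<beta> (\<rho> W) z \<in> carrier (SB z)" "\<beta> (\<rho> W') z \<in> carrier (SB z)"
        "\<beta>' (\<tau> W) z \<in> carrier (SB z)" "\<beta>' (\<tau> W') z \<in> carrier (SB z)" "\<Lambda> z \<in> carrier (SB z)"
        using \<beta>[OF t(1) zW(1)] \<beta>[OF t(2) zW(2)] \<Lambda>[OF t(1) zW(1)] by auto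
      let ?n = "inv\<^bsub>SB z\<^esub> \<beta> (\<rho> W) z \<otimes>\<^bsub>SB z\<^esub> \<Lambda> z \<otimes>\<^bsub>SB z\<^esub> \<beta>' (\<tau> W) z"
        and ?n' = "inv\<^bsub>SB z\<^esub> \<beta> (\<rho> W') z \<otimes>\<^bsub>SB z\<^esub> \<Lambda> z \<otimes>\<^bsub>SB z\<^esub> \<beta>' (\<tau> W') z"
        and ?q = "inv\<^bsub>SB z\<^esub> \<beta> (\<rho> W) z \<otimes>\<^bsub>SB z\<^esub> \<beta> (\<rho> W') z"
        and ?q' = "inv\<^bsub>SB z\<^esub> \<beta>' (\<tau> W) z \<otimes>\<^bsub>SB z\<^esub> \<beta>' (\<tau> W') z"
      have "germ X B N f z = ?n \<otimes>\<^bsub>SB z\<^esub> \<iota> z (\<mu> z)" "germ X B N' f' z = ?n' \<otimes>\<^bsub>SB z\<^esub> \<iota> z (\<mu>' z)"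
        using k z by (auto simp: comparison_def)
      moreover have "germ X B M b z = ?q \<otimes>\<^bsub>SB z\<^esub> \<iota> z (a z)" "germ X B M' b' z = ?q' \<otimes>\<^bsub>SB z\<^esub> \<iota> z (a' z)"
        using l l' z by (auto simp: local_lift_def)
      ultimately have "\<iota> z (germ X A ?N s z) = inv\<^bsub>SB z\<^esub> (?q' \<otimes>\<^bsub>SB z\<^esub> \<iota> z (a' z)) \<otimes>\<^bsub>SB z\<^esub>
          (inv\<^bsub>SB z\<^esub> (?n \<otimes>\<^bsub>SB z\<^esub> \<iota> z (\<mu> z)) \<otimes>\<^bsub>SB z\<^esub> (?q \<otimes>\<^bsub>SB z\<^esub> \<iota> z (a z))
            \<otimes>\<^bsub>SB z\<^esub> (?n' \<otimes>\<^bsub>SB z\<^esub> \<iota> z (\<mu>' z)))"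
        using iota_s[OF z] by (simp only: gc[OF z] gr[OF z])
      also have "\<dots> = (inv\<^bsub>SB z\<^esub> ?q' \<otimes>\<^bsub>SB z\<^esub> (inv\<^bsub>SB z\<^esub> ?n \<otimes>\<^bsub>SB z\<^esub> ?q \<otimes>\<^bsub>SB z\<^esub> ?n')) \<otimes>\<^bsub>SB z\<^esub>
          \<iota> z (inv\<^bsub>SA z\<^esub> a' z \<otimes>\<^bsub>SA z\<^esub> (inv\<^bsub>SA z\<^esub> \<mu> z \<otimes>\<^bsub>SA z\<^esub> a z \<otimes>\<^bsub>SA z\<^esub> \<mu>' z))"
        using ac bc by (simp only: central_mult central_inv h.G.inv_closed h.G.m_closed h.H.inv_closed h.H.m_closed)
      also have "inv\<^bsub>SB z\<^esub> ?q' \<otimes>\<^bsub>SB z\<^esub> (inv\<^bsub>SB z\<^esub> ?n \<otimes>\<^bsub>SB z\<^esub> ?q \<otimes>\<^bsub>SB z\<^esub> ?n') = \<one>\<^bsub>SB z\<^esub>"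
        using bc by (simp add: h.H.m_assoc h.H.inv_mult_group h.H.cancel_simps)
      finally have "germ X A ?N s z = inv\<^bsub>SA z\<^esub> a' z \<otimes>\<^bsub>SA z\<^esub>
          (inv\<^bsub>SA z\<^esub> \<mu> z \<otimes>\<^bsub>SA z\<^esub> a z \<otimes>\<^bsub>SA z\<^esub> \<mu>' z)"
        using ac by (intro stalk_i_inj[of _ z]) (simp_all del: h.hom_mult)
      then show ?thesis
        using ac by (simp add: h.G.m_assoc h.G.cancel_simps)
    qed
    have "d\<^sub>0 M a x \<otimes>\<^bsub>SZ x\<^esub> d\<^sub>0 N' \<mu>' x = d\<^sub>0 N \<mu> x \<otimes>\<^bsub>SZ x\<^esub> d\<^sub>0 M' a' x"
      by (rule A.diff_relation[OF M(1) N(2,1) M(2) a(1) \<mu>(2,1) a(2) O(1,4,3,2,5) s rel xN])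
    then show ?thesis
      unfolding da da'
      using comparison_closed[OF k(1) x(1)] comparison_closed[OF k(2) x(2)]
        \<beta>(3,4)[OF t(1) xW(1)] \<beta>(3,4)[OF t(2) xW(2)]
      by (intro comm_group.difference_exchange[OF Z.comm_stalk[OF top[OF t(1) xW(1)]]])
  qed
  define \<eta>0 where "\<eta>0 x = (SOME v. \<exists>W N \<mu> f. W \<in> \<W> \<and> x \<in> N \<and> comparison W N \<mu> f \<and>
      v = d\<^sub>0 N \<mu> x \<otimes>\<^bsub>SZ x\<^esub> \<zeta> (\<rho> W) x \<otimes>\<^bsub>SZ x\<^esub> inv\<^bsub>SZ x\<^esub> \<zeta>' (\<tau> W) x)" for x
  have \<eta>0: "\<eta>0 x = d\<^sub>0 N \<mu> x \<otimes>\<^bsub>SZ x\<^esub> \<zeta> (\<rho> W) x \<otimes>\<^bsub>SZ x\<^esub> inv\<^bsub>SZ x\<^esub> \<zeta>' (\<tau> W) x"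
    if t: "W \<in> \<W>" "x \<in> N" "comparison W N \<mu> f" for W N \<mu> f x
  proof -
    have "\<exists>v W N \<mu> f. W \<in> \<W> \<and> x \<in> N \<and> comparison W N \<mu> f \<and>
      v = d\<^sub>0 N \<mu> x \<otimes>\<^bsub>SZ x\<^esub> \<zeta> (\<rho> W) x \<otimes>\<^bsub>SZ x\<^esub> inv\<^bsub>SZ x\<^esub> \<zeta>' (\<tau> W) x" using t by blast
    from someI_ex[OF this] obtain W' N' \<mu>' f' where "W' \<in> \<W>" "x \<in> N'" "comparison W' N' \<mu>' f'"
      "\<eta>0 x = d\<^sub>0 N' \<mu>' x \<otimes>\<^bsub>SZ x\<^esub> \<zeta> (\<rho> W') x \<otimes>\<^bsub>SZ x\<^esub> inv\<^bsub>SZ x\<^esub> \<zeta>' (\<tau> W') x"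
      unfolding \<eta>0_def by blast
    then show ?thesis using independent[OF _ t(1) _ t(3) _ t(2)] by simp
  qed
  define \<eta> where "\<eta> = restrict \<eta>0 (topspace X)"
  have \<eta>_closed: "\<eta>0 x \<in> carrier (SZ x)" if x: "x \<in> topspace X" for x
  proof -
    obtain N \<mu> f where N: "x \<in> N" "comparison (w x) N \<mu> f" using comparison_ex[OF w(1)[OF x] w(2)[OF x]] by blast
    interpret S: group "SZ x" using Z.group_stalk[OF x] .
    show ?thesis
      unfolding \<eta>0[OF w(1)[OF x] N] using comparison_closed[OF N(2,1)] \<beta>(3,4)[OF w(1)[OF x] w(2)[OF x]] by simp
  qed
  have \<eta>: "\<eta> \<in> (\<Pi>\<^sub>E x\<in>topspace X. carrier (SZ x))" using \<eta>_closed by (auto simp: \<eta>_def)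
  have "d\<^sub>1 (topspace X) \<eta> x \<otimes>\<^bsub>SZZ x\<^esub> y' x = y x" if x: "x \<in> topspace X" for x
  proof -
    interpret S: group "SZZ x" using ZZ.group_stalk[OF x] .
    let ?W = "w x"
    note m = mem[OF w(1)[OF x]]
    obtain N \<mu> f where xN: "x \<in> N" and k: "comparison ?W N \<mu> f" using comparison_ex[OF w(1)[OF x] w(2)[OF x]] by blast
    then have N: "openin X N" "N \<subseteq> ?W" and \<mu>: "\<mu> \<in> disc X A N"
      by (auto simp: comparison_def)
    have sub: "N \<subseteq> topspace X" "N \<subseteq> \<tau> ?W" "N \<subseteq> \<rho> ?W" using openin_subset[OF N(1)] N(2) m(3,4) by auto
    have one: "\<one>\<^bsub>sections ZA N\<^esub> \<in> \<Gamma> ZA N"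
      using N by (intro Z.one_closed)
    have "d\<^sub>1 (topspace X) \<eta> x \<otimes>\<^bsub>SZZ x\<^esub> d\<^sub>1 (\<tau> ?W) (\<zeta>' (\<tau> ?W)) x
        = d\<^sub>1 N (d\<^sub>0 N \<mu>) x \<otimes>\<^bsub>SZZ x\<^esub> d\<^sub>1 (\<rho> ?W) (\<zeta> (\<rho> ?W)) x"
    proof (rule Z.diff_relation[OF openin_topspace m(7) N(1) m(6) \<eta> \<beta>'PiE(2)[OF m(2)] A.diff_closed[OF N(1) \<mu>]
          \<beta>PiE(2)[OF m(1)] N(1) sub(1,2) subset_refl sub(3) one _ xN])
      fix z assume z: "z \<in> N"
      then have zW: "z \<in> ?W" using N by blast
      interpret S: group "SZ z" using Z.group_stalk[OF top[OF w(1)[OF x] zW]] .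
      show "\<eta> z \<otimes>\<^bsub>SZ z\<^esub> \<zeta>' (\<tau> ?W) z = d\<^sub>0 N \<mu> z \<otimes>\<^bsub>SZ z\<^esub> \<zeta> (\<rho> ?W) z \<otimes>\<^bsub>SZ z\<^esub>
          germ X ZA N \<one>\<^bsub>sections ZA N\<^esub> z"
        using \<eta>0[OF w(1)[OF x] z k] comparison_closed[OF k z] \<beta>(3,4)[OF w(1)[OF x] zW] z sub(1)
        by (auto simp: \<eta>_def Z.germ_one[OF N(1) z] S.m_assoc)
    qed
    moreover have "d\<^sub>1 N (d\<^sub>0 N \<mu>) x = \<one>\<^bsub>SZZ x\<^esub>"
      using A.diff_diff[OF N(1) \<mu>] xN by simp
    moreover have "d\<^sub>1 (\<rho> ?W) (\<zeta> (\<rho> ?W)) x = y x" "d\<^sub>1 (\<tau> ?W) (\<zeta>' (\<tau> ?W)) x = y' x"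
      using \<beta>PiE(3)[OF m(1)] \<beta>'PiE(3)[OF m(2)] m(3,4) w(2)[OF x] by auto
    moreover have "y x \<in> carrier (SZZ x)" using D x by (auto simp: delta2_data_def)
    ultimately show ?thesis by simp
  qed
  with \<eta> show thesis by (rule that)
qed

lemma delta2_class:
  assumes g: "(\<U>, g) \<in> cech_cocycles X C" and D: "delta2_data \<U> g y \<beta> \<zeta>"
  shows "delta2 X A B C i p (cech_cohomologous X C `` {(\<U>, g)})
    = A.coboundaries2 #>\<^bsub>H0 X (godement X ZZA)\<^esub> y"
proof -
  let ?C2 = "H0 X (godement X ZZA)"
  interpret G: presheaf_of_groups X "godement X ZZA"
    by (rule ZZ.godement_presheaf)
  interpret C2: group ?C2 unfolding H0_def by (rule G.group_sections[OF openin_topspace])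
  have sub: "subgroup A.coboundaries2 ?C2" by (rule A.coboundaries2_subgroup)
  have y: "y \<in> carrier ?C2" using D by (simp add: delta2_data_def H0_def)
  have same: "A.coboundaries2 #>\<^bsub>?C2\<^esub> y' = A.coboundaries2 #>\<^bsub>?C2\<^esub> y"
    if k: "(\<V>, h) \<in> cech_cohomologous X C `` {(\<U>, g)}" and r: "delta2_rep X A B C i p \<V> h y'" for \<V> h y'
  proof -
    have coh: "((\<U>, g), (\<V>, h)) \<in> cech_cohomologous X C" using k by simp
    then have "(\<V>, h) \<in> cech_cocycles X C" by (simp add: C.cohomologous_iff)
    then obtain \<beta>' \<zeta>' where D': "delta2_data \<V> h y' \<beta>' \<zeta>'"
      using r delta2_rep_iff by blast
    obtain \<eta> where \<eta>: "\<eta> \<in> (\<Pi>\<^sub>E x\<in>topspace X. carrier (SZ x))"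
      "\<And>x. x \<in> topspace X \<Longrightarrow> d\<^sub>1 (topspace X) \<eta> x \<otimes>\<^bsub>SZZ x\<^esub> y' x = y x"
      using delta2_data_cohomologous[OF D D' coh] by blast
    have y': "y' \<in> carrier ?C2" using D' by (simp add: delta2_data_def H0_def)
    have "d\<^sub>1 (topspace X) \<eta> \<otimes>\<^bsub>?C2\<^esub> y' = y"
      using \<eta>(2) D by (auto simp: H0_def delta2_data_def PiE_iff extensional_def fun_eq_iff restrict_def)
    moreover have "d\<^sub>1 (topspace X) \<eta> \<in> A.coboundaries2"
      using \<eta>(1) by (auto simp: A.coboundaries2_def H0_def)
    ultimately have "y \<in> A.coboundaries2 #>\<^bsub>?C2\<^esub> y'"
      unfolding r_coset_def by blast
    then show ?thesis using C2.repr_independence[OF _ y' sub] by blast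
  qed
  have "(\<U>, g) \<in> cech_cohomologous X C `` {(\<U>, g)}"
    using g equiv_class_self[OF C.cohomologous_equiv] by blast
  moreover have "delta2_rep X A B C i p \<U> g y" using D delta2_rep_iff[OF g] by blast
  ultimately have "{A.coboundaries2 #>\<^bsub>?C2\<^esub> y' | y' \<V> h.
      (\<V>, h) \<in> cech_cohomologous X C `` {(\<U>, g)} \<and> delta2_rep X A B C i p \<V> h y'} = {A.coboundaries2 #>\<^bsub>?C2\<^esub> y}"
    using same by (intro subset_antisym subsetI) blast+
  then show ?thesis
    unfolding delta2_def Let_def A.coboundaries2_def by simp
qed

lemma delta2_in_H2:
  assumes "c \<in> H1 X C"
  shows "delta2 X A B C i p c \<in> carrier (H2 X A)"
proof -
  obtain \<U> g where g: "(\<U>, g) \<in> cech_cocycles X C" "c = cech_cohomologous X C `` {(\<U>, g)}"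
    using assms C.H1_cases by metis
  obtain y \<beta> \<zeta> where D: "delta2_data \<U> g y \<beta> \<zeta>" using delta2_data_exists[OF g(1)] by metis
  have "open_cover X \<U>" using g by (simp add: C.cocycle_iff)
  then show ?thesis
    unfolding g(2) delta2_class[OF g(1) D] using D
    by (intro A.H2_coset_closed delta2_data_cocycle[OF _ D]) (simp_all add: delta2_data_def H0_def)
qed

text \<open>The lifted cocycle \<open>k\<close> supplies all choices: its values at \<open>(u x, U)\<close> form \<open>\<beta>\<close>, and then
  \<open>k U V = (\<beta> U)\<^sup>-\<^sup>1 (\<beta> V)\<close> holds exactly, so that \<open>a\<close>, \<open>\<zeta>\<close> and \<open>y\<close> can be taken trivial.\<close>

lemma delta2_trivial_if_cocycle_lifts:
  assumes g: "(\<U>, g) \<in> cech_cocycles X C" and k: "(\<U>, k) \<in> cech_cocycles X B"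
    and pk: "\<And>U V. \<lbrakk>U \<in> \<U>; V \<in> \<U>\<rbrakk> \<Longrightarrow> p (U \<inter> V) (k U V) = g U V"
  shows "delta2 X A B C i p (cech_cohomologous X C `` {(\<U>, g)}) = \<one>\<^bsub>H2 X A\<^esub>"
proof -
  have cov: "open_cover X \<U>" using k by (simp add: B.cocycle_iff)
  note op = open_cover_openin[OF cov]
  have top: "x \<in> topspace X" if "U \<in> \<U>" "x \<in> U" for U x
    using op[OF that(1)] that openin_subset by blast
  obtain u where u: "\<And>x. x \<in> topspace X \<Longrightarrow> u x \<in> \<U>" "\<And>x. x \<in> topspace X \<Longrightarrow> x \<in> u x"
    using open_cover_choice[OF cov] by metis
  define \<beta> where "\<beta> U = (\<lambda>x\<in>U. germ X B (u x \<inter> U) (k (u x) U) x)" for U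
  define \<zeta> where "\<zeta> U = (\<lambda>x\<in>U. \<one>\<^bsub>SZ x\<^esub>)" for U :: "'a set"
  define y where "y = (\<lambda>x\<in>topspace X. \<one>\<^bsub>SZZ x\<^esub>)"
  have D: "delta2_data \<U> g y \<beta> \<zeta>"
    unfolding delta2_data_def
  proof (intro conjI ballI)
    show "y \<in> (\<Pi>\<^sub>E x\<in>topspace X. carrier (SZZ x))"
      using ZZ.group_stalk by (auto simp: y_def intro!: monoid.one_closed group.is_monoid)
    show "\<beta> U \<in> disc X B U" if "U \<in> \<U>" for U
      using B.cocycle_closed[OF k u(1) that u(2)] top[OF that] by (auto simp: \<beta>_def)
    show "\<zeta> U \<in> disc X ZA U" if "U \<in> \<U>" for U
      using Z.group_stalk top[OF that] by (auto simp: \<zeta>_def intro!: monoid.one_closed group.is_monoid)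
    show "d\<^sub>1 U (\<zeta> U) x = y x" if "U \<in> \<U>" "x \<in> U" for U x
      using Z.diff_one[OF op[OF that(1)]] that top[OF that] by (simp add: \<zeta>_def y_def)
    fix U V x assume UV: "U \<in> \<U>" "V \<in> \<U>" "x \<in> U \<inter> V"
    have o: "openin X (U \<inter> V)" using op UV by blast
    have kUV: "k U V \<in> \<Gamma> B (U \<inter> V)" using k UV by (simp add: B.cocycle_iff)
    define a where "a = (\<lambda>x\<in>U \<inter> V. \<one>\<^bsub>SA x\<^esub>)"
    have "local_lift g \<beta> U V (U \<inter> V) a (k U V)"
      unfolding local_lift_def
    proof (intro conjI ballI o subset_refl kUV)
      show "a \<in> (\<Pi>\<^sub>E x\<in>U \<inter> V. carrier (SA x))"
        using A.group_stalk top[OF UV(1)] by (auto simp: a_def intro!: monoid.one_closed group.is_monoid)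
      fix z assume z: "z \<in> U \<inter> V"
      show "\<pi> z (germ X B (U \<inter> V) (k U V) z) = germ X C (U \<inter> V) (g U V) z"
        using p.stalk_map_germ[OF o z kUV] pk UV by simp
      have zt: "z \<in> topspace X" using top UV z by blast
      interpret h: group_hom "SA z" "SB z" "\<iota> z" by (rule i.stalk_map_group_hom[OF zt])
      show "germ X B (U \<inter> V) (k U V) z = inv\<^bsub>SB z\<^esub> \<beta> U z \<otimes>\<^bsub>SB z\<^esub> \<beta> V z \<otimes>\<^bsub>SB z\<^esub> \<iota> z (a z)"
        using B.cocycle_diff[OF k u(1)[OF zt] UV(1,2) u(2)[OF zt]] B.cocycle_closed[OF k UV(1,2)] z
        by (simp add: \<beta>_def a_def)
    qed
    moreover have "d\<^sub>0 (U \<inter> V) a z = inv\<^bsub>SZ z\<^esub> \<zeta> U z \<otimes>\<^bsub>SZ z\<^esub> \<zeta> V z" if z: "z \<in> U \<inter> V" for z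
    proof -
      interpret S: group "SZ z" using Z.group_stalk_on[OF o z] .
      show ?thesis using A.diff_one[OF o] z by (simp add: a_def \<zeta>_def)
    qed
    ultimately show "\<exists>W a b. x \<in> W \<and> local_lift g \<beta> U V W a b \<and>
        (\<forall>y\<in>W. d\<^sub>0 W a y = inv\<^bsub>SZ y\<^esub> \<zeta> U y \<otimes>\<^bsub>SZ y\<^esub> \<zeta> V y)"
      using UV(3) by blast
  qed
  interpret G: presheaf_of_groups X "godement X ZZA"
    by (rule ZZ.godement_presheaf)
  have "group (H0 X (godement X ZZA))"
    unfolding H0_def by (rule G.group_sections[OF openin_topspace])
  moreover have "y = \<one>\<^bsub>H0 X (godement X ZZA)\<^esub>"
    by (simp add: y_def H0_def)
  ultimately show ?thesis
    unfolding delta2_class[OF g D] A.H2_one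
    using group.coset_mult_one[of _ A.coboundaries2] subgroup.subset[OF A.coboundaries2_subgroup] by metis
qed

end

section \<open>Quotients of a normal series\<close>

text \<open>Injectivity makes local preimages unique, hence they glue. This reduces exactness of a sequence of
  sheafified quotients to a local question.\<close>

lemma (in sheaf_morphism) locally_in_image:
  assumes inj: "\<And>U a. \<lbrakk>openin X U; a \<in> \<Gamma> F U; \<phi> U a = \<one>\<^bsub>sections F' U\<^esub>\<rbrakk> \<Longrightarrow> a = \<one>\<^bsub>sections F U\<^esub>"
    and U: "openin X U" and b: "b \<in> \<Gamma> F' U"
    and loc: "\<And>x. x \<in> U \<Longrightarrow> \<exists>V a. openin X V \<and> x \<in> V \<and> V \<subseteq> U \<and> a \<in> \<Gamma> F V \<and> \<phi> V a = restr F' U V b"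
  shows "\<exists>a\<in>\<Gamma> F U. \<phi> U a = b"
proof -
  have eqI: "a = a'" if V: "openin X V" and a: "a \<in> \<Gamma> F V" "a' \<in> \<Gamma> F V"
    and eq: "\<phi> V a = \<phi> V a'" for V a a'
  proof -
    interpret S: group "sections F V" using V by (rule dom.group_sections)
    interpret S': group "sections F' V" using V by (rule cod.group_sections)
    have "\<phi> V (a \<otimes>\<^bsub>sections F V\<^esub> inv\<^bsub>sections F V\<^esub> a') = \<one>\<^bsub>sections F' V\<^esub>"
      using V a eq by (simp add: map_mult map_inv)
    then have "a \<otimes>\<^bsub>sections F V\<^esub> inv\<^bsub>sections F V\<^esub> a' = \<one>\<^bsub>sections F V\<^esub>"
      using V a by (intro inj) auto
    then show ?thesis using a S.inv_equality[of a "inv\<^bsub>sections F V\<^esub> a'"] by simp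
  qed
  define \<U> where "\<U> = {V. openin X V \<and> V \<subseteq> U \<and> (\<exists>a \<in> \<Gamma> F V. \<phi> V a = restr F' U V b)}"
  have "x \<in> \<Union>\<U>" if "x \<in> U" for x using loc[OF that] unfolding \<U>_def by blast
  moreover have "\<Union>\<U> \<subseteq> U" unfolding \<U>_def by blast
  ultimately have un: "\<Union>\<U> = U" by (intro subset_antisym subsetI) blast+
  have "\<forall>V\<in>\<U>. \<exists>a. a \<in> \<Gamma> F V \<and> \<phi> V a = restr F' U V b" unfolding \<U>_def by blast
  then obtain a where a: "\<And>V. V \<in> \<U> \<Longrightarrow> a V \<in> \<Gamma> F V" "\<And>V. V \<in> \<U> \<Longrightarrow> \<phi> V (a V) = restr F' U V b"
    by metis
  have op: "openin X V" "V \<subseteq> U" if "V \<in> \<U>" for V using that by (auto simp: \<U>_def)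
  have compat: "restr F V (V \<inter> W) (a V) = restr F W (V \<inter> W) (a W)" if "V \<in> \<U>" "W \<in> \<U>" for V W
  proof (rule eqI)
    show o: "openin X (V \<inter> W)" using op that by blast
    show "restr F V (V \<inter> W) (a V) \<in> \<Gamma> F (V \<inter> W)" "restr F W (V \<inter> W) (a W) \<in> \<Gamma> F (V \<inter> W)"
      using o op a that by auto
    show "\<phi> (V \<inter> W) (restr F V (V \<inter> W) (a V)) = \<phi> (V \<inter> W) (restr F W (V \<inter> W) (a W))"
      using o op a that U b by (simp add: natural [symmetric] cod.restr_comp)
  qed
  have "\<exists>s\<in>\<Gamma> F (\<Union>\<U>). \<forall>V\<in>\<U>. restr F (\<Union>\<U>) V s = a V"
    by (rule dom.gluing[OF op(1) a(1) compat])
  then obtain s where s: "s \<in> \<Gamma> F U" "\<And>V. V \<in> \<U> \<Longrightarrow> restr F U V s = a V"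
    unfolding un by blast
  have "\<phi> U s = b"
  proof (rule cod.locality[of \<U>, unfolded un])
    show "restr F' U V (\<phi> U s) = restr F' U V b" if "V \<in> \<U>" for V
      using that U op[OF that] s a by (simp add: natural)
  qed (use op U s b in auto)
  then show ?thesis using s by blast
qed

locale normal_series =
  fixes X :: "'a topology" and G :: "('a, 'g) presheaf" and H :: "nat \<Rightarrow> 'a set \<Rightarrow> 'g set"
  assumes series: "AQ_normal_series X G H"
begin

sublocale G: sheaf_of_groups X G
  using series by (simp add: AQ_normal_series_def)

abbreviation HS where "HS k \<equiv> subpresheaf G (H k)"
abbreviation HQ where "HQ k m \<equiv> quotient_presheaf (HS k) (H m)"
abbreviation SQ where "SQ k m \<equiv> series_quotient X G H k m"

abbreviation smap where "smap \<equiv> series_map X G H"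
abbreviation \<A> where "\<A> \<equiv> AQ X G H"

lemma HS_sheaf: "sheaf_of_groups X (HS k)"
  using series by (simp add: AQ_normal_series_def normal_subsheaf_def)

lemma HS_presheaf: "presheaf_of_groups X (HS k)"
  using HS_sheaf by (simp add: sheaf_of_groups_def)

lemma H_normal: "openin X U \<Longrightarrow> H k U \<lhd> sections G U"
  using series by (simp add: AQ_normal_series_def normal_subsheaf_def)

lemma H_subgroup: "openin X U \<Longrightarrow> subgroup (H k U) (sections G U)"
  by (rule normal_imp_subgroup[OF H_normal])

lemma H_carrier: "\<lbrakk>openin X U; s \<in> H k U\<rbrakk> \<Longrightarrow> s \<in> \<Gamma> G U"
  using H_subgroup subgroup.mem_carrier by metis

lemma H_antimono:
  assumes "k \<le> m" "openin X U"
  shows "H m U \<subseteq> H k U"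
proof (rule lift_Suc_antimono_le[of "\<lambda>j. H j U", OF _ assms(1)])
  show "H (Suc j) U \<subseteq> H j U" for j using series assms(2) by (simp add: AQ_normal_series_def)
qed

lemma H_restr: "\<lbrakk>openin X U; openin X V; V \<subseteq> U; s \<in> H k U\<rbrakk> \<Longrightarrow> restr G U V s \<in> H k V"
  using presheaf_of_groups.restr_closed[OF HS_presheaf, of U V s k] by simp

lemma HS_inv:
  assumes "openin X U" "s \<in> H k U"
  shows "inv\<^bsub>sections (HS k) U\<^esub> s = inv\<^bsub>sections G U\<^esub> s"
  using group.m_inv_consistent[OF G.group_sections[OF assms(1)] H_subgroup[OF assms(1)] assms(2)] by simp

lemma HS_normal:
  assumes "k \<le> m"
  shows "normal_subpresheaf X (HS k) (H m)"
proof (intro normal_subpresheaf.intro HS_presheaf normal_subpresheaf_axioms.intro)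
  show "H m U \<lhd> sections (HS k) U" if "openin X U" for U
    using group.normal_restrict_supergroup[OF G.group_sections[OF that] H_subgroup[OF that]
        H_normal[OF that] H_antimono[OF assms that]] by simp
  show "restr (HS k) U V s \<in> H m V" if "openin X U" "openin X V" "V \<subseteq> U" "s \<in> H m U" for U V s
    using that by (simp add: H_restr)
qed

lemma HS_inclusion:
  assumes "k \<le> l"
  shows "presheaf_morphism X (HS l) (HS k) (\<lambda>U s. s)"
proof (intro presheaf_morphism.intro HS_presheaf presheaf_morphism_axioms.intro)
  show "(\<lambda>s. s) \<in> hom (sections (HS l) U) (sections (HS k) U)" if "openin X U" for U
    using H_antimono[OF assms that] by (intro homI) auto
qed simp

text \<open>Every section of \<open>H\<^sub>k / H\<^sub>m\<close> is locally of this form, and the natural maps between the quotients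
  act on it by changing the indices; hence statements about the quotients are checked on it.\<close>

definition cls where
  "cls k m U h = germs X (HQ k m) U (H m U #>\<^bsub>sections G U\<^esub> h)"

lemma SQ_eq: "SQ k m = sheafify X (HQ k m)"
  by (simp add: series_quotient_def quotient_sheaf_def)

lemma quotient_presheaf_HS: "k \<le> m \<Longrightarrow> presheaf_of_groups X (HQ k m)"
  by (rule normal_subpresheaf.quotient_presheaf_presheaf[OF HS_normal])

lemma SQ_sheaf: "k \<le> m \<Longrightarrow> sheaf_of_groups X (SQ k m)"
  unfolding SQ_eq by (rule presheaf_of_groups.sheafify_sheaf[OF quotient_presheaf_HS])

lemma coset_HS [simp]: "N #>\<^bsub>sections (HS k) U\<^esub> h = N #>\<^bsub>sections G U\<^esub> h"
  by (simp add: r_coset_def)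

lemma cls_morphism:
  assumes "k \<le> m" "k \<le> l"
  shows "presheaf_morphism X (HS l) (SQ k m) (cls k m)"
proof -
  have "presheaf_morphism X (HS k) (SQ k m)
      (\<lambda>U h. germs X (HQ k m) U (H m U #>\<^bsub>sections (HS k) U\<^esub> h))"
    unfolding SQ_eq
    by (rule presheaf_morphism_comp[OF normal_subpresheaf.coset_morphism[OF HS_normal[OF assms(1)]]
          presheaf_of_groups.germs_morphism[OF quotient_presheaf_HS[OF assms(1)]]])
  moreover have "(\<lambda>U h. germs X (HQ k m) U (H m U #>\<^bsub>sections (HS k) U\<^esub> h)) = cls k m"
    by (intro ext) (simp only: cls_def coset_HS)
  ultimately show ?thesis
    using presheaf_morphism_comp[OF HS_inclusion[OF assms(2)]] by metis
qed

lemma cls_locally: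
  assumes "k \<le> m" "\<sigma> \<in> \<Gamma> (SQ k m) U" "x \<in> U"
  obtains V h where "openin X V" "x \<in> V" "V \<subseteq> U" "h \<in> H k V" "restr (SQ k m) U V \<sigma> = cls k m V h"
proof -
  interpret N: normal_subpresheaf X "HS k" "H m" by (rule HS_normal[OF assms(1)])
  interpret Q: presheaf_of_groups X "HQ k m" by (rule quotient_presheaf_HS[OF assms(1)])
  obtain V K where V: "openin X V" "x \<in> V" "V \<subseteq> U" "K \<in> \<Gamma> (HQ k m) V"
    "\<And>y. y \<in> V \<Longrightarrow> \<sigma> y = germ X (HQ k m) V K y"
    using Q.sheafify_cases assms(2,3) unfolding SQ_eq by metis
  have "K \<in> carrier (sections (HS k) V Mod H m V)" using V(4) by (simp only: N.quotient_sections)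
  then obtain h where h: "h \<in> \<Gamma> (HS k) V" "K = H m V #>\<^bsub>sections (HS k) V\<^esub> h"
    by (rule N.quotient_cases)
  have "restr (SQ k m) U V \<sigma> = cls k m V h"
    using V(5) h(2) unfolding SQ_eq cls_def Q.sheafify_simps Q.restrict_eq_germs_iff by simp
  then show thesis using that V h by simp
qed

text \<open>If the class of \<open>h\<close> is trivial, then \<open>h\<close> lies in \<open>H\<^sub>m\<close> near each point. It lies in \<open>H\<^sub>m\<close> over \<open>U\<close>
  because \<open>H\<^sub>m\<close> is itself a sheaf, so that the local restrictions of \<open>h\<close> glue in \<open>H\<^sub>m\<close>.\<close>

lemma cls_one_iff:
  assumes km: "k \<le> m" and U: "openin X U" and h: "h \<in> H k U"
  shows "cls k m U h = \<one>\<^bsub>sections (SQ k m) U\<^esub> \<longleftrightarrow> h \<in> H m U"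
proof -
  interpret N: normal_subpresheaf X "HS k" "H m" by (rule HS_normal[OF km])
  interpret Q: presheaf_of_groups X "HQ k m" by (rule quotient_presheaf_HS[OF km])
  interpret c: presheaf_morphism X "HS k" "HQ k m" "\<lambda>U s. H m U #>\<^bsub>sections (HS k) U\<^esub> s"
    by (rule N.coset_morphism)
  interpret g: presheaf_morphism X "HQ k m" "SQ k m" "germs X (HQ k m)"
    unfolding SQ_eq by (rule Q.germs_morphism)
  interpret S: sheaf_of_groups X "HS m" by (rule HS_sheaf)
  have one_iff: "H m V #>\<^bsub>sections (HS k) V\<^esub> s = \<one>\<^bsub>sections (HQ k m) V\<^esub> \<longleftrightarrow> s \<in> H m V"
    if "openin X V" "s \<in> H k V" for V s
    using N.coset_eq_one_iff[OF that(1), of s] that by simp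
  have hc: "h \<in> \<Gamma> (HS k) U" using h by simp
  show ?thesis
  proof
    assume "h \<in> H m U"
    then have "H m U #>\<^bsub>sections (HS k) U\<^esub> h = \<one>\<^bsub>sections (HQ k m) U\<^esub>"
      using one_iff U h by blast
    then show "cls k m U h = \<one>\<^bsub>sections (SQ k m) U\<^esub>"
      unfolding cls_def using g.map_one[OF U] by (simp only: coset_HS)
  next
    assume one: "cls k m U h = \<one>\<^bsub>sections (SQ k m) U\<^esub>"
    have eq: "germs X (HQ k m) U (H m U #>\<^bsub>sections (HS k) U\<^esub> h)
        = germs X (HQ k m) U \<one>\<^bsub>sections (HQ k m) U\<^esub>"
      using one g.map_one[OF U] by (simp only: cls_def coset_HS)
    have loc: "\<exists>W. openin X W \<and> x \<in> W \<and> W \<subseteq> U \<and> restr G U W h \<in> H m W" if x: "x \<in> U" for x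
    proof -
      have "germ X (HQ k m) U (H m U #>\<^bsub>sections (HS k) U\<^esub> h) x
        = germ X (HQ k m) U \<one>\<^bsub>sections (HQ k m) U\<^esub> x"
        using fun_cong[OF eq, of x] x by (simp add: germs_def)
      then obtain W where W: "openin X W" "x \<in> W" "W \<subseteq> U \<inter> U"
        "restr (HQ k m) U W (H m U #>\<^bsub>sections (HS k) U\<^esub> h)
         = restr (HQ k m) U W \<one>\<^bsub>sections (HQ k m) U\<^esub>"
        using Q.germ_eq_iff[OF U c.map_closed[OF U hc] U Q.one_closed[OF U] x] by metis
      have WU: "W \<subseteq> U" using W(3) by blast
      have "H m W #>\<^bsub>sections (HS k) W\<^esub> restr (HS k) U W h = \<one>\<^bsub>sections (HQ k m) W\<^esub>"
        using W(4) c.natural[OF U W(1) WU hc] Q.restr_one[OF U W(1) WU] by metis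
      then have "restr G U W h \<in> H m W"
        using one_iff[OF W(1)] H_restr[OF U W(1) WU h] by simp
      then show ?thesis using W WU by blast
    qed
    define \<U> where "\<U> = {W. openin X W \<and> W \<subseteq> U \<and> restr G U W h \<in> H m W}"
    have "\<Union>\<U> \<subseteq> U" unfolding \<U>_def by blast
    moreover have "x \<in> \<Union>\<U>" if "x \<in> U" for x using loc[OF that] unfolding \<U>_def by blast
    ultimately have un: "\<Union>\<U> = U" by (intro subset_antisym subsetI) blast+
    have hG: "h \<in> \<Gamma> G U" using H_carrier[OF U h] .
    have op: "openin X W" "W \<subseteq> U" "restr G U W h \<in> H m W" if "W \<in> \<U>" for W using that by (auto simp: \<U>_def)
    have compat: "restr G V (V \<inter> W) (restr G U V h) = restr G W (V \<inter> W) (restr G U W h)" if "V \<in> \<U>" "W \<in> \<U>" for V W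
      using op[OF that(1)] op[OF that(2)] U hG by (simp add: G.restr_comp openin_Int)
    have mem: "restr G U V h \<in> \<Gamma> (HS m) V" if "V \<in> \<U>" for V using op(3)[OF that] by simp
    have "\<exists>s\<in>\<Gamma> (HS m) (\<Union>\<U>). \<forall>V\<in>\<U>. restr (HS m) (\<Union>\<U>) V s = restr G U V h"
      unfolding subpresheaf_simps(2)
      by (rule S.gluing[unfolded subpresheaf_simps(2), OF op(1) mem compat])
    then obtain s where s: "s \<in> H m U" "\<And>V. V \<in> \<U> \<Longrightarrow> restr G U V s = restr G U V h"
      unfolding un by auto
    have "s = h"
      by (rule G.locality[of \<U>, unfolded un]) (use op s hG H_carrier[OF U s(1)] in auto)
    then show "h \<in> H m U" using s by simp
  qed
qed

lemma coset_map_coset: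
  assumes le: "m \<le> n" and U: "openin X U" and h: "h \<in> \<Gamma> G U"
  shows "H m U <#>\<^bsub>sections G U\<^esub> (H n U #>\<^bsub>sections G U\<^esub> h) = H m U #>\<^bsub>sections G U\<^esub> h"
proof -
  interpret S: group "sections G U" using U by (rule G.group_sections)
  have sub: "subgroup (H m U) (sections G U)" "subgroup (H n U) (sections G U)" using H_subgroup U by auto
  have "H m U <#>\<^bsub>sections G U\<^esub> (H n U #>\<^bsub>sections G U\<^esub> h) = (H m U <#>\<^bsub>sections G U\<^esub> H n U) #>\<^bsub>sections G U\<^esub> h"
    using sub h by (intro S.setmult_rcos_assoc) (auto simp: subgroup.subset)
  also have "H m U <#>\<^bsub>sections G U\<^esub> H n U = H m U"
  proof (intro subset_antisym subsetI)
    fix z assume "z \<in> H m U <#>\<^bsub>sections G U\<^esub> H n U"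
    then show "z \<in> H m U"
      using H_antimono[OF le U] subgroup.m_closed[OF sub(1)] by (auto simp: set_mult_def)
  next
    fix z assume z: "z \<in> H m U"
    then have "z = z \<otimes>\<^bsub>sections G U\<^esub> \<one>\<^bsub>sections G U\<^esub>" using H_carrier[OF U] by simp
    then show "z \<in> H m U <#>\<^bsub>sections G U\<^esub> H n U"
      using z subgroup.one_closed[OF sub(2)] unfolding set_mult_def by blast
  qed
  finally show ?thesis .
qed

context
  fixes k l m n :: nat
  assumes le: "k \<le> l" "m \<le> n" "k \<le> m" "l \<le> n"
begin

lemma coset_map_morphism:
  "presheaf_morphism X (HQ l n) (HQ k m)
     (\<lambda>U K. H m U <#>\<^bsub>sections G U\<^esub> K)"
proof -
  interpret N: normal_subpresheaf X "HS l" "H n" by (rule HS_normal[OF le(4)])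
  interpret N': normal_subpresheaf X "HS k" "H m" by (rule HS_normal[OF le(3)])
  interpret c: presheaf_morphism X "HS l" "HQ l n" "\<lambda>U s. H n U #>\<^bsub>sections (HS l) U\<^esub> s"
    by (rule N.coset_morphism)
  interpret c': presheaf_morphism X "HS l" "HQ k m" "\<lambda>U s. H m U #>\<^bsub>sections (HS k) U\<^esub> s"
    by (rule presheaf_morphism_comp[OF HS_inclusion[OF le(1)] N'.coset_morphism])
  have val: "H m U <#>\<^bsub>sections G U\<^esub> (H n U #>\<^bsub>sections (HS l) U\<^esub> h) = H m U #>\<^bsub>sections (HS k) U\<^esub> h"
    if "openin X U" "h \<in> \<Gamma> (HS l) U" for U h
    using coset_map_coset[OF le(2) that(1)] H_carrier[OF that(1)] that(2) by simp
  have cases: "\<exists>h \<in> \<Gamma> (HS l) U. K = H n U #>\<^bsub>sections (HS l) U\<^esub> h"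
    if "K \<in> \<Gamma> (HQ l n) U" for U K
    using that N.quotient_cases[of K U] unfolding N.quotient_sections by metis
  show ?thesis
  proof (intro presheaf_morphism.intro quotient_presheaf_HS le presheaf_morphism_axioms.intro homI)
    fix U K assume U: "openin X U" and "K \<in> \<Gamma> (HQ l n) U"
    then obtain h where "h \<in> \<Gamma> (HS l) U" "K = H n U #>\<^bsub>sections (HS l) U\<^esub> h" using cases by blast
    then show "H m U <#>\<^bsub>sections G U\<^esub> K \<in> \<Gamma> (HQ k m) U"
      using val[OF U] c'.map_closed[OF U] by metis
  next
    fix U K L assume U: "openin X U" and "K \<in> \<Gamma> (HQ l n) U"
      "L \<in> \<Gamma> (HQ l n) U"
    then obtain h h' where h: "h \<in> \<Gamma> (HS l) U" "K = H n U #>\<^bsub>sections (HS l) U\<^esub> h"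
      "h' \<in> \<Gamma> (HS l) U" "L = H n U #>\<^bsub>sections (HS l) U\<^esub> h'" using cases by meson
    show "H m U <#>\<^bsub>sections G U\<^esub> (K \<otimes>\<^bsub>sections (HQ l n) U\<^esub> L)
      = (H m U <#>\<^bsub>sections G U\<^esub> K) \<otimes>\<^bsub>sections (HQ k m) U\<^esub> (H m U <#>\<^bsub>sections G U\<^esub> L)"
      unfolding h(2,4) c.map_mult[OF U h(1,3), symmetric] val[OF U h(1)] val[OF U h(3)]
        val[OF U N.mult_closed[OF U h(1,3)]] by (rule c'.map_mult[OF U h(1,3)])
  next
    fix U V K assume U: "openin X U" "openin X V" "V \<subseteq> U"
      and "K \<in> \<Gamma> (HQ l n) U"
    then obtain h where h: "h \<in> \<Gamma> (HS l) U" "K = H n U #>\<^bsub>sections (HS l) U\<^esub> h" using cases by blast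
    show "restr (HQ k m) U V (H m U <#>\<^bsub>sections G U\<^esub> K)
      = H m V <#>\<^bsub>sections G V\<^esub> restr (HQ l n) U V K"
      unfolding h(2) c.natural[OF U h(1)] val[OF U(1) h(1)] val[OF U(2) N.restr_closed[OF U h(1)]]
      by (rule c'.natural[OF U h(1)])
  qed
qed

lemma series_map_morphism: "sheaf_morphism X (SQ l n) (SQ k m) (smap k m)"
proof (intro sheaf_morphism.intro SQ_sheaf le)
  show "presheaf_morphism X (SQ l n) (SQ k m) (smap k m)"
    unfolding SQ_eq series_map_def by (rule presheaf_morphism.stalkwise_morphism[OF coset_map_morphism])
qed

lemma series_map_cls:
  assumes "openin X U" "h \<in> H l U"
  shows "smap k m U (cls l n U h) = cls k m U h"
proof -
  interpret c: presheaf_morphism X "HS l" "HQ l n" "\<lambda>U s. H n U #>\<^bsub>sections (HS l) U\<^esub> s"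
    by (rule normal_subpresheaf.coset_morphism[OF HS_normal[OF le(4)]])
  have "H n U #>\<^bsub>sections G U\<^esub> h \<in> \<Gamma> (HQ l n) U"
    using c.map_closed[OF assms(1), of h] assms(2) by simp
  then show ?thesis
    unfolding series_map_def cls_def
    using presheaf_morphism.stalkwise_germs[OF coset_map_morphism assms(1)]
      coset_map_coset[OF le(2) assms(1) H_carrier[OF assms]] by simp
qed

end

lemma series_short_exact:
  assumes kn: "k \<le> n"
  shows "short_exact X (\<A> n) (SQ k (Suc n)) (SQ k n) (smap k (Suc n)) (smap k n)"
proof -
  have k: "k \<le> Suc n" "n \<le> Suc n" using kn by auto
  interpret A: sheaf_of_groups X "\<A> n" by (rule SQ_sheaf[OF k(2)])
  interpret B: sheaf_of_groups X "SQ k (Suc n)" by (rule SQ_sheaf[OF k(1)])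
  interpret C: sheaf_of_groups X "SQ k n" by (rule SQ_sheaf[OF kn])
  interpret i: sheaf_morphism X "\<A> n" "SQ k (Suc n)" "smap k (Suc n)"
    by (rule series_map_morphism) (use k kn in auto)
  interpret p: sheaf_morphism X "SQ k (Suc n)" "SQ k n" "smap k n"
    by (rule series_map_morphism) (use k kn in auto)
  interpret cA: presheaf_morphism X "HS n" "\<A> n" "cls n (Suc n)"
    by (rule cls_morphism) (use k in auto)
  interpret cB: presheaf_morphism X "HS k" "SQ k (Suc n)" "cls k (Suc n)"
    by (rule cls_morphism) (use k in auto)
  interpret cC: presheaf_morphism X "HS k" "SQ k n" "cls k n"
    by (rule cls_morphism) (use kn in auto)
  have i_cls: "smap k (Suc n) U (cls n (Suc n) U h) = cls k (Suc n) U h"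
    if "openin X U" "h \<in> H n U" for U h
    using that kn by (intro series_map_cls) auto
  have p_cls: "smap k n U (cls k (Suc n) U h) = cls k n U h" if "openin X U" "h \<in> H k U" for U h
    using that kn by (intro series_map_cls) auto
  have inj: "a = \<one>\<^bsub>sections (\<A> n) U\<^esub>"
    if U: "openin X U" and a: "a \<in> \<Gamma> (\<A> n) U"
      and one: "smap k (Suc n) U a = \<one>\<^bsub>sections (SQ k (Suc n)) U\<^esub>" for U a
  proof (rule A.section_eqI[OF U a A.one_closed[OF U]])
    fix x assume x: "x \<in> U"
    obtain V h where V: "openin X V" "x \<in> V" "V \<subseteq> U" and h: "h \<in> H n V"
      and eq: "restr (\<A> n) U V a = cls n (Suc n) V h"
      using cls_locally[OF k(2) a x] by metis
    have "cls k (Suc n) V h = restr (SQ k (Suc n)) U V (smap k (Suc n) U a)"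
      using i.natural[OF U V(1,3) a] eq i_cls[OF V(1) h] by simp
    also have "\<dots> = \<one>\<^bsub>sections (SQ k (Suc n)) V\<^esub>"
      unfolding one by (rule B.restr_one[OF U V(1,3)])
    finally have "h \<in> H (Suc n) V"
      using cls_one_iff[OF k(1) V(1)] h H_antimono[OF kn V(1)] by blast
    then have "restr (\<A> n) U V a = \<one>\<^bsub>sections (\<A> n) V\<^esub>"
      using cls_one_iff[OF k(2) V(1) h] eq by simp
    then show "germ X (\<A> n) U a x = germ X (\<A> n) U \<one>\<^bsub>sections (\<A> n) U\<^esub> x"
      using A.germ_restr[OF U V(1,3,2) a] A.germ_one[OF V(1,2)] A.germ_one[OF U x] by metis
  qed
  show ?thesis
  proof (intro short_exact.intro short_exact_axioms.intro A.sheaf_of_groups_axioms B.sheaf_of_groups_axioms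
      C.sheaf_of_groups_axioms i.sheaf_morphism_axioms p.sheaf_morphism_axioms)
    fix U a assume U: "openin X U" and a: "a \<in> \<Gamma> (\<A> n) U"
    show "a = \<one>\<^bsub>sections (\<A> n) U\<^esub>" if "smap k (Suc n) U a = \<one>\<^bsub>sections (SQ k (Suc n)) U\<^esub>"
      using inj[OF U a that] .
    have ia: "smap k (Suc n) U a \<in> \<Gamma> (SQ k (Suc n)) U"
      by (rule i.map_closed[OF U a])
    show "smap k n U (smap k (Suc n) U a) = \<one>\<^bsub>sections (SQ k n) U\<^esub>"
    proof (rule C.section_eqI[OF U p.map_closed[OF U ia] C.one_closed[OF U]])
      fix x assume x: "x \<in> U"
      obtain V h where V: "openin X V" "x \<in> V" "V \<subseteq> U" and h: "h \<in> H n V"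
        and eq: "restr (\<A> n) U V a = cls n (Suc n) V h"
        using cls_locally[OF k(2) a x] by metis
      have hk: "h \<in> H k V" using h H_antimono[OF kn V(1)] by blast
      have "restr (SQ k n) U V (smap k n U (smap k (Suc n) U a)) = cls k n V h"
        using i.natural[OF U V(1,3) a] p.natural[OF U V(1,3) ia] eq i_cls[OF V(1) h] p_cls[OF V(1) hk] by simp
      also have "\<dots> = \<one>\<^bsub>sections (SQ k n) V\<^esub>" using cls_one_iff[OF kn V(1) hk] h by simp
      finally show "germ X (SQ k n) U (smap k n U (smap k (Suc n) U a)) x
          = germ X (SQ k n) U \<one>\<^bsub>sections (SQ k n) U\<^esub> x"
        using C.germ_restr[OF U V(1,3,2) p.map_closed[OF U ia]] C.germ_one[OF V(1,2)] C.germ_one[OF U x] by metis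
    qed
  next
    fix U b assume U: "openin X U" and b: "b \<in> \<Gamma> (SQ k (Suc n)) U"
      and one: "smap k n U b = \<one>\<^bsub>sections (SQ k n) U\<^esub>"
    show "\<exists>a\<in>\<Gamma> (\<A> n) U. smap k (Suc n) U a = b"
    proof (rule i.locally_in_image[OF inj U b])
      fix x assume x: "x \<in> U"
      obtain V h where V: "openin X V" "x \<in> V" "V \<subseteq> U" and h: "h \<in> H k V"
        and eq: "restr (SQ k (Suc n)) U V b = cls k (Suc n) V h"
        using cls_locally[OF k(1) b x] by metis
      have "cls k n V h = restr (SQ k n) U V (smap k n U b)"
        using p.natural[OF U V(1,3) b] eq p_cls[OF V(1) h] by simp
      also have "\<dots> = \<one>\<^bsub>sections (SQ k n) V\<^esub>"
        unfolding one by (rule C.restr_one[OF U V(1,3)])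
      finally have hn: "h \<in> H n V" using cls_one_iff[OF kn V(1) h] by simp
      then have "cls n (Suc n) V h \<in> \<Gamma> (\<A> n) V"
        using cA.map_closed[OF V(1)] by simp
      then show "\<exists>V a. openin X V \<and> x \<in> V \<and> V \<subseteq> U \<and> a \<in> \<Gamma> (\<A> n) V \<and>
          smap k (Suc n) V a = restr (SQ k (Suc n)) U V b"
        using V i_cls[OF V(1) hn] eq by metis
    qed
  next
    fix U c x assume U: "openin X U" and c: "c \<in> \<Gamma> (SQ k n) U" and x: "x \<in> U"
    obtain V h where V: "openin X V" "x \<in> V" "V \<subseteq> U" and h: "h \<in> H k V"
      and eq: "restr (SQ k n) U V c = cls k n V h"
      using cls_locally[OF kn c x] by metis
    have "cls k (Suc n) V h \<in> \<Gamma> (SQ k (Suc n)) V" using cB.map_closed[OF V(1)] h by simp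
    then show "\<exists>V b. openin X V \<and> x \<in> V \<and> V \<subseteq> U \<and> b \<in> \<Gamma> (SQ k (Suc n)) V \<and>
        smap k n V b = restr (SQ k n) U V c"
      using V p_cls[OF V(1) h] eq by metis
  qed
qed

lemma series_central_extension:
  assumes c: "central_at X G H k n"
  shows "central_extension X (\<A> n) (SQ k (Suc n)) (SQ k n) (smap k (Suc n)) (smap k n)"
proof (intro central_extension.intro central_extension_axioms.intro abelian_presheaf.intro abelian_presheaf_axioms.intro)
  show "short_exact X (\<A> n) (SQ k (Suc n)) (SQ k n) (smap k (Suc n)) (smap k n)"
    using c by (intro series_short_exact) (simp add: central_at_def)
  show "presheaf_of_groups X (\<A> n)"
    using SQ_sheaf[of n "Suc n"] by (simp add: sheaf_of_groups_def)
  show "comm_group (sections (\<A> n) U)" if "openin X U" for U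
    using series that by (simp add: AQ_normal_series_def sheaf_of_abelian_groups_def)
qed (use c in \<open>simp add: central_at_def\<close>)

end

section \<open>The complex\<close>

context normal_series
begin

lemma partial2_partial1:
  assumes k: "central_at X G H k (Suc j)" and l: "central_at X G H l (Suc (Suc j))"
    and s: "s \<in> \<Gamma> (\<A> j) (topspace X)"
  shows "partial2 X G H l (Suc (Suc j)) (partial1 X G H k (Suc j) s) = \<one>\<^bsub>H2 X (\<A> (Suc (Suc j)))\<^esub>"
proof -
  have kj: "k \<le> j" and lj: "l \<le> Suc j" using k l by (auto simp: central_at_def)
  interpret E1: central_extension X "\<A> (Suc j)" "SQ k (Suc (Suc j))" "SQ k (Suc j)"
    "smap k (Suc (Suc j))" "smap k (Suc j)"
    by (rule series_central_extension[OF k])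
  interpret E2: central_extension X "\<A> (Suc (Suc j))" "SQ l (Suc (Suc (Suc j)))" "SQ l (Suc (Suc j))"
    "smap l (Suc (Suc (Suc j)))" "smap l (Suc (Suc j))"
    by (rule series_central_extension[OF l])
  interpret HJ: presheaf_of_groups X "HS j" by (rule HS_presheaf)
  interpret HJ1: sheaf_of_groups X "HS (Suc j)" by (rule HS_sheaf)
  interpret q: sheaf_morphism X "\<A> j" "SQ k (Suc j)" "smap k (Suc j)"
    by (rule series_map_morphism) (use kj in auto)
  interpret q0: sheaf_morphism X "\<A> j" "SQ 0 (Suc j)" "smap 0 (Suc j)"
    by (rule series_map_morphism) auto
  interpret r: sheaf_morphism X "\<A> (Suc j)" "SQ l (Suc (Suc j))" "smap l (Suc (Suc j))"
    by (rule series_map_morphism) (use lj in auto)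
  interpret c0: presheaf_morphism X "HS j" "SQ 0 (Suc j)" "cls 0 (Suc j)"
    by (rule cls_morphism) auto
  interpret cB: presheaf_morphism X "HS j" "SQ k (Suc (Suc j))" "cls k (Suc (Suc j))"
    by (rule cls_morphism) (use kj in auto)
  interpret cA: presheaf_morphism X "HS (Suc j)" "\<A> (Suc j)" "cls (Suc j) (Suc (Suc j))"
    by (rule cls_morphism) auto
  interpret cL: sheaf_morphism X "HS (Suc j)" "SQ l (Suc (Suc (Suc j)))" "cls l (Suc (Suc (Suc j)))"
    by (intro sheaf_morphism.intro HS_sheaf SQ_sheaf cls_morphism) (use lj in auto)
  define \<U> where "\<U> = {U. openin X U \<and> (\<exists>h\<in>H j U. restr (\<A> j) (topspace X) U s = cls j (Suc j) U h)}"
  have "x \<in> \<Union>\<U>" if x: "x \<in> topspace X" for x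
  proof -
    obtain V h where "openin X V" "x \<in> V" "V \<subseteq> topspace X" "h \<in> H j V"
      "restr (\<A> j) (topspace X) V s = cls j (Suc j) V h"
      using cls_locally[of j "Suc j", OF _ s x] by auto
    then show ?thesis unfolding \<U>_def by blast
  qed
  moreover have "\<Union>\<U> \<subseteq> topspace X" unfolding \<U>_def using openin_subset by blast
  ultimately have "\<Union>\<U> = topspace X" by (intro subset_antisym subsetI) blast+
  then have cov: "open_cover X \<U>" unfolding open_cover_def by (auto simp: \<U>_def)
  have op: "openin X U" "U \<subseteq> topspace X" if "U \<in> \<U>" for U
    using open_cover_openin[OF cov that] openin_subset by auto
  have "\<forall>U\<in>\<U>. \<exists>h. h \<in> H j U \<and> restr (\<A> j) (topspace X) U s = cls j (Suc j) U h"
    unfolding \<U>_def by blast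
  then obtain h where h: "\<And>U. U \<in> \<U> \<Longrightarrow> h U \<in> H j U"
    and sh: "\<And>U. U \<in> \<U> \<Longrightarrow> restr (\<A> j) (topspace X) U s = cls j (Suc j) U (h U)" by metis
  have hG: "h U \<in> \<Gamma> G U" if "U \<in> \<U>" for U using H_carrier[OF op(1) h] that by blast
  define c where "c U V = inv\<^bsub>sections G (U \<inter> V)\<^esub> (restr G U (U \<inter> V) (h U))
      \<otimes>\<^bsub>sections G (U \<inter> V)\<^esub> restr G V (U \<inter> V) (h V)" for U V
  have o: "openin X (U \<inter> V)" if "U \<in> \<U>" "V \<in> \<U>" for U V using op(1) that by blast
  have rh: "restr G U (U \<inter> V) (h U) \<in> H j (U \<inter> V)" "restr G V (U \<inter> V) (h V) \<in> H j (U \<inter> V)"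
    if "U \<in> \<U>" "V \<in> \<U>" for U V
    using H_restr[OF op(1)[OF that(1)] o[OF that] Int_lower1 h[OF that(1)]]
      H_restr[OF op(1)[OF that(2)] o[OF that] Int_lower2 h[OF that(2)]] .
  have rc: "restr (HS j) U (U \<inter> V) (h U) \<in> \<Gamma> (HS j) (U \<inter> V)"
    "restr (HS j) V (U \<inter> V) (h V) \<in> \<Gamma> (HS j) (U \<inter> V)"
    if "U \<in> \<U>" "V \<in> \<U>" for U V using rh[OF that] by simp_all
  have hc: "h U \<in> \<Gamma> (HS j) U" if "U \<in> \<U>" for U using h that by simp
  have c_eq: "c U V = inv\<^bsub>sections (HS j) (U \<inter> V)\<^esub> (restr (HS j) U (U \<inter> V) (h U))
      \<otimes>\<^bsub>sections (HS j) (U \<inter> V)\<^esub> restr (HS j) V (U \<inter> V) (h V)" if "U \<in> \<U>" "V \<in> \<U>" for U V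
    using HS_inv[OF o[OF that] rh(1)[OF that]] by (simp add: c_def)
  have cj: "c U V \<in> \<Gamma> (HS j) (U \<inter> V)" if "U \<in> \<U>" "V \<in> \<U>" for U V
    unfolding c_eq[OF that] by (intro HJ.mult_closed HJ.inverse_closed o that rc)
  \<comment> \<open>Computed in \<open>H\<^sub>0 / H\<^sub>j\<^sub>+\<^sub>1\<close>, where the class of \<open>c U V\<close> is a quotient of two restrictions of the
    image of \<open>s\<close>.\<close>
  have cH: "c U V \<in> H (Suc j) (U \<inter> V)" if UV: "U \<in> \<U>" "V \<in> \<U>" for U V
  proof -
    have s0: "restr (SQ 0 (Suc j)) (topspace X) W (smap 0 (Suc j) (topspace X) s) = cls 0 (Suc j) W (h W)"
      if "W \<in> \<U>" for W
      using q0.natural[OF openin_topspace op[OF that] s] sh[OF that] series_map_cls[of 0 j "Suc j" "Suc j" W "h W"]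
        op[OF that] h[OF that] by simp
    have s0c: "smap 0 (Suc j) (topspace X) s \<in> \<Gamma> (SQ 0 (Suc j)) (topspace X)"
      using s by (intro q0.map_closed) auto
    have *: "cls 0 (Suc j) (U \<inter> V) (restr (HS j) W (U \<inter> V) (h W))
        = restr (SQ 0 (Suc j)) (topspace X) (U \<inter> V) (smap 0 (Suc j) (topspace X) s)"
      if "W \<in> \<U>" "U \<inter> V \<subseteq> W" for W
      using c0.natural[OF op(1)[OF that(1)] o[OF UV] that(2) hc[OF that(1)]] s0[OF that(1)]
        q0.cod.restr_comp[OF openin_topspace op(1)[OF that(1)] o[OF UV] that(2) op(2)[OF that(1)] s0c] by simp
    have eq: "cls 0 (Suc j) (U \<inter> V) (restr (HS j) U (U \<inter> V) (h U)) = cls 0 (Suc j) (U \<inter> V) (restr (HS j) V (U \<inter> V) (h V))"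
      using *[OF UV(1)] *[OF UV(2)] by simp
    interpret S: group "sections (SQ 0 (Suc j)) (U \<inter> V)" by (rule q0.cod.group_sections[OF o[OF UV]])
    have "cls 0 (Suc j) (U \<inter> V) (c U V) = \<one>\<^bsub>sections (SQ 0 (Suc j)) (U \<inter> V)\<^esub>"
      unfolding c_eq[OF UV] c0.map_mult[OF o[OF UV] HJ.inverse_closed[OF o[OF UV] rc(1)[OF UV]] rc(2)[OF UV]]
        c0.map_inv[OF o[OF UV] rc(1)[OF UV]] eq
      by (rule S.l_inv[OF c0.map_closed[OF o[OF UV] rc(2)[OF UV]]])
    moreover have "c U V \<in> H 0 (U \<inter> V)"
      using cj[OF UV] H_antimono[of 0 j, OF _ o[OF UV]] by auto
    ultimately show ?thesis
      using cls_one_iff[of 0 "Suc j", OF _ o[OF UV]] by simp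
  qed
  have cG: "c U V \<in> \<Gamma> G (U \<inter> V)" if "U \<in> \<U>" "V \<in> \<U>" for U V
    using H_carrier[OF o cH] that by blast
  have "(\<U>, c) \<in> cech_cocycles X G"
    unfolding G.cocycle_iff
  proof (intro conjI ballI cov cG)
    fix U V W x assume UVW: "U \<in> \<U>" "V \<in> \<U>" "W \<in> \<U>" and x: "x \<in> U \<inter> V \<inter> W"
    interpret S: group "stalk X G x" using G.group_stalk_on[OF op(1)[OF UVW(1)]] x by blast
    have g: "germ X G (U \<inter> V) (c U V) x = inv\<^bsub>stalk X G x\<^esub> germ X G U (h U) x \<otimes>\<^bsub>stalk X G x\<^esub> germ X G V (h V) x"
      if UV: "U \<in> \<U>" "V \<in> \<U>" "x \<in> U" "x \<in> V" for U V
      unfolding c_def using UV op(1) o[OF UV(1,2)] hG by (simp add: G.germ_mult G.germ_inv G.germ_restr)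
    have hg: "germ X G U (h U) x \<in> carrier (stalk X G x)" if "U \<in> \<U>" "x \<in> U" for U
      using that op(1) hG by simp
    show "germ X G (U \<inter> V) (c U V) x \<otimes>\<^bsub>stalk X G x\<^esub> germ X G (V \<inter> W) (c V W) x = germ X G (U \<inter> W) (c U W) x"
      using UVW x hg by (simp add: g S.m_assoc S.cancel_simps)
  qed
  then have c: "(\<U>, c) \<in> cech_cocycles X (HS (Suc j))"
    using cH by (simp add: cech_cocycles_def)
  define z where "z U V = cls (Suc j) (Suc (Suc j)) (U \<inter> V) (c U V)" for U V
  have z: "z U V \<in> \<Gamma> (\<A> (Suc j)) (U \<inter> V)" if "U \<in> \<U>" "V \<in> \<U>" for U V
    unfolding z_def using cA.map_closed[OF o[OF that]] cH[OF that] by simp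
  have rep: "E1.delta1_rep (smap k (Suc j) (topspace X) s) \<U> z (\<lambda>U. cls k (Suc (Suc j)) U (h U))"
    unfolding E1.delta1_rep_def
  proof (intro conjI ballI cov z)
    fix U assume U: "U \<in> \<U>"
    show "cls k (Suc (Suc j)) U (h U) \<in> \<Gamma> (SQ k (Suc (Suc j))) U"
      by (rule cB.map_closed[OF op(1) hc, OF U U])
    have hk: "h U \<in> H k U" using h[OF U] H_antimono[OF kj op(1)[OF U]] by blast
    have "smap k (Suc j) U (cls k (Suc (Suc j)) U (h U)) = cls k (Suc j) U (h U)"
      using kj hk op(1)[OF U] by (intro series_map_cls) auto
    also have "\<dots> = smap k (Suc j) U (cls j (Suc j) U (h U))"
      using kj h op(1) U by (intro series_map_cls [symmetric]) auto
    also have "\<dots> = restr (SQ k (Suc j)) (topspace X) U (smap k (Suc j) (topspace X) s)"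
      using q.natural[OF openin_topspace op[OF U] s] sh[OF U] by simp
    finally show "smap k (Suc j) U (cls k (Suc (Suc j)) U (h U))
      = restr (SQ k (Suc j)) (topspace X) U (smap k (Suc j) (topspace X) s)" .
  next
    fix U V x assume UV: "U \<in> \<U>" "V \<in> \<U>" and x: "x \<in> U \<inter> V"
    let ?b = "\<lambda>U. cls k (Suc (Suc j)) U (h U)"
    have b: "?b U \<in> \<Gamma> (SQ k (Suc (Suc j))) U" "?b V \<in> \<Gamma> (SQ k (Suc (Suc j))) V"
      using cB.map_closed[OF op(1) hc] UV by blast+
    have r: "restr (SQ k (Suc (Suc j))) U (U \<inter> V) (?b U) \<in> \<Gamma> (SQ k (Suc (Suc j))) (U \<inter> V)"
      "restr (SQ k (Suc (Suc j))) V (U \<inter> V) (?b V) \<in> \<Gamma> (SQ k (Suc (Suc j))) (U \<inter> V)"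
      using E1.B.restr_closed[OF op(1)[OF UV(1)] o[OF UV] Int_lower1 b(1)]
        E1.B.restr_closed[OF op(1)[OF UV(2)] o[OF UV] Int_lower2 b(2)] .
    have "smap k (Suc (Suc j)) (U \<inter> V) (z U V) = cls k (Suc (Suc j)) (U \<inter> V) (c U V)"
      unfolding z_def using kj cH[OF UV] o[OF UV] by (intro series_map_cls) auto
    also have "\<dots> = inv\<^bsub>sections (SQ k (Suc (Suc j))) (U \<inter> V)\<^esub> (restr (SQ k (Suc (Suc j))) U (U \<inter> V) (?b U))
        \<otimes>\<^bsub>sections (SQ k (Suc (Suc j))) (U \<inter> V)\<^esub> restr (SQ k (Suc (Suc j))) V (U \<inter> V) (?b V)"
      unfolding c_eq[OF UV] cB.map_mult[OF o[OF UV] HJ.inverse_closed[OF o[OF UV] rc(1)[OF UV]] rc(2)[OF UV]]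
        cB.map_inv[OF o[OF UV] rc(1)[OF UV]] cB.natural[OF op(1)[OF UV(1)] o[OF UV] Int_lower1 hc[OF UV(1)]]
        cB.natural[OF op(1)[OF UV(2)] o[OF UV] Int_lower2 hc[OF UV(2)]] ..
    finally have iz: "smap k (Suc (Suc j)) (U \<inter> V) (z U V) = \<dots>" .
    show "E1.\<iota> x (germ X (\<A> (Suc j)) (U \<inter> V) (z U V) x)
       = inv\<^bsub>stalk X (SQ k (Suc (Suc j))) x\<^esub> germ X (SQ k (Suc (Suc j))) U (?b U) x
         \<otimes>\<^bsub>stalk X (SQ k (Suc (Suc j))) x\<^esub> germ X (SQ k (Suc (Suc j))) V (?b V) x"
      unfolding E1.i.stalk_map_germ[OF o[OF UV] x z[OF UV]] iz
        E1.B.germ_mult[OF o[OF UV] x E1.B.inverse_closed[OF o[OF UV] r(1)] r(2)]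
        E1.B.germ_inv[OF o[OF UV] x r(1)] E1.B.germ_restr[OF op(1)[OF UV(1)] o[OF UV] Int_lower1 x b(1)]
        E1.B.germ_restr[OF op(1)[OF UV(2)] o[OF UV] Int_lower2 x b(2)] ..
  qed
  have sk: "smap k (Suc j) (topspace X) s \<in> \<Gamma> (SQ k (Suc j)) (topspace X)"
    by (rule q.map_closed[OF openin_topspace s])
  have p1: "partial1 X G H k (Suc j) s = cech_cohomologous X (\<A> (Suc j)) `` {(\<U>, z)}"
    unfolding partial1_def by (rule E1.delta1_class[OF rep sk])
  have zc: "(\<U>, z) \<in> cech_cocycles X (\<A> (Suc j))" by (rule E1.delta1_rep_cocycle[OF rep])
  show ?thesis
    unfolding partial2_def p1 r.H1_map_class[OF zc]
  proof (rule E2.delta2_trivial_if_cocycle_lifts[OF r.cocycle_map[OF zc] cL.cocycle_map[OF c]])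
    fix U V assume UV: "U \<in> \<U>" "V \<in> \<U>"
    have cl: "c U V \<in> H l (U \<inter> V)" using cH[OF UV] H_antimono[OF lj o[OF UV]] by blast
    have "smap l (Suc (Suc j)) (U \<inter> V) (cls l (Suc (Suc (Suc j))) (U \<inter> V) (c U V))
        = cls l (Suc (Suc j)) (U \<inter> V) (c U V)"
      using lj cl o[OF UV] by (intro series_map_cls) auto
    also have "\<dots> = smap l (Suc (Suc j)) (U \<inter> V) (z U V)"
      unfolding z_def using lj cH[OF UV] o[OF UV] by (intro series_map_cls [symmetric]) auto
    finally show "smap l (Suc (Suc j)) (U \<inter> V) (cls l (Suc (Suc (Suc j))) (U \<inter> V) (c U V))
      = smap l (Suc (Suc j)) (U \<inter> V) (z U V)" .
  qed
qed

end

theorem proposition2p9: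
  fixes X :: "'a topology"
    and G :: "('a, 'g) presheaf"
    and H :: "nat \<Rightarrow> 'a set \<Rightarrow> 'g set"
    and j k l :: nat
  assumes "AQ_central_series X G H"
    and "central_at X G H k (j + 1)"
    and "central_at X G H l (j + 2)"
  shows "pointed_complex
           (carrier (H0 X (AQ X G H j)), \<one>\<^bsub>H0 X (AQ X G H j)\<^esub>)
           (partial1 X G H k (j + 1))
           (H1 X (AQ X G H (j + 1)), H1_base X (AQ X G H (j + 1)))
           (partial2 X G H l (j + 2))
           (carrier (H2 X (AQ X G H (j + 2))), \<one>\<^bsub>H2 X (AQ X G H (j + 2))\<^esub>)"
proof -
  interpret normal_series X G H
    using assms(1) by unfold_locales (simp add: AQ_central_series_def)
  have k: "central_at X G H k (Suc j)" and l: "central_at X G H l (Suc (Suc j))"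
    using assms by simp_all
  have kj: "k \<le> j" and lj: "l \<le> Suc j" using k l by (auto simp: central_at_def)
  interpret E1: central_extension X "\<A> (Suc j)" "SQ k (Suc (Suc j))" "SQ k (Suc j)"
    "smap k (Suc (Suc j))" "smap k (Suc j)"
    by (rule series_central_extension[OF k])
  interpret E2: central_extension X "\<A> (Suc (Suc j))" "SQ l (Suc (Suc (Suc j)))" "SQ l (Suc (Suc j))"
    "smap l (Suc (Suc (Suc j)))" "smap l (Suc (Suc j))"
    by (rule series_central_extension[OF l])
  interpret q: sheaf_morphism X "\<A> j" "SQ k (Suc j)" "smap k (Suc j)"
    by (rule series_map_morphism) (use kj in auto)
  interpret r: sheaf_morphism X "\<A> (Suc j)" "SQ l (Suc (Suc j))" "smap l (Suc (Suc j))"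
    by (rule series_map_morphism) (use lj in auto)
  let ?one = "\<one>\<^bsub>sections (\<A> j) (topspace X)\<^esub>"
  have one: "?one \<in> \<Gamma> (\<A> j) (topspace X)"
    by (rule q.dom.one_closed[OF openin_topspace])
  have base: "partial1 X G H k (Suc j) ?one = H1_base X (\<A> (Suc j))"
    unfolding partial1_def q.map_one[OF openin_topspace] by (rule E1.delta1_one)
  have comp: "partial2 X G H l (Suc (Suc j)) (partial1 X G H k (Suc j) s) = \<one>\<^bsub>H2 X (\<A> (Suc (Suc j)))\<^esub>"
    if "s \<in> \<Gamma> (\<A> j) (topspace X)" for s
    by (rule partial2_partial1[OF k l that])
  have p1: "partial1 X G H k (Suc j) s \<in> H1 X (\<A> (Suc j))"
    if "s \<in> \<Gamma> (\<A> j) (topspace X)" for s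
    unfolding partial1_def by (rule E1.delta1_in_H1[OF q.map_closed[OF openin_topspace that]])
  have p2: "partial2 X G H l (Suc (Suc j)) c \<in> carrier (H2 X (\<A> (Suc (Suc j))))"
    if c: "c \<in> H1 X (\<A> (Suc j))" for c
  proof -
    obtain \<U> g where g: "(\<U>, g) \<in> cech_cocycles X (\<A> (Suc j))"
      "c = cech_cohomologous X (\<A> (Suc j)) `` {(\<U>, g)}"
      using E1.A.H1_cases[OF c] by metis
    show ?thesis
      unfolding partial2_def g(2) r.H1_map_class[OF g(1)]
      by (intro E2.delta2_in_H2 E2.C.cocycle_class_in_H1 r.cocycle_map g)
  qed
  have base_mem: "H1_base X (\<A> (Suc j)) \<in> H1 X (\<A> (Suc j))"
    using p1[OF one] base by simp
  have "pointed_complex (carrier (H0 X (\<A> j)), \<one>\<^bsub>H0 X (\<A> j)\<^esub>) (partial1 X G H k (Suc j))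
     (H1 X (\<A> (Suc j)), H1_base X (\<A> (Suc j))) (partial2 X G H l (Suc (Suc j)))
     (carrier (H2 X (\<A> (Suc (Suc j)))), \<one>\<^bsub>H2 X (\<A> (Suc (Suc j)))\<^esub>)"
    unfolding pointed_complex_def pointed_map_def H0_def fst_conv snd_conv
    using one base comp[OF one] comp p1 p2 base_mem p2[OF base_mem] by auto
  then show ?thesis by simp
qed

end
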